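(* Let $n\ge2$, $0\le l<k\le n-1$, $\theta\in(0,\frac{\pi}{2})$ and $p\ge1$. Let $f$ be a positive smooth function on $\mathcal{C}_\theta$ satisfying $$\nabla^2 f^{-\frac{1}{p+k-l-1}}+f^{-\frac{1}{p+k-l-1}}\sigma\ge 0\ \text{ in }\mathcal{C}_\theta,\qquad \nabla_\mu f+\cot\theta\,(p+k-l-1)f\ge 0\ \text{ on }\partial\mathcal{C}_\theta.$$ Let $h\in C^4(\mathcal{C}_\theta)$ be a positive admissible solution of $$\frac{\sigma_k(\nabla^2h+h\sigma)}{\sigma_l(\nabla^2h+h\sigma)}=f\,h^{p-1}\ \text{ in }\mathcal{C}_\theta,\qquad \nabla_\mu h=\cot\theta\, h\ \text{ on }\partial\mathcal{C}_\theta,$$ such that $W=\nabla^2h+h\sigma$ is positive semi-definite on $\mathcal{C}_\theta$. Then $W$ is positive definite on $\mathcal{C}_\theta$, i.e. $h$ is strictly convex.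
   Context: Let $e=-E_{n+1}$, $E_1,\dots,E_{n+1}$ the standard basis of $\mathbb{R}^{n+1}$, $\overline{\mathbb{R}^{n+1}_+}=\{x_{n+1}\ge0\}$. $\mathcal{C}_\theta=\{\xi\in\overline{\mathbb{R}^{n+1}_+}:|\xi-\cos\theta\,e|=1\}$ with round metric $\sigma$, connection $\nabla$, unit outward conormal $\mu$ of $\partial\mathcal{C}_\theta$. $\sigma_j(W)$ is the $j$-th elementary symmetric function of the eigenvalues of $W$ ($\sigma_0=1$); $\Gamma_k=\{\lambda\in\mathbb{R}^n:\sigma_i(\lambda)>0,1\le i\le k\}$; $h$ is admissible if the eigenvalues of $W=\nabla^2h+h\sigma$ lie in $\Gamma_k$ everywhere. *)

theory Defs
  imports "HOL-Analysis.Analysis"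
begin

text \<open>Ambient space R^{n+1} is an abstract euclidean space 'a with DIM('a) = n+1.
  The vector b is a standard basis vector playing the role of E_{n+1}; e = -b.\<close>

fun Ck :: "nat \<Rightarrow> 'a::euclidean_space set \<Rightarrow> ('a \<Rightarrow> real) \<Rightarrow> bool" where
  "Ck 0 U f = continuous_on U f"
| "Ck (Suc k) U f = (f differentiable_on U \<and>
      (\<forall>i\<in>Basis. Ck k U (\<lambda>x. frechet_derivative f (at x) i)))"

definition smooth_on_set :: "'a::euclidean_space set \<Rightarrow> ('a \<Rightarrow> real) \<Rightarrow> bool" where
  "smooth_on_set U f = (\<forall>k. Ck k U f)"

definition Dd :: "('a::euclidean_space \<Rightarrow> real) \<Rightarrow> 'a \<Rightarrow> 'a \<Rightarrow> real" where
  "Dd f x u = frechet_derivative f (at x) u"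

definition D2 :: "('a::euclidean_space \<Rightarrow> real) \<Rightarrow> 'a \<Rightarrow> 'a \<Rightarrow> 'a \<Rightarrow> real" where
  "D2 f x u v = frechet_derivative (\<lambda>y. frechet_derivative f (at y) u) (at x) v"

definition capC :: "'a::euclidean_space \<Rightarrow> real \<Rightarrow> 'a set" where
  "capC b \<theta> = {\<xi>. \<xi> \<bullet> b \<ge> 0 \<and> norm (\<xi> - cos \<theta> *\<^sub>R (- b)) = 1}"

definition capBd :: "'a::euclidean_space \<Rightarrow> real \<Rightarrow> 'a set" where
  "capBd b \<theta> = {\<xi> \<in> capC b \<theta>. \<xi> \<bullet> b = 0}"

definition capN :: "'a::euclidean_space \<Rightarrow> real \<Rightarrow> 'a \<Rightarrow> 'a" where
  "capN b \<theta> \<xi> = \<xi> - cos \<theta> *\<^sub>R (- b)"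

text \<open>Unit outward conormal mu of the boundary of C_theta: the unit tangent vector
  to the sphere, orthogonal to the boundary, pointing out of C_theta (towards -b).\<close>
definition conormal :: "'a::euclidean_space \<Rightarrow> real \<Rightarrow> 'a \<Rightarrow> 'a" where
  "conormal b \<theta> \<xi> = (let N = capN b \<theta> \<xi>; t = - b + (b \<bullet> N) *\<^sub>R N in t /\<^sub>R norm t)"

text \<open>Spherical (Levi-Civita) Hessian of h at xi on tangent vectors u v, via the
  extrinsic formula: D^2 h(u,v) - <u,v> Dh(N) (unit sphere, second fundamental form = metric).\<close>
definition sphHess :: "'a::euclidean_space \<Rightarrow> real \<Rightarrow> ('a \<Rightarrow> real) \<Rightarrow> 'a \<Rightarrow> 'a \<Rightarrow> 'a \<Rightarrow> real" where
  "sphHess b \<theta> h \<xi> u v = D2 h \<xi> u v - (u \<bullet> v) * Dd h \<xi> (capN b \<theta> \<xi>)"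

definition Wform :: "'a::euclidean_space \<Rightarrow> real \<Rightarrow> ('a \<Rightarrow> real) \<Rightarrow> 'a \<Rightarrow> 'a \<Rightarrow> 'a \<Rightarrow> real" where
  "Wform b \<theta> h \<xi> u v = sphHess b \<theta> h \<xi> u v + h \<xi> * (u \<bullet> v)"

definition tangent :: "'a::euclidean_space \<Rightarrow> real \<Rightarrow> 'a \<Rightarrow> 'a \<Rightarrow> bool" where
  "tangent b \<theta> \<xi> u = (u \<bullet> capN b \<theta> \<xi> = 0)"

definition eigvals :: "'a::euclidean_space \<Rightarrow> real \<Rightarrow> ('a \<Rightarrow> 'a \<Rightarrow> real) \<Rightarrow> 'a \<Rightarrow> (nat \<Rightarrow> real) \<Rightarrow> bool" where
  "eigvals b \<theta> W \<xi> lam = (\<exists>v::nat \<Rightarrow> 'a.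
      (\<forall>i < DIM('a) - 1. tangent b \<theta> \<xi> (v i)) \<and>
      (\<forall>i < DIM('a) - 1. \<forall>j < DIM('a) - 1. v i \<bullet> v j = (if i = j then 1 else 0)) \<and>
      (\<forall>i < DIM('a) - 1. \<forall>j < DIM('a) - 1. W (v i) (v j) = (if i = j then lam i else 0)))"

definition esym :: "nat \<Rightarrow> nat \<Rightarrow> (nat \<Rightarrow> real) \<Rightarrow> real" where
  "esym n j lam = (\<Sum>S \<in> {S. S \<subseteq> {..<n} \<and> card S = j}. \<Prod>i\<in>S. lam i)"

definition inGamma :: "nat \<Rightarrow> nat \<Rightarrow> (nat \<Rightarrow> real) \<Rightarrow> bool" where
  "inGamma n k lam = (\<forall>i. 1 \<le> i \<and> i \<le> k \<longrightarrow> esym n i lam > 0)"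

end

theory Submission
  imports Defs "Jordan_Normal_Form.Determinant"
begin

no_notation scalar_prod (infix "\<bullet>" 70)
hide_const (open) Matrix.orthogonal
hide_fact (open) Matrix.orthogonal_def

text \<open>
  Extend \<open>h\<close> to the cone over the cap by \<open>H y = |y| h (y/|y| - cos \<theta> b)\<close>. Then \<open>W\<close> becomes the
  Euclidean Hessian of \<open>H\<close>, the Robin condition becomes \<open>\<partial>\<^sub>b H = 0\<close>, and the equation becomes
  \<open>log \<sigma>\<^sub>k - log \<sigma>\<^sub>l = (p - 1) log H - \<gamma> log G\<close> on the Hessian of \<open>H\<close>, where \<open>G\<close> is the extension of
  a power of \<open>f\<close>; the hypotheses on \<open>f\<close> say that \<open>G\<close> is convex with \<open>\<partial>\<^sub>b G \<ge> 0\<close> on the boundary.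
  At a minimum of \<open>h\<close> the form \<open>W\<close> is positive definite. If it degenerated elsewhere, a multiple
  \<open>\<epsilon> exp (A \<langle>z, y\<rangle> / |y|)\<close> of a barrier centred at a point \<open>z\<close> of definiteness would touch the
  smallest eigenvalue from below. Interior touching contradicts the inverse concavity of Hessian
  quotients together with the convexity of \<open>G\<close>; boundary touching contradicts the third-order
  identities obtained by differentiating the Neumann condition.
\<close>

section \<open>Second-order jets\<close>

text \<open>The smallest eigenvalue need not be differentiable, so the minimum is taken over unit
  tangent pairs \<open>(y, v)\<close> and \<open>v\<close> is moved together with \<open>y\<close>;
  choosing the velocity of \<open>v\<close> by completing a square produces exactly the term
  \<open>2 * (X a i)^2 / x i\<close> that inverse concavity asks for. Division by eigenvalues is the
  obstacle, since \<open>W\<close> is only semi-definite and the radial direction is always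
  degenerate: every denominator is shifted by \<open>\<eta> > 0\<close>, and the shift is removed by
  a limit. The exponent in the condition on \<open>f\<close> is forced twice:
  \<open>\<gamma> = p - 1 + (k - l)\<close> makes the equation homogeneous on the cone, and it is
  the sum of the two weights in the Cauchy-Schwarz inequality that absorbs the first-order terms. At
  a touching point all errors are at most a constant times \<open>\<phi> * (1 + A)\<close>, where
  \<open>\<phi>\<close> is the value of the barrier. Hence \<open>\<phi>\<close>, and with it
  \<open>\<epsilon>\<close>, cancels, and only \<open>A\<close> has to be large.\<close>

definition jet2 :: "(real \<Rightarrow> real) \<Rightarrow> real \<Rightarrow> real \<Rightarrow> real \<Rightarrow> bool" where
  "jet2 f a b c \<longleftrightarrow> f 0 = a \<and>
     (\<exists>f'. (\<forall>\<^sub>F t in nhds 0. (f has_real_derivative f' t) (at t)) \<and> f' 0 = b \<and>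
           (f' has_real_derivative c) (at 0))"

lemma jet2I:
  assumes "\<forall>\<^sub>F t in nhds 0. (f has_real_derivative f' t) (at t)" "(f' has_real_derivative c) (at 0)"
    "f 0 = a" "f' 0 = b"
  shows "jet2 f a b c"
  using assms unfolding jet2_def by blast

lemma jet2E:
  assumes "jet2 f a b c"
  obtains f' where "\<forall>\<^sub>F t in nhds 0. (f has_real_derivative f' t) (at t)"
    "(f' has_real_derivative c) (at 0)" "f 0 = a" "f' 0 = b"
  using assms unfolding jet2_def by blast

lemma jet2_DERIV: "jet2 f a b c \<Longrightarrow> (f has_real_derivative b) (at 0)"
  unfolding jet2_def using eventually_nhds_x_imp_x by fastforce

lemma jet2_at0: "jet2 f a b c \<Longrightarrow> f 0 = a"
  unfolding jet2_def by blast

lemma jet2_cong: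
  assumes "jet2 f a b c" "\<forall>\<^sub>F t in nhds 0. f t = g t"
  shows "jet2 g a b c"
proof -
  obtain f' where f': "\<forall>\<^sub>F t in nhds 0. (f has_real_derivative f' t) (at t)"
    "(f' has_real_derivative c) (at 0)" "f 0 = a" "f' 0 = b"
    using assms(1) by (rule jet2E)
  have "\<forall>\<^sub>F t in nhds 0. \<forall>\<^sub>F s in nhds t. f s = g s"
    using assms(2) by (simp add: eventually_eventually)
  hence "\<forall>\<^sub>F t in nhds 0. (g has_real_derivative f' t) (at t)"
    using f'(1)
  proof eventually_elim
    case (elim t)
    then show ?case using DERIV_cong_ev[of t t f g "f' t" "f' t"] by simp
  qed
  moreover have "g 0 = a" using eventually_nhds_x_imp_x[OF assms(2)] f'(3) by simp
  ultimately show ?thesis using f' by (intro jet2I)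
qed

text \<open>This is how an equation that holds near a point is differentiated twice: both sides
  receive a jet from the calculus rules, and the coefficients are compared.\<close>

lemma jet2_unique:
  assumes "jet2 f a b c" "jet2 g a' b' c'" "\<forall>\<^sub>F t in nhds 0. f t = g t"
  shows "a = a'" "b = b'" "c = c'"
proof -
  have *: "jet2 g a b c" using jet2_cong[OF assms(1,3)] .
  show "a = a'" using jet2_at0[OF *] jet2_at0[OF assms(2)] by simp
  show b: "b = b'" using jet2_DERIV[OF *] jet2_DERIV[OF assms(2)] DERIV_unique by blast
  obtain f' where f': "\<forall>\<^sub>F t in nhds 0. (g has_real_derivative f' t) (at t)"
    "(f' has_real_derivative c) (at 0)" using * by (rule jet2E)
  obtain g' where g': "\<forall>\<^sub>F t in nhds 0. (g has_real_derivative g' t) (at t)"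
    "(g' has_real_derivative c') (at 0)" using assms(2) by (rule jet2E)
  have "\<forall>\<^sub>F t in nhds 0. f' t = g' t"
    using f'(1) g'(1) by eventually_elim (rule DERIV_unique)
  then have "(g' has_real_derivative c) (at 0)"
    using DERIV_cong_ev[of 0 0 f' g' c c] f'(2) by simp
  then show "c = c'" using g'(2) DERIV_unique by blast
qed

lemma jet2_const: "jet2 (\<lambda>t. k) k 0 0"
  by (rule jet2I[where f' = "\<lambda>t. 0"]) (auto intro!: always_eventually derivative_eq_intros)

lemma jet2_id: "jet2 (\<lambda>t. t) 0 1 0"
  by (rule jet2I[where f' = "\<lambda>t. 1"]) (auto intro!: always_eventually derivative_eq_intros)

lemma jet2_add:
  assumes "jet2 f a b c" "jet2 g a' b' c'"
  shows "jet2 (\<lambda>t. f t + g t) (a + a') (b + b') (c + c')"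
proof -
  obtain f' where f': "\<forall>\<^sub>F t in nhds 0. (f has_real_derivative f' t) (at t)"
    "(f' has_real_derivative c) (at 0)" "f 0 = a" "f' 0 = b"  using assms(1) by (rule jet2E)
  obtain g' where g': "\<forall>\<^sub>F t in nhds 0. (g has_real_derivative g' t) (at t)"
    "(g' has_real_derivative c') (at 0)" "g 0 = a'" "g' 0 = b'" using assms(2) by (rule jet2E)
  show ?thesis
  proof (rule jet2I[where f' = "\<lambda>t. f' t + g' t"])
    show "\<forall>\<^sub>F t in nhds 0. ((\<lambda>t. f t + g t) has_real_derivative f' t + g' t) (at t)"
      using f'(1) g'(1) by eventually_elim (rule DERIV_add)
  qed (use f' g' in \<open>auto intro: DERIV_add\<close>)
qed

lemma jet2_mult:
  assumes "jet2 f a b c" "jet2 g a' b' c'"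
  shows "jet2 (\<lambda>t. f t * g t) (a * a') (b * a' + a * b') (c * a' + 2 * (b * b') + a * c')"
proof -
  obtain f' where f': "\<forall>\<^sub>F t in nhds 0. (f has_real_derivative f' t) (at t)"
    "(f' has_real_derivative c) (at 0)" "f 0 = a" "f' 0 = b"  using assms(1) by (rule jet2E)
  obtain g' where g': "\<forall>\<^sub>F t in nhds 0. (g has_real_derivative g' t) (at t)"
    "(g' has_real_derivative c') (at 0)" "g 0 = a'" "g' 0 = b'" using assms(2) by (rule jet2E)
  have fd: "(f has_real_derivative b) (at 0)" and gd: "(g has_real_derivative b') (at 0)"
    using jet2_DERIV assms by blast+
  show ?thesis
  proof (rule jet2I[where f' = "\<lambda>t. f' t * g t + f t * g' t"])
    show "\<forall>\<^sub>F t in nhds 0. ((\<lambda>t. f t * g t) has_real_derivative f' t * g t + f t * g' t) (at t)"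
      using f'(1) g'(1)
    proof eventually_elim
      case (elim t)
      show ?case using DERIV_mult[OF elim] by (simp add: algebra_simps)
    qed
    show "((\<lambda>t. f' t * g t + f t * g' t) has_real_derivative c * a' + 2 * (b * b') + a * c') (at 0)"
      by (rule derivative_eq_intros f'(2) g'(2) fd gd refl)+ (use f' g' in \<open>simp add: algebra_simps\<close>)
  qed (use f' g' in auto)
qed

lemma jet2_cmult: "jet2 f a b c \<Longrightarrow> jet2 (\<lambda>t. k * f t) (k * a) (k * b) (k * c)"
  using jet2_mult[OF jet2_const[of k]] by fastforce

lemma jet2_uminus: "jet2 f a b c \<Longrightarrow> jet2 (\<lambda>t. - f t) (- a) (- b) (- c)"
  using jet2_cmult[of f a b c "-1"] by simp

lemma jet2_diff:
  assumes "jet2 f a b c" "jet2 g a' b' c'"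
  shows "jet2 (\<lambda>t. f t - g t) (a - a') (b - b') (c - c')"
  using jet2_add[OF assms(1) jet2_uminus[OF assms(2)]] by simp

lemma jet2_sum:
  assumes "\<And>i. i \<in> S \<Longrightarrow> jet2 (f i) (a i) (b i) (c i)"
  shows "jet2 (\<lambda>t. \<Sum>i\<in>S. f i t) (sum a S) (sum b S) (sum c S)"
  using assms
proof (induction S rule: infinite_finite_induct)
  case (insert x F)
  then show ?case using jet2_add[of "f x" "a x" "b x" "c x"] by simp
qed (auto simp: jet2_const)

lemma jet2_compose:
  assumes g: "jet2 g a b c"
    and F: "\<forall>\<^sub>F x in nhds a. (F has_real_derivative F' x) (at x)" "(F' has_real_derivative m) (at a)"
  shows "jet2 (\<lambda>t. F (g t)) (F a) (F' a * b) (m * b\<^sup>2 + F' a * c)"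
proof -
  obtain g' where g': "\<forall>\<^sub>F t in nhds 0. (g has_real_derivative g' t) (at t)"
    "(g' has_real_derivative c) (at 0)" "g 0 = a" "g' 0 = b" using g by (rule jet2E)
  have gd: "(g has_real_derivative b) (at 0)" using jet2_DERIV[OF g] .
  hence "isCont g 0" by (rule DERIV_isCont)
  hence "filterlim g (nhds a) (nhds 0)" using g'(3) by (simp add: continuous_at tendsto_nhds_iff)
  hence ev: "\<forall>\<^sub>F t in nhds 0. (F has_real_derivative F' (g t)) (at (g t))"
    using F(1) filterlim_iff by fastforce
  show ?thesis
  proof (rule jet2I[where f' = "\<lambda>t. F' (g t) * g' t"])
    show "\<forall>\<^sub>F t in nhds 0. ((\<lambda>t. F (g t)) has_real_derivative F' (g t) * g' t) (at t)"
      using ev g'(1) by eventually_elim (rule DERIV_chain2)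
    have "((\<lambda>t. F' (g t)) has_real_derivative m * b) (at 0)"
      using DERIV_chain2[of F' m g 0 b UNIV] F(2) gd g'(3) by simp
    thus "((\<lambda>t. F' (g t) * g' t) has_real_derivative m * b\<^sup>2 + F' a * c) (at 0)"
      using DERIV_mult[OF _ g'(2), of "\<lambda>t. F' (g t)" "m * b"] g'(3,4)
      by (simp add: power2_eq_square algebra_simps)
  qed (use g' in auto)
qed

lemma jet2_ln:
  assumes "jet2 f a b c" "a > 0"
  shows "jet2 (\<lambda>t. ln (f t)) (ln a) (b / a) (c / a - (b / a)\<^sup>2)"
proof -
  have "\<forall>\<^sub>F x in nhds a. (ln has_real_derivative inverse x) (at x)"
    using eventually_nhds_in_open[of "{0<..}" a] assms(2)
    by (auto elim!: eventually_mono intro: DERIV_ln)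
  moreover have "(inverse has_real_derivative - (inverse a ^ 2)) (at a)"
    using DERIV_inverse[of a UNIV] assms(2) by (simp add: numeral_2_eq_2)
  ultimately have "jet2 (\<lambda>t. ln (f t)) (ln a) (inverse a * b) (- (inverse a ^ 2) * b\<^sup>2 + inverse a * c)"
    by (rule jet2_compose[OF assms(1)])
  thus ?thesis by (simp add: field_simps power2_eq_square)
qed

lemma jet2_inverse:
  assumes "jet2 f a b c" "a \<noteq> 0"
  shows "jet2 (\<lambda>t. inverse (f t)) (inverse a) (- b / a\<^sup>2) (2 * b\<^sup>2 / a ^ 3 - c / a\<^sup>2)"
proof -
  have "\<forall>\<^sub>F x in nhds a. (inverse has_real_derivative - (inverse x ^ 2)) (at x)"
  proof -
    have "\<forall>\<^sub>F x in nhds a. x \<in> -{0}"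
      using assms(2) by (intro eventually_nhds_in_open) auto
    thus ?thesis
    proof eventually_elim
      case (elim x)
      thus ?case using DERIV_inverse[of x UNIV] by (simp add: numeral_2_eq_2)
    qed
  qed
  moreover have "((\<lambda>x. - (inverse x ^ 2)) has_real_derivative 2 * inverse a ^ 3) (at a)"
    by (rule derivative_eq_intros refl assms)+ (simp add: power2_eq_square power3_eq_cube)
  ultimately have "jet2 (\<lambda>t. inverse (f t)) (inverse a) (- (inverse a ^ 2) * b) (2 * inverse a ^ 3 * b\<^sup>2 + - (inverse a ^ 2) * c)"
    by (rule jet2_compose[OF assms(1)])
  thus ?thesis by (simp add: field_simps power2_eq_square power3_eq_cube)
qed

lemma jet2_exp:
  assumes "jet2 f a b c"
  shows "jet2 (\<lambda>t. exp (f t)) (exp a) (exp a * b) (exp a * (b\<^sup>2 + c))"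
  using jet2_compose[OF assms, of exp exp "exp a"] by (simp add: distrib_left)

lemma jet2_sqrt1: "jet2 (\<lambda>t. sqrt (1 + t\<^sup>2)) 1 0 1"
proof (rule jet2I[where f' = "\<lambda>t. t / sqrt (1 + t\<^sup>2)"])
  have p: "1 + t\<^sup>2 > 0" for t :: real by (simp add: add_pos_nonneg)
  show "\<forall>\<^sub>F t in nhds 0. ((\<lambda>t. sqrt (1 + t\<^sup>2)) has_real_derivative t / sqrt (1 + t\<^sup>2)) (at t)"
  proof (intro always_eventually allI)
    fix t :: real
    show "((\<lambda>t. sqrt (1 + t\<^sup>2)) has_real_derivative t / sqrt (1 + t\<^sup>2)) (at t)"
      using p[of t] by - (rule derivative_eq_intros refl | simp add: field_simps)+
  qed
  show "((\<lambda>t. t / sqrt (1 + t\<^sup>2)) has_real_derivative 1) (at 0)"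
    by (auto intro!: derivative_eq_intros)
qed auto

text \<open>The derivative tests used at a touching point. If \<open>c < 0\<close>, then
  \<open>f'\<close> is negative just to the right of 0, and the mean value theorem puts
  \<open>f\<close> below its minimum.\<close>

lemma jet2_min:
  assumes j: "jet2 f a b c" and min: "\<forall>\<^sub>F t in nhds 0. f t \<ge> a"
  shows "b = 0" "c \<ge> 0"
proof -
  obtain f' where f': "\<forall>\<^sub>F t in nhds 0. (f has_real_derivative f' t) (at t)"
    "(f' has_real_derivative c) (at 0)" "f 0 = a" "f' 0 = b" using j by (rule jet2E)
  obtain e where e: "e > 0" "\<And>t. \<bar>t\<bar> < e \<Longrightarrow> (f has_real_derivative f' t) (at t) \<and> f t \<ge> a"
    using eventually_conj[OF f'(1) min] unfolding eventually_nhds_metric by (auto simp: dist_real_def)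
  have fd: "(f has_real_derivative b) (at 0)" using jet2_DERIV[OF j] .
  show b: "b = 0" by (rule DERIV_local_min[OF fd e(1)]) (use e f' in auto)
  show "c \<ge> 0"
  proof (rule ccontr)
    assume "\<not> c \<ge> 0"
    hence "c < 0" by simp
    from DERIV_neg_dec_right[OF f'(2) this] obtain r where r: "r > 0"
      "\<And>t. 0 < t \<Longrightarrow> t < r \<Longrightarrow> f' t < 0" using b f'(4) by auto
    define s where "s = min r e / 2"
    have s: "0 < s" "s < r" "s < e" using r e by (auto simp: s_def)
    have "\<exists>z. 0 < z \<and> z < s \<and> f s - f 0 = (s - 0) * f' z"
      by (rule MVT2) (use s e in auto)
    then obtain z where "0 < z" "z < s" "f s - f 0 = s * f' z" by auto
    moreover have "s * f' z < 0" using r(2)[of z] s \<open>0 < z\<close> \<open>z < s\<close> by (simp add: mult_pos_neg)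
    ultimately have "f s < f 0" by simp
    thus False using e(2)[of s] s f'(3) by auto
  qed
qed

text \<open>The one-sided test for boundary points: the functions are differentiable in a full
  neighbourhood, but the inequality is known only on the side that points into the cone.\<close>

lemma right_min_DERIV:
  fixes f :: "real \<Rightarrow> real"
  assumes "(f has_real_derivative b) (at 0)" "e > 0" "\<And>t. 0 < t \<Longrightarrow> t < e \<Longrightarrow> f t \<ge> f 0"
  shows "b \<ge> 0"
proof (rule ccontr)
  assume "\<not> b \<ge> 0"
  hence "b < 0" by simp
  from DERIV_neg_dec_right[OF assms(1) this] obtain r where r: "r > 0"
    "\<And>t. 0 < t \<Longrightarrow> t < r \<Longrightarrow> f t < f 0" by auto
  define s where "s = min r e / 2"
  have "0 < s" "s < r" "s < e" using r assms(2) by (auto simp: s_def)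
  thus False using r(2)[of s] assms(3)[of s] by simp
qed

text \<open>Allows the equation to be differentiated once in the inward direction at a boundary
  point, where it holds only for \<open>t >= 0\<close>.\<close>

lemma right_eq_DERIV:
  fixes f :: "real \<Rightarrow> real"
  assumes "(f has_real_derivative b) (at 0)" "(g has_real_derivative b') (at 0)"
    "e > 0" "\<And>t. 0 \<le> t \<Longrightarrow> t < e \<Longrightarrow> f t = g t"
  shows "b = b'"
proof -
  have 1: "((\<lambda>t. f t - g t) has_real_derivative b - b') (at 0)" using assms by (intro DERIV_diff)
  have 2: "((\<lambda>t. g t - f t) has_real_derivative b' - b) (at 0)" using assms by (intro DERIV_diff)
  have "b - b' \<ge> 0" by (rule right_min_DERIV[OF 1 assms(3)]) (use assms in auto)
  moreover have "b' - b \<ge> 0" by (rule right_min_DERIV[OF 2 assms(3)]) (use assms in auto)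
  ultimately show ?thesis by simp
qed

section \<open>Elementary symmetric functions\<close>

text \<open>The degree is an integer so that the recursion over the index set needs no side condition:
  in negative degree the value is 0.\<close>

definition es :: "'i set \<Rightarrow> int \<Rightarrow> ('i \<Rightarrow> real) \<Rightarrow> real" where
  "es I k x = (\<Sum>S | S \<subseteq> I \<and> int (card S) = k. \<Prod>i\<in>S. x i)"

lemma es_neg [simp]: "k < 0 \<Longrightarrow> es I k x = 0"
  unfolding es_def by (intro sum.neutral) auto

lemma es_0 [simp]: "finite I \<Longrightarrow> es I 0 x = 1"
proof -
  assume "finite I"
  hence "{S. S \<subseteq> I \<and> int (card S) = 0} = {{}}"
    by (auto simp: card_eq_0_iff finite_subset dest: finite_subset)
  thus ?thesis by (simp add: es_def)
qed

lemma es_empty: "es {} k x = (if k = 0 then 1 else 0)"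
proof -
  have "{S. S \<subseteq> ({}::'a set) \<and> int (card S) = k} = (if k = 0 then {{}} else {})" by auto
  thus ?thesis by (simp add: es_def)
qed

lemma es_insert:
  assumes "finite I" "a \<notin> I"
  shows "es (insert a I) k x = es I k x + x a * es I (k - 1) x"
proof -
  let ?A = "{S. S \<subseteq> I \<and> int (card S) = k}" and ?B = "{S. S \<subseteq> I \<and> int (card S) = k - 1}"
  have fin: "finite ?A" "finite ?B" using assms by auto
  have eq: "{S. S \<subseteq> insert a I \<and> int (card S) = k} = ?A \<union> insert a ` ?B"
  proof (intro equalityI subsetI)
    fix S assume S: "S \<in> {S. S \<subseteq> insert a I \<and> int (card S) = k}"
    show "S \<in> ?A \<union> insert a ` ?B"
    proof (cases "a \<in> S")
      case True
      have "finite S" using S assms finite_subset[of S "insert a I"] by auto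
      hence "card S = Suc (card (S - {a}))" using True by (rule card.remove)
      hence "int (card (S - {a})) = k - 1" using S by simp
      moreover have "S - {a} \<subseteq> I" using S by auto
      ultimately have "S - {a} \<in> ?B" by (intro CollectI conjI)
      thus ?thesis using True by (intro UnI2 image_eqI[where x = "S - {a}"]) (simp_all add: insert_absorb)
    next
      case False thus ?thesis using S by auto
    qed
  next
    fix S assume "S \<in> ?A \<union> insert a ` ?B"
    thus "S \<in> {S. S \<subseteq> insert a I \<and> int (card S) = k}"
    proof
      assume "S \<in> insert a ` ?B"
      then obtain T where T: "S = insert a T" "T \<subseteq> I" "int (card T) = k - 1" by auto
      have "finite T" "a \<notin> T" using T assms finite_subset by auto
      thus ?thesis using T by auto
    qed auto
  qed
  have dis: "?A \<inter> insert a ` ?B = {}" using assms by auto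
  have inj: "inj_on (insert a) ?B"
  proof (rule inj_onI)
    fix S T assume "S \<in> ?B" "T \<in> ?B" "insert a S = insert a T"
    moreover have "a \<notin> S" "a \<notin> T" using calculation assms by auto
    ultimately show "S = T" by (simp add: insert_ident)
  qed
  have "es (insert a I) k x = (\<Sum>S\<in>?A. \<Prod>i\<in>S. x i) + (\<Sum>S\<in>insert a ` ?B. \<Prod>i\<in>S. x i)"
    unfolding es_def eq using fin dis by (intro sum.union_disjoint) auto
  also have "(\<Sum>S\<in>insert a ` ?B. \<Prod>i\<in>S. x i) = (\<Sum>S\<in>?B. \<Prod>i\<in>insert a S. x i)"
    using inj by (simp add: sum.reindex)
  also have "\<dots> = (\<Sum>S\<in>?B. x a * (\<Prod>i\<in>S. x i))"
  proof (rule sum.cong[OF refl])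
    fix S assume "S \<in> ?B"
    hence "finite S" "a \<notin> S" using assms finite_subset by auto
    thus "(\<Prod>i\<in>insert a S. x i) = x a * (\<Prod>i\<in>S. x i)" by simp
  qed
  finally show ?thesis by (simp add: es_def sum_distrib_left)
qed

lemma es_remove:
  assumes "finite I" "a \<in> I"
  shows "es I k x = es (I - {a}) k x + x a * es (I - {a}) (k - 1) x"
  using es_insert[of "I - {a}" a k x] assms by (simp add: insert_absorb)

lemma es_nonneg: "(\<And>i. i \<in> I \<Longrightarrow> x i \<ge> 0) \<Longrightarrow> es I k x \<ge> 0"
  unfolding es_def by (intro sum_nonneg prod_nonneg) auto

lemma es_cong: "(\<And>i. i \<in> I \<Longrightarrow> x i = y i) \<Longrightarrow> es I k x = es I k y"
  unfolding es_def by (intro sum.cong prod.cong) auto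

lemma es_pos:
  assumes "finite I" "\<And>i. i \<in> I \<Longrightarrow> x i > 0" "0 \<le> k" "k \<le> int (card I)"
  shows "es I k x > 0"
proof -
  have "nat k \<le> card I" using assms by linarith
  then obtain S where S: "S \<subseteq> I" "card S = nat k"
    by (meson obtain_subset_with_card_n)
  have "(\<Prod>i\<in>S. x i) > 0" using S(1) assms(2) by (intro prod_pos) auto
  moreover have "(\<Prod>i\<in>S. x i) \<le> es I k x" unfolding es_def
  proof (rule member_le_sum)
    show "S \<in> {S. S \<subseteq> I \<and> int (card S) = k}" using S assms(3) by simp
    show "finite {S. S \<subseteq> I \<and> int (card S) = k}" using assms(1) by simp
    fix T assume "T \<in> {S. S \<subseteq> I \<and> int (card S) = k} - {S}"
    hence "T \<subseteq> I" by blast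
    hence "0 \<le> x i" if "i \<in> T" for i using assms(2)[of i] that by auto
    thus "0 \<le> (\<Prod>i\<in>T. x i)" by (rule prod_nonneg)
  qed
  ultimately show ?thesis by linarith
qed

lemma es_large: "finite I \<Longrightarrow> int (card I) < k \<Longrightarrow> es I k x = 0"
proof -
  assume fin: "finite I" and k: "int (card I) < k"
  have "int (card S) \<noteq> k" if "S \<subseteq> I" for S using card_mono[OF fin that] k by linarith
  hence "{S. S \<subseteq> I \<and> int (card S) = k} = {}" by blast
  thus ?thesis unfolding es_def by (simp only: sum.empty)
qed

lemma es_scale: "finite I \<Longrightarrow> es I (int k) (\<lambda>i. s * x i) = s ^ k * es I (int k) x"
  unfolding es_def by (simp add: sum_distrib_left prod.distrib)

text \<open>Each product of \<open>k\<close> variables is counted once for each of its factors. This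
  is Euler's identity for a homogeneous polynomial, with \<open>es (I - {a}) (k - 1) x\<close> as
  the partial derivative in \<open>x a\<close>.\<close>

lemma es_euler:
  assumes "finite I"
  shows "of_int k * es I k x = (\<Sum>a\<in>I. x a * es (I - {a}) (k - 1) x)"
  using assms
proof (induction I arbitrary: k)
  case empty
  then show ?case by (simp add: es_empty)
next
  case (insert b I)
  have "(\<Sum>a\<in>I. x a * es (insert b I - {a}) (k - 1) x)
      = (\<Sum>a\<in>I. x a * es (I - {a}) (k - 1) x + x b * (x a * es (I - {a}) (k - 1 - 1) x))"
  proof (rule sum.cong[OF refl])
    fix a assume a: "a \<in> I"
    have "insert b I - {a} = insert b (I - {a})" using a insert by auto
    thus "x a * es (insert b I - {a}) (k - 1) x
      = x a * es (I - {a}) (k - 1) x + x b * (x a * es (I - {a}) (k - 1 - 1) x)"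
      using es_insert[of "I - {a}" b "k - 1" x] insert by (simp add: algebra_simps)
  qed
  also have "\<dots> = of_int k * es I k x + x b * (of_int (k - 1) * es I (k - 1) x)"
    unfolding insert.IH by (simp add: sum.distrib sum_distrib_left)
  finally show ?case using insert es_insert[of I b k x] by (simp add: algebra_simps)
qed

text \<open>Euler's identity applied to both sides, followed by removal of \<open>a\<close> from the
  remaining factors, leaves \<open>(x a)^2\<close> times the same kind of difference on
  \<open>I - {a}\<close> with both degrees lowered by one. The factors \<open>k\<close> and
  \<open>l\<close> are kept because they give the quantitative gain \<open>1 - m / k\<close> in
  \<open>qd_ge\<close>.\<close>

lemma es_newton_strong:
  assumes "finite I" "\<And>i. i \<in> I \<Longrightarrow> x i \<ge> 0" "l \<le> k"
  shows "of_int k * (es I k x * es I (l - 1) x) \<le> of_int l * (es I (k - 1) x * es I l x)"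
  using assms
proof (induction "card I" arbitrary: I k l)
  case 0
  thus ?case by (auto simp: es_empty)
next
  case (Suc n)
  \<comment> \<open>The induction hypothesis carries the factors \<open>k - 1\<close> and
    \<open>l - 1\<close>, which may be dropped because \<open>l <= k\<close>. If
    \<open>k - 1 <= 0\<close>, the left side contains a negative degree and vanishes.\<close>
  have weak: "es (I - {a}) (k - 1) x * es (I - {a}) (l - 1 - 1) x
      \<le> es (I - {a}) (k - 1 - 1) x * es (I - {a}) (l - 1) x" if a: "a \<in> I" for a
  proof (cases "k - 1 > 0")
    case True
    let ?u = "es (I - {a}) (k - 1) x * es (I - {a}) (l - 1 - 1) x"
    let ?v = "es (I - {a}) (k - 1 - 1) x * es (I - {a}) (l - 1) x"
    have "n = card (I - {a})" using Suc a by simp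
    from Suc.hyps(1)[OF this, of "l - 1" "k - 1"]
    have "of_int (k - 1) * ?u \<le> of_int (l - 1) * ?v" using Suc.prems by auto
    also have "\<dots> \<le> of_int (k - 1) * ?v"
      using Suc.prems by (intro mult_right_mono mult_nonneg_nonneg es_nonneg) auto
    finally show ?thesis using True by simp
  next
    case False
    thus ?thesis using Suc.prems by (auto intro!: mult_nonneg_nonneg es_nonneg)
  qed
  have "of_int k * (es I k x * es I (l - 1) x) - of_int l * (es I (k - 1) x * es I l x)
     = (of_int k * es I k x) * es I (l - 1) x - es I (k - 1) x * (of_int l * es I l x)" by simp
  also have "\<dots> = (\<Sum>a\<in>I. x a * es (I - {a}) (k - 1) x * es I (l - 1) x
                          - es I (k - 1) x * (x a * es (I - {a}) (l - 1) x))"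
    unfolding es_euler[OF Suc.prems(1)] by (simp add: sum_subtractf sum_distrib_left sum_distrib_right)
  also have "\<dots> = (\<Sum>a\<in>I. (x a)\<^sup>2 * (es (I - {a}) (k - 1) x * es (I - {a}) (l - 1 - 1) x
      - es (I - {a}) (k - 1 - 1) x * es (I - {a}) (l - 1) x))"
  proof (rule sum.cong[OF refl])
    fix a assume a: "a \<in> I"
    show "x a * es (I - {a}) (k - 1) x * es I (l - 1) x - es I (k - 1) x * (x a * es (I - {a}) (l - 1) x)
      = (x a)\<^sup>2 * (es (I - {a}) (k - 1) x * es (I - {a}) (l - 1 - 1) x
      - es (I - {a}) (k - 1 - 1) x * es (I - {a}) (l - 1) x)"
      unfolding es_remove[OF Suc.prems(1) a, of "l - 1"] es_remove[OF Suc.prems(1) a, of "k - 1"]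
      by (simp add: algebra_simps power2_eq_square)
  qed
  also have "\<dots> \<le> 0"
    using weak by (intro sum_nonpos mult_nonneg_nonpos) auto
  finally show ?case by simp
qed

lemma es_newton:
  assumes "finite I" "\<And>i. i \<in> I \<Longrightarrow> x i \<ge> 0" "l \<le> k"
  shows "es I k x * es I (l - 1) x \<le> es I (k - 1) x * es I l x"
proof (cases "k > 0")
  case True
  have "of_int k * (es I k x * es I (l - 1) x) \<le> of_int l * (es I (k - 1) x * es I l x)"
    by (rule es_newton_strong[OF assms])
  also have "\<dots> \<le> of_int k * (es I (k - 1) x * es I l x)"
    using assms by (intro mult_right_mono mult_nonneg_nonneg es_nonneg) auto
  finally show ?thesis using True by simp
next
  case False
  thus ?thesis using assms by (auto intro!: mult_nonneg_nonneg es_nonneg)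
qed

section \<open>Superadditivity of quotients of consecutive symmetric functions\<close>

definition par :: "real \<Rightarrow> real \<Rightarrow> real" where "par a b = a * b / (a + b)"

text \<open>\<open>par\<close> is half the harmonic mean: homogeneous of degree one, concave and
  increasing, hence superadditive. The free \<open>c\<close> builds the monotonicity in, so that an
  inductive lower bound for the second argument can be inserted directly.\<close>

lemma par_superadd:
  assumes "a > 0" "b > 0" "a' > 0" "b' > 0" "c \<ge> b + b'"
  shows "par a b + par a' b' \<le> par (a + a') c"
proof -
  have mono: "par (a + a') (b + b') \<le> par (a + a') c"
  proof -
    have e: "par s x = s - s * s / (s + x)" if "s > 0" "x > 0" for s x :: real
      using that unfolding par_def by (simp add: field_simps)
    have "(a + a') * (a + a') / (a + a' + c) \<le> (a + a') * (a + a') / (a + a' + (b + b'))"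
      using assms by (intro divide_left_mono mult_nonneg_nonneg mult_pos_pos) auto
    thus ?thesis using e[of "a + a'" "b + b'"] e[of "a + a'" c] assms by simp
  qed
  have "par a b + par a' b' \<le> par (a + a') (b + b')"
  proof -
    have "par (a + a') (b + b') - par a b - par a' b'
      = (a * b' - a' * b)\<^sup>2 / ((a + b) * (a' + b') * (a + a' + b + b'))"
      unfolding par_def using assms
      by (simp add: divide_simps) (simp add: algebra_simps power2_eq_square)
    also have "\<dots> \<ge> 0" using assms by simp
    finally show ?thesis by simp
  qed
  with mono show ?thesis by simp
qed

text \<open>The recursion behind concavity: by Euler's identity and \<open>es_remove\<close>, the
  quotient is a sum of parallel sums of one variable with the quotient of one degree less in the
  other variables.\<close>

lemma es_quot_par:
  assumes "finite I" "\<And>i. i \<in> I \<Longrightarrow> x i > 0" "0 < m" "m \<le> int (card I) - 1"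
  shows "of_int (m + 1) * (es I (m + 1) x / es I m x)
    = (\<Sum>i\<in>I. par (x i) (es (I - {i}) m x / es (I - {i}) (m - 1) x))"
proof -
  have pos: "es I m x > 0" using assms by (intro es_pos) auto
  have "of_int (m + 1) * (es I (m + 1) x / es I m x) = (\<Sum>i\<in>I. x i * es (I - {i}) m x / es I m x)"
    using es_euler[OF assms(1), of "m + 1" x] by (simp add: sum_divide_distrib[symmetric])
  also have "\<dots> = (\<Sum>i\<in>I. par (x i) (es (I - {i}) m x / es (I - {i}) (m - 1) x))"
  proof (rule sum.cong[OF refl])
    fix i assume i: "i \<in> I"
    have c: "int (card (I - {i})) = int (card I) - 1"
      using i assms(1) by (metis card_Suc_Diff1 of_nat_Suc add_diff_cancel_right' add.commute)
    have p: "es (I - {i}) (m - 1) x > 0" using assms c by (intro es_pos) auto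
    have e: "es I m x = es (I - {i}) m x + x i * es (I - {i}) (m - 1) x"
      by (rule es_remove[OF assms(1) i])
    have "x i + es (I - {i}) m x / es (I - {i}) (m - 1) x = es I m x / es (I - {i}) (m - 1) x"
      unfolding e using p by (simp add: field_simps)
    thus "x i * es (I - {i}) m x / es I m x = par (x i) (es (I - {i}) m x / es (I - {i}) (m - 1) x)"
      unfolding par_def using p pos by (simp add: field_simps)
  qed
  finally show ?thesis .
qed

text \<open>The Marcus-Lopes inequality. In the recursion \<open>es_quot_par\<close> the second
  arguments of \<open>par\<close> are superadditive by induction, and \<open>par_superadd\<close>
  transfers this to the sum.\<close>

lemma es_quot_superadd:
  assumes "finite I" "\<And>i. i \<in> I \<Longrightarrow> x i > 0" "\<And>i. i \<in> I \<Longrightarrow> y i > 0" "m < card I"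
  shows "es I (int m + 1) x / es I (int m) x + es I (int m + 1) y / es I (int m) y
     \<le> es I (int m + 1) (\<lambda>i. x i + y i) / es I (int m) (\<lambda>i. x i + y i)"
  using assms
proof (induction m arbitrary: I)
  case 0
  have "es I 1 z = (\<Sum>i\<in>I. z i)" for z
    using es_euler[OF 0(1), of 1 z] 0(1) by simp
  thus ?case using 0 by (simp add: sum.distrib)
next
  case (Suc m)
  let ?z = "\<lambda>i. x i + y i"
  have c: "card (I - {i}) = card I - 1" if "i \<in> I" for i using that Suc.prems by simp
  have eq: "of_int (int m + 2) * (es I (int (Suc m) + 1) w / es I (int (Suc m)) w)
     = (\<Sum>i\<in>I. par (w i) (es (I - {i}) (int m + 1) w / es (I - {i}) (int m) w))"
    if "\<And>i. i \<in> I \<Longrightarrow> w i > 0" for w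
    using es_quot_par[of I w "int (Suc m)"] that Suc.prems by (simp add: algebra_simps)
  have "(\<Sum>i\<in>I. par (x i) (es (I - {i}) (int m + 1) x / es (I - {i}) (int m) x))
      + (\<Sum>i\<in>I. par (y i) (es (I - {i}) (int m + 1) y / es (I - {i}) (int m) y))
      \<le> (\<Sum>i\<in>I. par (?z i) (es (I - {i}) (int m + 1) ?z / es (I - {i}) (int m) ?z))"
    unfolding sum.distrib[symmetric]
  proof (intro sum_mono par_superadd)
    fix i assume i: "i \<in> I"
    show "0 < x i" "0 < y i" using i Suc.prems by auto
    show "0 < es (I - {i}) (int m + 1) x / es (I - {i}) (int m) x"
      "0 < es (I - {i}) (int m + 1) y / es (I - {i}) (int m) y"
      using Suc.prems c[OF i] by (auto intro!: divide_pos_pos es_pos)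
    show "es (I - {i}) (int m + 1) x / es (I - {i}) (int m) x
       + es (I - {i}) (int m + 1) y / es (I - {i}) (int m) y
       \<le> es (I - {i}) (int m + 1) ?z / es (I - {i}) (int m) ?z"
      using Suc.prems c[OF i] by (intro Suc.IH) auto
  qed
  note le = this
  have eqx: "of_int (int m + 2) * (es I (int (Suc m) + 1) x / es I (int (Suc m)) x)
     = (\<Sum>i\<in>I. par (x i) (es (I - {i}) (int m + 1) x / es (I - {i}) (int m) x))"
    using Suc.prems by (intro eq) auto
  have eqy: "of_int (int m + 2) * (es I (int (Suc m) + 1) y / es I (int (Suc m)) y)
     = (\<Sum>i\<in>I. par (y i) (es (I - {i}) (int m + 1) y / es (I - {i}) (int m) y))"
    using Suc.prems by (intro eq) auto
  have eqz: "of_int (int m + 2) * (es I (int (Suc m) + 1) ?z / es I (int (Suc m)) ?z)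
     = (\<Sum>i\<in>I. par (?z i) (es (I - {i}) (int m + 1) ?z / es (I - {i}) (int m) ?z))"
    using Suc.prems by (intro eq add_pos_pos) auto
  have "of_int (int m + 2) * (es I (int (Suc m) + 1) x / es I (int (Suc m)) x)
     + of_int (int m + 2) * (es I (int (Suc m) + 1) y / es I (int (Suc m)) y)
     \<le> of_int (int m + 2) * (es I (int (Suc m) + 1) ?z / es I (int (Suc m)) ?z)"
    using le by (simp only: eqx eqy eqz)
  thus ?case unfolding distrib_left[symmetric] by (rule mult_left_le_imp_le) simp
qed

text \<open>Passing to complementary subsets. It converts symmetric functions of inverses into
  symmetric functions of complementary degree, and so turns inverse concavity into
  concavity.\<close>

lemma es_inverse:
  assumes "finite I" "\<And>i. i \<in> I \<Longrightarrow> x i > 0"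
  shows "es I k (\<lambda>i. inverse (x i)) * es I (int (card I)) x = es I (int (card I) - k) x"
  using assms
proof (induction I arbitrary: k)
  case empty thus ?case by (auto simp: es_empty)
next
  case (insert a I)
  have xa: "x a > 0" using insert by simp
  have "es (insert a I) k (\<lambda>i. inverse (x i)) * es (insert a I) (int (card (insert a I))) x
    = (es I k (\<lambda>i. inverse (x i)) + inverse (x a) * es I (k - 1) (\<lambda>i. inverse (x i)))
       * (x a * es I (int (card I)) x)"
    using insert by (simp add: es_insert es_large)
  also have "\<dots> = x a * (es I k (\<lambda>i. inverse (x i)) * es I (int (card I)) x)
     + es I (k - 1) (\<lambda>i. inverse (x i)) * es I (int (card I)) x"
    using xa by (simp add: field_simps)
  also have "\<dots> = x a * es I (int (card I) - k) x + es I (int (card I) - (k - 1)) x"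
    using insert.IH[of k] insert.IH[of "k - 1"] insert.prems by simp
  also have "\<dots> = es (insert a I) (int (card (insert a I)) - k) x"
    using insert by (simp add: es_insert algebra_simps)
  finally show ?case .
qed

text \<open>Read backwards, this bounds a lower degree from below by a higher one; the ellipticity
  constants rest on that.\<close>

lemma es_bound_step:
  assumes "finite I" "\<And>i. i \<in> I \<Longrightarrow> 0 \<le> x i \<and> x i \<le> B" "k \<ge> 0" "card I \<le> d" "B \<ge> 0"
  shows "es I (k + 1) x \<le> real d * B * es I k x"
proof -
  have B: "B \<ge> 0" by fact
  have nn: "es I k x \<ge> 0" for k using assms by (intro es_nonneg) auto
  have "es I (k + 1) x \<le> of_int (k + 1) * es I (k + 1) x"
    using nn[of "k + 1"] assms(3) by (simp add: mult_le_cancel_right1)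
  also have "\<dots> = (\<Sum>a\<in>I. x a * es (I - {a}) k x)" using es_euler[OF assms(1), of "k + 1"] by simp
  also have "\<dots> \<le> (\<Sum>a\<in>I. B * es I k x)"
  proof (intro sum_mono mult_mono)
    fix a assume a: "a \<in> I"
    show "es (I - {a}) k x \<le> es I k x"
      unfolding es_remove[OF assms(1) a] using assms(2) a
      by (simp, intro mult_nonneg_nonneg es_nonneg) auto
    show "0 \<le> es (I - {a}) k x" using assms(2) by (intro es_nonneg) auto
  qed (use assms B in auto)
  also have "\<dots> = real (card I) * (B * es I k x)" by simp
  also have "\<dots> \<le> real d * (B * es I k x)" using assms B nn by (intro mult_right_mono) auto
  finally show ?thesis by (simp add: mult.assoc)
qed

section \<open>Sums of principal minors\<close>

lemma jet2_prod:
  assumes "finite S" "\<And>i. i \<in> S \<Longrightarrow> jet2 (f i) (a i) (b i) (c i)"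
  shows "jet2 (\<lambda>t. \<Prod>i\<in>S. f i t) (prod a S) (\<Sum>i\<in>S. b i * prod a (S - {i}))
    ((\<Sum>i\<in>S. c i * prod a (S - {i})) + (\<Sum>i\<in>S. \<Sum>j\<in>S-{i}. b i * b j * prod a (S - {i} - {j})))"
  using assms
proof (induction S rule: finite_induct)
  case empty
  thus ?case by (simp add: jet2_const)
next
  case (insert x F)
  have rem: "insert x F - {x} = F" using insert by auto
  have rem2: "insert x F - {i} = insert x (F - {i})" if "i \<in> F" for i using insert that by auto
  have prem2: "prod a (insert x F - {i}) = a x * prod a (F - {i})" if "i \<in> F" for i
    using insert that by (simp add: rem2)
  have s1: "(\<Sum>i\<in>insert x F. g i * prod a (insert x F - {i}))
     = g x * prod a F + a x * (\<Sum>i\<in>F. g i * prod a (F - {i}))" for g :: "'a \<Rightarrow> real"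
    using insert by (simp add: rem sum_distrib_left prem2 cong: sum.cong) (simp add: ac_simps)
  have s2: "(\<Sum>i\<in>insert x F. \<Sum>j\<in>insert x F-{i}. b i * b j * prod a (insert x F - {i} - {j}))
    = 2 * (b x * (\<Sum>i\<in>F. b i * prod a (F - {i})))
      + a x * (\<Sum>i\<in>F. \<Sum>j\<in>F-{i}. b i * b j * prod a (F - {i} - {j}))"
  proof -
    have "(\<Sum>j\<in>insert x F-{i}. b i * b j * prod a (insert x F - {i} - {j}))
      = b i * b x * prod a (F - {i}) + a x * (\<Sum>j\<in>F-{i}. b i * b j * prod a (F - {i} - {j}))"
      if i: "i \<in> F" for i
    proof -
      have "(\<Sum>j\<in>insert x F-{i}. b i * b j * prod a (insert x F - {i} - {j}))
        = b i * b x * prod a (insert x (F - {i}) - {x})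
          + (\<Sum>j\<in>F-{i}. b i * b j * prod a (insert x (F - {i}) - {j}))"
        using insert i by (simp add: rem2)
      also have "insert x (F - {i}) - {x} = F - {i}" using insert by auto
      also have "(\<Sum>j\<in>F-{i}. b i * b j * prod a (insert x (F - {i}) - {j}))
        = (\<Sum>j\<in>F-{i}. a x * (b i * b j * prod a (F - {i} - {j})))"
      proof (rule sum.cong[OF refl])
        fix j assume j: "j \<in> F - {i}"
        have "insert x (F - {i}) - {j} = insert x (F - {i} - {j})" using insert j by auto
        thus "b i * b j * prod a (insert x (F - {i}) - {j}) = a x * (b i * b j * prod a (F - {i} - {j}))"
          using insert by simp
      qed
      finally show ?thesis by (simp add: sum_distrib_left)
    qed
    hence "(\<Sum>i\<in>F. \<Sum>j\<in>insert x F-{i}. b i * b j * prod a (insert x F - {i} - {j}))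
      = (\<Sum>i\<in>F. b i * b x * prod a (F - {i}) + a x * (\<Sum>j\<in>F-{i}. b i * b j * prod a (F - {i} - {j})))"
      by (intro sum.cong) auto
    thus ?thesis using insert
      by (simp add: rem sum.distrib sum_distrib_left ac_simps)
  qed
  have "jet2 (\<lambda>t. f x t * (\<Prod>i\<in>F. f i t)) (a x * prod a F)
    (b x * prod a F + a x * (\<Sum>i\<in>F. b i * prod a (F - {i})))
    (c x * prod a F + 2 * (b x * (\<Sum>i\<in>F. b i * prod a (F - {i})))
     + a x * ((\<Sum>i\<in>F. c i * prod a (F - {i})) + (\<Sum>i\<in>F. \<Sum>j\<in>F-{i}. b i * b j * prod a (F - {i} - {j}))))"
    using insert by (intro jet2_mult) auto
  thus ?case unfolding s1 s2 using insert by (simp add: algebra_simps)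
qed

text \<open>The sum of the principal minors of order \<open>k\<close>, spelled out by the Leibniz
  formula so that it is visibly a polynomial in the entries. Along a curve of matrices it can be
  differentiated entrywise, and no eigenvalues have to be followed.\<close>

definition esm :: "nat \<Rightarrow> int \<Rightarrow> (nat \<Rightarrow> nat \<Rightarrow> real) \<Rightarrow> real" where
  "esm d k A = (\<Sum>S | S \<subseteq> {..<d} \<and> int (card S) = k.
      \<Sum>\<pi> | \<pi> permutes S. of_int (sign \<pi>) * (\<Prod>i\<in>S. A i (\<pi> i)))"

lemma esm_cong:
  assumes "\<And>i j. i < d \<Longrightarrow> j < d \<Longrightarrow> A i j = B i j"
  shows "esm d k A = esm d k B"
  unfolding esm_def
proof (intro sum.cong refl, goal_cases)
  case (1 S \<pi>)
  have "(\<Prod>i\<in>S. A i (\<pi> i)) = (\<Prod>i\<in>S. B i (\<pi> i))"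
  proof (rule prod.cong[OF refl])
    fix i assume i: "i \<in> S"
    have "\<pi> i \<in> S" using 1 i permutes_in_image[of \<pi> S i] by blast
    thus "A i (\<pi> i) = B i (\<pi> i)" using 1 i by (intro assms) auto
  qed
  thus ?case by simp
qed

text \<open>Each factor of the Leibniz product is split into its part from \<open>z * A\<close> and
  its part from the identity. A permutation contributes to the subset \<open>S\<close> of factors
  taken from \<open>z * A\<close> only if it fixes every index outside \<open>S\<close>.\<close>

lemma det_eq_esm:
  "det (mat d d (\<lambda>(i,j). (if i = j then 1 else 0) + z * A i j)) = (\<Sum>k\<le>d. esm d (int k) A * z ^ k)"
proof -
  let ?U = "{0..<d}"
  let ?D = "\<lambda>S. \<Sum>\<pi> | \<pi> permutes S. of_int (sign \<pi>) * (\<Prod>i\<in>S. A i (\<pi> i))"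
  have fp: "finite {\<pi>. \<pi> permutes ?U}" by (simp add: finite_permutations)
  have "det (mat d d (\<lambda>(i,j). (if i = j then 1 else 0) + z * A i j))
    = (\<Sum>\<pi> | \<pi> permutes ?U. of_int (sign \<pi>) * (\<Prod>i=0..<d. z * A i (\<pi> i) + (if i = \<pi> i then 1 else 0)))"
    (is "_ = ?R") 
  proof -
    have "(\<Prod>i=0..<d. mat d d (\<lambda>(i,j). (if i = j then 1 else 0) + z * A i j) $$ (i, \<pi> i))
      = (\<Prod>i=0..<d. z * A i (\<pi> i) + (if i = \<pi> i then 1 else 0))" if p: "\<pi> permutes ?U" for \<pi>
    proof (rule prod.cong[OF refl])
      fix i assume i: "i \<in> ?U"
      have "\<pi> i \<in> ?U" using p i by (simp add: permutes_in_image)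
      thus "mat d d (\<lambda>(i,j). (if i = j then 1 else 0) + z * A i j) $$ (i, \<pi> i)
        = z * A i (\<pi> i) + (if i = \<pi> i then 1 else 0)" using i by simp
    qed
    thus ?thesis by (subst det_def'[of _ d]) (auto intro!: sum.cong)
  qed
  also have "?R = (\<Sum>\<pi> | \<pi> permutes ?U. \<Sum>S\<in>Pow ?U. of_int (sign \<pi>) *
      ((\<Prod>i\<in>S. z * A i (\<pi> i)) * (\<Prod>i\<in>?U-S. if i = \<pi> i then 1 else 0)))"
    by (simp add: prod_add sum_distrib_left)
  also have "\<dots> = (\<Sum>S\<in>Pow ?U. \<Sum>\<pi> | \<pi> permutes ?U. of_int (sign \<pi>) *
      ((\<Prod>i\<in>S. z * A i (\<pi> i)) * (\<Prod>i\<in>?U-S. if i = \<pi> i then 1 else 0)))"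
    by (rule sum.swap)
  also have "\<dots> = (\<Sum>S\<in>Pow ?U. z ^ card S * ?D S)"
  proof (rule sum.cong[OF refl])
    fix S assume S: "S \<in> Pow ?U"
    hence fS: "finite S" using finite_subset by auto
    have "(\<Sum>\<pi> | \<pi> permutes ?U. of_int (sign \<pi>) *
      ((\<Prod>i\<in>S. z * A i (\<pi> i)) * (\<Prod>i\<in>?U-S. if i = \<pi> i then 1 else 0)))
     = (\<Sum>\<pi> | \<pi> permutes S. of_int (sign \<pi>) *
      ((\<Prod>i\<in>S. z * A i (\<pi> i)) * (\<Prod>i\<in>?U-S. if i = \<pi> i then 1 else 0)))"
    proof (rule sum.mono_neutral_right[OF fp])
      show "{\<pi>. \<pi> permutes S} \<subseteq> {\<pi>. \<pi> permutes ?U}" using S permutes_subset by blast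
      show "\<forall>\<pi>\<in>{\<pi>. \<pi> permutes ?U} - {\<pi>. \<pi> permutes S}. of_int (sign \<pi>) *
        ((\<Prod>i\<in>S. z * A i (\<pi> i)) * (\<Prod>i\<in>?U-S. if i = \<pi> i then 1 else 0)) = 0"
      proof
        fix \<pi> assume p: "\<pi> \<in> {\<pi>. \<pi> permutes ?U} - {\<pi>. \<pi> permutes S}"
        have "\<exists>i\<in>?U - S. \<pi> i \<noteq> i"
          using p permutes_superset[of \<pi> ?U S] by blast
        then obtain i where i: "i \<in> ?U - S" "\<pi> i \<noteq> i" by blast
        have "(\<Prod>i\<in>?U-S. if i = \<pi> i then 1 else (0::real)) = 0"
          by (rule prod_zero[OF _ bexI[of _ i]]) (use i in auto)
        thus "of_int (sign \<pi>) * ((\<Prod>i\<in>S. z * A i (\<pi> i)) * (\<Prod>i\<in>?U-S. if i = \<pi> i then 1 else 0)) = 0"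
          by simp
      qed
    qed
    also have "\<dots> = (\<Sum>\<pi> | \<pi> permutes S. z ^ card S * (of_int (sign \<pi>) * (\<Prod>i\<in>S. A i (\<pi> i))))"
    proof (rule sum.cong[OF refl])
      fix \<pi> assume "\<pi> \<in> {\<pi>. \<pi> permutes S}"
      hence "\<pi> i = i" if "i \<in> ?U - S" for i using that permutes_not_in[of \<pi> S i] by auto
      hence "(\<Prod>i\<in>?U-S. if i = \<pi> i then 1 else (0::real)) = 1" by (intro prod.neutral) auto
      thus "of_int (sign \<pi>) * ((\<Prod>i\<in>S. z * A i (\<pi> i)) * (\<Prod>i\<in>?U-S. if i = \<pi> i then 1 else 0))
       = z ^ card S * (of_int (sign \<pi>) * (\<Prod>i\<in>S. A i (\<pi> i)))"
        by (simp add: prod.distrib)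
    qed
    finally show "(\<Sum>\<pi> | \<pi> permutes ?U. of_int (sign \<pi>) *
      ((\<Prod>i\<in>S. z * A i (\<pi> i)) * (\<Prod>i\<in>?U-S. if i = \<pi> i then 1 else 0))) = z ^ card S * ?D S"
      by (simp add: sum_distrib_left)
  qed
  also have "\<dots> = (\<Sum>k\<le>d. \<Sum>S | S \<in> Pow ?U \<and> card S = k. z ^ card S * ?D S)"
  proof (rule sum.group[symmetric])
    show "card ` Pow ?U \<subseteq> {..d}" using card_mono[of ?U] by fastforce
  qed auto
  also have "\<dots> = (\<Sum>k\<le>d. esm d (int k) A * z ^ k)"
    unfolding esm_def
    by (intro sum.cong refl)
       (auto simp: sum_distrib_left sum_distrib_right atLeast0LessThan mult.commute intro!: sum.cong)
  finally show ?thesis .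
qed

lemma prod_eq_es: "(\<Prod>i<d. 1 + z * l i) = (\<Sum>k\<le>d. es {..<d} (int k) l * z ^ k)"
proof -
  have "(\<Prod>i<d. z * l i + 1) = (\<Sum>S\<in>Pow {..<d}. z ^ card S * (\<Prod>i\<in>S. l i))"
    by (simp add: prod_add prod.distrib)
  also have "\<dots> = (\<Sum>k\<le>d. \<Sum>S | S \<in> Pow {..<d} \<and> card S = k. z ^ card S * (\<Prod>i\<in>S. l i))"
  proof (rule sum.group[symmetric])
    show "card ` Pow {..<d} \<subseteq> {..d}" using card_mono[of "{..<d}"] by fastforce
  qed auto
  also have "\<dots> = (\<Sum>k\<le>d. es {..<d} (int k) l * z ^ k)"
    unfolding es_def by (intro sum.cong refl) (simp add: sum_distrib_left mult.commute)
  finally show ?thesis by (simp add: add.commute)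
qed

text \<open>The determinant of \<open>1 + z A\<close> is invariant under orthogonal conjugation for
  every \<open>z\<close>. Hence its coefficients as a polynomial in \<open>z\<close> are the same as
  for the diagonal matrix.\<close>

lemma esm_orthogonal_diag:
  fixes Q :: "nat \<Rightarrow> nat \<Rightarrow> real"
  assumes orth: "\<And>i j. i < d \<Longrightarrow> j < d \<Longrightarrow> (\<Sum>m<d. Q i m * Q j m) = (if i = j then 1 else 0)"
    and A: "\<And>i j. i < d \<Longrightarrow> j < d \<Longrightarrow> A i j = (\<Sum>m<d. l m * Q i m * Q j m)" and "k \<le> d"
  shows "esm d (int k) A = es {..<d} (int k) l"
proof -
  define P where "P = mat d d (\<lambda>(i,j). Q i j)"
  define R where "R = mat d d (\<lambda>(i,j). Q j i)"
  define D where "D z = mat d d (\<lambda>(i,j). if i = j then 1 + z * l i else 0)" for z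
  have car: "P \<in> carrier_mat d d" "R \<in> carrier_mat d d" "D z \<in> carrier_mat d d" for z
    by (auto simp: P_def R_def D_def)
  have PR: "P * R = 1\<^sub>m d"
    by (rule eq_matI) (auto simp: P_def R_def scalar_prod_def atLeast0LessThan orth)
  have PDR: "P * D z * R = mat d d (\<lambda>(i,j). (if i = j then 1 else 0) + z * A i j)" for z
  proof (rule eq_matI)
    fix i j assume "i < dim_row (mat d d (\<lambda>(i,j). (if i = j then 1 else 0) + z * A i j))"
      "j < dim_col (mat d d (\<lambda>(i,j). (if i = j then 1 else 0) + z * A i j))"
    hence ij: "i < d" "j < d" by auto
    have "(P * D z * R) $$ (i,j) = (\<Sum>m<d. (\<Sum>k<d. Q i k * (if k = m then 1 + z * l k else 0)) * Q j m)"
      using ij by (simp add: P_def R_def D_def scalar_prod_def atLeast0LessThan)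
    also have "\<dots> = (\<Sum>m<d. Q i m * (1 + z * l m) * Q j m)"
      by (intro sum.cong refl) (simp add: if_distrib sum.delta' cong: if_cong)
    also have "\<dots> = (\<Sum>m<d. Q i m * Q j m) + z * (\<Sum>m<d. l m * Q i m * Q j m)"
      by (simp add: algebra_simps sum.distrib sum_distrib_left)
    finally show "(P * D z * R) $$ (i,j) = mat d d (\<lambda>(i,j). (if i = j then 1 else 0) + z * A i j) $$ (i,j)"
      using ij by (simp add: orth A)
  qed (auto simp: P_def R_def)
  have dD: "det (D z) = (\<Prod>i<d. 1 + z * l i)" for z
  proof -
    have "det (D z) = prod_list (diag_mat (D z))"
      by (rule det_upper_triangular[OF _ car(3)]) (auto simp: D_def)
    also have "diag_mat (D z) = map (\<lambda>i. 1 + z * l i) [0..<d]"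
      by (auto simp: diag_mat_def D_def)
    finally show ?thesis by (simp add: prod.distinct_set_conv_list[symmetric] atLeast0LessThan)
  qed
  have "det P * det R = 1" using det_mult[OF car(1,2)] PR by simp
  hence "(\<Sum>k\<le>d. esm d (int k) A * z ^ k) = (\<Sum>k\<le>d. es {..<d} (int k) l * z ^ k)" for z
    unfolding det_eq_esm[symmetric] PDR[symmetric] prod_eq_es[symmetric] dD[symmetric]
    using det_mult[OF mult_carrier_mat[OF car(1,3)] car(2), of z] det_mult[OF car(1,3), of z] by simp
  thus ?thesis using polyfun_eq_coeffs[of "\<lambda>k. esm d (int k) A" d "\<lambda>k. es {..<d} (int k) l"] assms(3) by blast
qed

text \<open>Double counting by the bijection between \<open>(S, a)\<close> with \<open>a\<close> in
  \<open>S\<close> and \<open>(a, S - {a})\<close>. It turns a derivative that strikes one factor of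
  each product into symmetric functions of lower degree.\<close>

lemma sum_subsets_remove:
  assumes "finite I"
  shows "(\<Sum>S | S \<subseteq> I \<and> int (card S) = k. \<Sum>a\<in>S. g a (S - {a}))
    = (\<Sum>a\<in>I. \<Sum>T | T \<subseteq> I - {a} \<and> int (card T) = k - 1. (g a T :: real))"
proof -
  let ?S = "{S. S \<subseteq> I \<and> int (card S) = k}"
  let ?T = "\<lambda>a. {T. T \<subseteq> I - {a} \<and> int (card T) = k - 1}"
  have fS: "finite S" if "S \<subseteq> I" for S using that assms finite_subset by blast
  have "(\<Sum>S\<in>?S. \<Sum>a\<in>S. g a (S - {a})) = (\<Sum>(S,a)\<in>Sigma ?S (\<lambda>S. S). g a (S - {a}))"
    using assms fS by (intro sum.Sigma) auto
  also have "\<dots> = (\<Sum>(a,T)\<in>Sigma I ?T. g a T)"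
  proof (rule sum.reindex_bij_witness[where i = "\<lambda>(a,T). (insert a T, a)" and j = "\<lambda>(S,a). (a, S - {a})"])
    fix p assume "p \<in> Sigma ?S (\<lambda>S. S)"
    then obtain S a where p: "p = (S,a)" "S \<subseteq> I" "int (card S) = k" "a \<in> S" by auto
    have "card S = Suc (card (S - {a}))" using fS[OF p(2)] p(4) by (rule card.remove)
    hence "int (card (S - {a})) = k - 1" using p(3) by linarith
    moreover have "S - {a} \<subseteq> I - {a}" "a \<in> I" using p by auto
    ultimately show "(case p of (S, a) \<Rightarrow> (a, S - {a})) \<in> Sigma I ?T" unfolding p by simp
    show "(case case p of (S, a) \<Rightarrow> (a, S - {a}) of (a, T) \<Rightarrow> (insert a T, a)) = p"
      using p by auto
    show "(case case p of (S, a) \<Rightarrow> (a, S - {a}) of (a, T) \<Rightarrow> g a T) = (case p of (S, a) \<Rightarrow> g a (S - {a}))"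
      using p by auto
  next
    fix p assume "p \<in> Sigma I ?T"
    then obtain a T where p: "p = (a,T)" "a \<in> I" "T \<subseteq> I - {a}" "int (card T) = k - 1" by auto
    have aT: "a \<notin> T" "finite T" using p fS by auto
    hence "card (insert a T) = Suc (card T)" by (rule card_insert_disjoint[rotated])
    hence "int (card (insert a T)) = k" using p(4) by linarith
    moreover have "insert a T \<subseteq> I" using p by auto
    ultimately show "(case p of (a, T) \<Rightarrow> (insert a T, a)) \<in> Sigma ?S (\<lambda>S. S)" unfolding p by simp
    show "(case case p of (a, T) \<Rightarrow> (insert a T, a) of (S, a) \<Rightarrow> (a, S - {a})) = p"
      using p aT by auto
  qed
  also have "\<dots> = (\<Sum>a\<in>I. \<Sum>T\<in>?T a. g a T)"
    using assms by (intro sum.Sigma[symmetric]) auto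
  finally show ?thesis .
qed

text \<open>At a diagonal matrix every undifferentiated factor forces its index to be fixed, so only
  permutations of the differentiated indices \<open>T\<close> survive.\<close>

lemma sum_permutations_diag:
  assumes "finite S" "T \<subseteq> S"
  shows "(\<Sum>\<pi> | \<pi> permutes S. F \<pi> * (\<Prod>m\<in>S - T. if m = \<pi> m then l m else 0))
    = (\<Sum>\<pi> | \<pi> permutes T. F \<pi> * (\<Prod>m\<in>S - T. (l m :: real)))"
proof -
  have "(\<Sum>\<pi> | \<pi> permutes S. F \<pi> * (\<Prod>m\<in>S - T. if m = \<pi> m then l m else 0))
    = (\<Sum>\<pi> | \<pi> permutes T. F \<pi> * (\<Prod>m\<in>S - T. if m = \<pi> m then l m else 0))"
  proof (rule sum.mono_neutral_right)
    show "finite {\<pi>. \<pi> permutes S}" using assms by (simp add: finite_permutations)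
    show "{\<pi>. \<pi> permutes T} \<subseteq> {\<pi>. \<pi> permutes S}" using assms permutes_subset by blast
    show "\<forall>\<pi>\<in>{\<pi>. \<pi> permutes S} - {\<pi>. \<pi> permutes T}. F \<pi> * (\<Prod>m\<in>S - T. if m = \<pi> m then l m else 0) = 0"
    proof
      fix \<pi> assume p: "\<pi> \<in> {\<pi>. \<pi> permutes S} - {\<pi>. \<pi> permutes T}"
      have "\<exists>i\<in>S - T. \<pi> i \<noteq> i" using p permutes_superset[of \<pi> S T] by blast
      then obtain i where i: "i \<in> S - T" "\<pi> i \<noteq> i" by blast
      have "(\<Prod>m\<in>S - T. if m = \<pi> m then l m else 0) = 0"
        by (rule prod_zero[OF _ bexI[of _ i]]) (use i assms in auto)
      thus "F \<pi> * (\<Prod>m\<in>S - T. if m = \<pi> m then l m else 0) = 0" by simp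
    qed
  qed
  also have "\<dots> = (\<Sum>\<pi> | \<pi> permutes T. F \<pi> * (\<Prod>m\<in>S - T. l m))"
  proof (rule sum.cong[OF refl])
    fix \<pi> assume "\<pi> \<in> {\<pi>. \<pi> permutes T}"
    hence "(\<Prod>m\<in>S - T. if m = \<pi> m then l m else 0) = (\<Prod>m\<in>S - T. l m)"
      by (intro prod.cong refl) (auto simp: permutes_not_in)
    thus "F \<pi> * (\<Prod>m\<in>S - T. if m = \<pi> m then l m else 0) = F \<pi> * (\<Prod>m\<in>S - T. l m)" by simp
  qed
  finally show ?thesis .
qed

text \<open>One differentiated entry leaves only the identity permutation, two leave the identity
  and one transposition. The latter is the origin of
  \<open>X a a * X b b - X a b * X b a\<close>.\<close>

lemma jet2_minor:
  assumes fin: "finite S"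
    and A: "\<And>i j. i \<in> S \<Longrightarrow> j \<in> S \<Longrightarrow> jet2 (A i j) (if i = j then l i else 0) (X i j) (Y i j)"
  shows "jet2 (\<lambda>t. \<Sum>\<pi> | \<pi> permutes S. of_int (sign \<pi>) * (\<Prod>i\<in>S. A i (\<pi> i) t))
    (prod l S) (\<Sum>a\<in>S. X a a * prod l (S - {a}))
    ((\<Sum>a\<in>S. Y a a * prod l (S - {a})) +
     (\<Sum>a\<in>S. \<Sum>b\<in>S-{a}. (X a a * X b b - X a b * X b a) * prod l (S - {a} - {b})))"
proof -
  let ?P = "{\<pi>. \<pi> permutes S}"
  let ?d = "\<lambda>\<pi> i. if i = \<pi> i then l i else 0"
  let ?s = "\<lambda>\<pi>. of_int (sign \<pi>) :: real"
  have J: "jet2 (\<lambda>t. \<Sum>\<pi>\<in>?P. ?s \<pi> * (\<Prod>i\<in>S. A i (\<pi> i) t))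
    (\<Sum>\<pi>\<in>?P. ?s \<pi> * prod (?d \<pi>) S)
    (\<Sum>\<pi>\<in>?P. ?s \<pi> * (\<Sum>i\<in>S. X i (\<pi> i) * prod (?d \<pi>) (S - {i})))
    (\<Sum>\<pi>\<in>?P. ?s \<pi> * ((\<Sum>i\<in>S. Y i (\<pi> i) * prod (?d \<pi>) (S - {i})) +
      (\<Sum>i\<in>S. \<Sum>j\<in>S-{i}. X i (\<pi> i) * X j (\<pi> j) * prod (?d \<pi>) (S - {i} - {j}))))"
  proof (intro jet2_sum jet2_cmult jet2_prod fin, goal_cases)
    case (1 \<pi> i)
    hence "\<pi> i \<in> S" by (simp add: permutes_in_image)
    thus ?case using A[of i "\<pi> i"] 1 by simp
  qed
  have s0: "(\<Sum>\<pi>\<in>?P. ?s \<pi> * prod (?d \<pi>) S) = prod l S"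
    using sum_permutations_diag[OF fin, of "{}" ?s l] by simp
  have s1: "(\<Sum>\<pi>\<in>?P. ?s \<pi> * (\<Sum>i\<in>S. Z i (\<pi> i) * prod (?d \<pi>) (S - {i}))) = (\<Sum>a\<in>S. Z a a * prod l (S - {a}))"
    for Z
  proof -
    have "(\<Sum>\<pi>\<in>?P. ?s \<pi> * (\<Sum>i\<in>S. Z i (\<pi> i) * prod (?d \<pi>) (S - {i})))
      = (\<Sum>i\<in>S. \<Sum>\<pi>\<in>?P. ?s \<pi> * Z i (\<pi> i) * prod (?d \<pi>) (S - {i}))"
      by (subst sum.swap) (simp add: sum_distrib_left mult.assoc)
    also have "\<dots> = (\<Sum>a\<in>S. Z a a * prod l (S - {a}))"
    proof (rule sum.cong[OF refl])
      fix i assume "i \<in> S"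
      hence "(\<Sum>\<pi>\<in>?P. (?s \<pi> * Z i (\<pi> i)) * prod (?d \<pi>) (S - {i}))
       = (\<Sum>\<pi> | \<pi> permutes {i}. ?s \<pi> * Z i (\<pi> i) * prod l (S - {i}))"
        by (intro sum_permutations_diag[OF fin]) auto
      also have "{\<pi>. \<pi> permutes {i}} = {id}" by (auto simp: permutes_sing)
      finally show "(\<Sum>\<pi>\<in>?P. (?s \<pi> * Z i (\<pi> i)) * prod (?d \<pi>) (S - {i})) = Z i i * prod l (S - {i})"
        by simp
    qed
    finally show ?thesis .
  qed
  have s2: "(\<Sum>\<pi>\<in>?P. ?s \<pi> * (\<Sum>i\<in>S. \<Sum>j\<in>S-{i}. X i (\<pi> i) * X j (\<pi> j) * prod (?d \<pi>) (S - {i} - {j})))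
    = (\<Sum>a\<in>S. \<Sum>b\<in>S-{a}. (X a a * X b b - X a b * X b a) * prod l (S - {a} - {b}))"
  proof -
    have "(\<Sum>\<pi>\<in>?P. ?s \<pi> * (\<Sum>i\<in>S. \<Sum>j\<in>S-{i}. X i (\<pi> i) * X j (\<pi> j) * prod (?d \<pi>) (S - {i} - {j})))
      = (\<Sum>\<pi>\<in>?P. \<Sum>i\<in>S. \<Sum>j\<in>S-{i}. ?s \<pi> * (X i (\<pi> i) * X j (\<pi> j)) * prod (?d \<pi>) (S - {i} - {j}))"
      by (simp add: sum_distrib_left mult.assoc)
    also have "\<dots> = (\<Sum>i\<in>S. \<Sum>\<pi>\<in>?P. \<Sum>j\<in>S-{i}. ?s \<pi> * (X i (\<pi> i) * X j (\<pi> j)) * prod (?d \<pi>) (S - {i} - {j}))"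
      by (rule sum.swap)
    also have "\<dots> = (\<Sum>i\<in>S. \<Sum>j\<in>S-{i}. \<Sum>\<pi>\<in>?P. ?s \<pi> * (X i (\<pi> i) * X j (\<pi> j)) * prod (?d \<pi>) (S - {i} - {j}))"
      by (intro sum.cong refl sum.swap)
    also have "\<dots> = (\<Sum>a\<in>S. \<Sum>b\<in>S-{a}. (X a a * X b b - X a b * X b a) * prod l (S - {a} - {b}))"
    proof (intro sum.cong refl)
      fix i j assume ij: "i \<in> S" "j \<in> S - {i}"
      have e: "S - {i} - {j} = S - {i,j}" by auto
      have "(\<Sum>\<pi>\<in>?P. (?s \<pi> * (X i (\<pi> i) * X j (\<pi> j))) * prod (?d \<pi>) (S - {i,j}))
       = (\<Sum>\<pi> | \<pi> permutes {i,j}. ?s \<pi> * (X i (\<pi> i) * X j (\<pi> j)) * prod l (S - {i,j}))"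
        using ij by (intro sum_permutations_diag[OF fin]) auto
      also have "{\<pi>. \<pi> permutes {i,j}} = {id, Transposition.transpose i j}"
        by (auto simp: permutes_doubleton_iff)
      also have "(\<Sum>\<pi>\<in>\<dots>. ?s \<pi> * (X i (\<pi> i) * X j (\<pi> j)) * prod l (S - {i,j}))
        = (X i i * X j j - X i j * X j i) * prod l (S - {i,j})"
      proof -
        have ne: "id \<noteq> Transposition.transpose i j"
          using ij by (metis DiffD2 id_apply singletonI transpose_apply_first)
        have "sign (Transposition.transpose i j) = - 1" using ij by (auto simp: sign_swap_id)
        thus ?thesis using ne by (simp add: algebra_simps)
      qed
      finally show "(\<Sum>\<pi>\<in>?P. ?s \<pi> * (X i (\<pi> i) * X j (\<pi> j)) * prod (?d \<pi>) (S - {i} - {j}))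
        = (X i i * X j j - X i j * X j i) * prod l (S - {i} - {j})"
        unfolding e .
    qed
    finally show ?thesis .
  qed
  show ?thesis using J unfolding s0 s1 distrib_left sum.distrib s2 .
qed

lemma jet2_esm:
  assumes A: "\<And>i j. i < d \<Longrightarrow> j < d \<Longrightarrow> jet2 (A i j) (if i = j then l i else 0) (X i j) (Y i j)"
  shows "jet2 (\<lambda>t. esm d k (\<lambda>i j. A i j t)) (es {..<d} k l)
    (\<Sum>a<d. X a a * es ({..<d} - {a}) (k - 1) l)
    ((\<Sum>a<d. Y a a * es ({..<d} - {a}) (k - 1) l) +
     (\<Sum>a<d. \<Sum>b\<in>{..<d}-{a}. (X a a * X b b - X a b * X b a) * es ({..<d} - {a} - {b}) (k - 2) l))"
proof -
  let ?I = "{..<d}"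
  let ?S = "{S. S \<subseteq> ?I \<and> int (card S) = k}"
  have J: "jet2 (\<lambda>t. esm d k (\<lambda>i j. A i j t)) (\<Sum>S\<in>?S. prod l S)
    (\<Sum>S\<in>?S. \<Sum>a\<in>S. X a a * prod l (S - {a}))
    (\<Sum>S\<in>?S. (\<Sum>a\<in>S. Y a a * prod l (S - {a})) +
     (\<Sum>a\<in>S. \<Sum>b\<in>S-{a}. (X a a * X b b - X a b * X b a) * prod l (S - {a} - {b})))"
    unfolding esm_def
  proof (intro jet2_sum jet2_minor[where X = X and Y = Y], goal_cases)
    case (1 S) thus ?case using finite_subset[of S ?I] by auto
  next
    case (2 S i j)
    hence "i < d" "j < d" by auto
    thus ?case by (rule A)
  qed
  have s1: "(\<Sum>S\<in>?S. \<Sum>a\<in>S. Z a a * prod l (S - {a})) = (\<Sum>a<d. Z a a * es (?I - {a}) (k - 1) l)" for Z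
    unfolding es_def sum_distrib_left by (rule sum_subsets_remove) simp
  have s2: "(\<Sum>S\<in>?S. \<Sum>a\<in>S. \<Sum>b\<in>S-{a}. Z a b * prod l (S - {a} - {b}))
    = (\<Sum>a<d. \<Sum>b\<in>?I-{a}. Z a b * es (?I - {a} - {b}) (k - 2) l)" for Z
  proof -
    have "(\<Sum>S\<in>?S. \<Sum>a\<in>S. \<Sum>b\<in>S-{a}. Z a b * prod l (S - {a} - {b}))
      = (\<Sum>a<d. \<Sum>T | T \<subseteq> ?I - {a} \<and> int (card T) = k - 1. \<Sum>b\<in>T. Z a b * prod l (T - {b}))"
      by (rule sum_subsets_remove) simp
    also have "\<dots> = (\<Sum>a<d. \<Sum>b\<in>?I-{a}. \<Sum>T | T \<subseteq> ?I - {a} - {b} \<and> int (card T) = k - 1 - 1. Z a b * prod l T)"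
      by (intro sum.cong refl sum_subsets_remove) simp
    finally show ?thesis by (simp add: es_def sum_distrib_left)
  qed
  show ?thesis using J unfolding sum.distrib s1 s2 es_def[symmetric] .
qed

section \<open>Orthonormal eigenbases\<close>

definition onb :: "nat \<Rightarrow> (nat \<Rightarrow> 'a::euclidean_space) \<Rightarrow> bool" where
  "onb r e \<longleftrightarrow> (\<forall>i<r. \<forall>j<r. e i \<bullet> e j = (if i = j then 1 else 0))"

lemma onb_norm: "onb r e \<Longrightarrow> i < r \<Longrightarrow> norm (e i) = 1"
  by (simp add: onb_def norm_eq_1)

lemma onb_inj: "onb r e \<Longrightarrow> inj_on e {..<r}"
  unfolding onb_def inj_on_def by (metis lessThan_iff zero_neq_one)

lemma onb_independent:
  assumes "onb r e"
  shows "independent (e ` {..<r})"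
proof (rule pairwise_orthogonal_independent)
  show "pairwise orthogonal (e ` {..<r})"
    using assms unfolding pairwise_def orthogonal_def onb_def by auto
  show "0 \<notin> e ` {..<r}"
  proof
    assume "0 \<in> e ` {..<r}"
    then obtain i where "i < r" "e i = 0" by auto
    thus False using onb_norm[OF assms, of i] by simp
  qed
qed

lemma onb_span:
  fixes e :: "nat \<Rightarrow> 'a::euclidean_space"
  assumes "onb DIM('a) e"
  shows "span (e ` {..<DIM('a)}) = UNIV"
proof -
  have "card (e ` {..<DIM('a)}) = DIM('a)" using card_image[OF onb_inj[OF assms]] by simp
  thus ?thesis using onb_independent[OF assms]
    by (metis card_eq_dim dim_UNIV finite_imageI finite_lessThan order_refl subset_UNIV top.extremum_uniqueI)
qed

lemma onb_expand:
  fixes e :: "nat \<Rightarrow> 'a::euclidean_space"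
  assumes "onb DIM('a) e"
  shows "x = (\<Sum>i<DIM('a). (x \<bullet> e i) *\<^sub>R e i)"
proof -
  let ?y = "x - (\<Sum>i<DIM('a). (x \<bullet> e i) *\<^sub>R e i)"
  have "?y \<bullet> e j = 0" if "j < DIM('a)" for j
  proof -
    have "(\<Sum>i<DIM('a). (x \<bullet> e i) *\<^sub>R e i) \<bullet> e j = (\<Sum>i<DIM('a). (x \<bullet> e i) * (e i \<bullet> e j))"
      by (simp add: inner_sum_left)
    also have "\<dots> = (\<Sum>i<DIM('a). (x \<bullet> e i) * (if i = j then 1 else 0))"
      using assms that unfolding onb_def by (intro sum.cong) auto
    also have "\<dots> = x \<bullet> e j" using that by (simp add: if_distrib cong: if_cong)
    finally show ?thesis by (simp add: inner_diff_left)
  qed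
  hence "orthogonal ?y y" if "y \<in> e ` {..<DIM('a)}" for y using that by (auto simp: orthogonal_def)
  hence "orthogonal ?y ?y"
    using orthogonal_to_span[of ?y "e ` {..<DIM('a)}" ?y] onb_span[OF assms] by auto
  thus ?thesis by (simp add: orthogonal_self)
qed

lemma onb_parseval:
  fixes e :: "nat \<Rightarrow> 'a::euclidean_space"
  assumes "onb DIM('a) e"
  shows "x \<bullet> y = (\<Sum>i<DIM('a). (x \<bullet> e i) * (y \<bullet> e i))"
proof -
  have "x \<bullet> y = (\<Sum>i<DIM('a). (x \<bullet> e i) *\<^sub>R e i) \<bullet> y" using onb_expand[OF assms, of x] by simp
  also have "\<dots> = (\<Sum>i<DIM('a). (x \<bullet> e i) * (e i \<bullet> y))" by (simp only: inner_sum_left inner_scaleR_left)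
  finally show ?thesis by (simp only: inner_commute[of y])
qed

text \<open>The form \<open>B u u - B v v * (u \<bullet> u)\<close> is nonnegative on
  \<open>S\<close> and vanishes at \<open>v\<close>, so its restriction to \<open>v + t *R x\<close>
  is a nonnegative quadratic in \<open>t\<close> without constant term; its linear coefficient must
  be zero.\<close>

lemma rayleigh_min_eigen:
  fixes B :: "'a::euclidean_space \<Rightarrow> 'a \<Rightarrow> real"
  assumes bil: "bilinear B" and sym: "\<And>u v. B u v = B v u"
    and S: "subspace S" and v: "v \<in> S" "norm v = 1"
    and min: "\<And>u. u \<in> S \<Longrightarrow> norm u = 1 \<Longrightarrow> B v v \<le> B u u"
    and x: "x \<in> S"
  shows "B v x = B v v * (v \<bullet> x)"
proof -
  have lin: "B (a + b) c = B a c + B b c" "B c (a + b) = B c a + B c b"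
    "B (r *\<^sub>R a) c = r * B a c" "B c (r *\<^sub>R a) = r * B c a" for a b c r
    using bil by (auto simp: bilinear_ladd bilinear_radd bilinear_lmul bilinear_rmul)
  have ge: "B v v * (u \<bullet> u) \<le> B u u" if u: "u \<in> S" for u
  proof (cases "u = 0")
    case True thus ?thesis using lin(3)[of 0 0 0] by simp
  next
    case False
    have "B v v \<le> B (u /\<^sub>R norm u) (u /\<^sub>R norm u)"
      using False u S by (intro min) (auto simp: subspace_scale)
    also have "\<dots> = B u u / (norm u)\<^sup>2" by (simp add: lin power2_eq_square field_simps)
    finally show ?thesis using False by (simp add: field_simps power2_norm_eq_inner)
  qed
  define c where "c = B v x - B v v * (v \<bullet> x)"
  define D where "D = B x x - B v v * (x \<bullet> x)"
  have quad: "2 * t * c + t\<^sup>2 * D \<ge> 0" for t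
  proof -
    have "v + t *\<^sub>R x \<in> S" using v x S by (intro subspace_add subspace_scale)
    from ge[OF this] show ?thesis using v(2)
      by (simp add: lin inner_add_left inner_add_right sym[of x v] inner_commute[of x v] c_def D_def
          power2_eq_square norm_eq_1 algebra_simps)
  qed
  have "D \<ge> 0" using ge[OF x] by (simp add: D_def)
  have "c = 0"
  proof (rule ccontr)
    assume "c \<noteq> 0"
    \<comment> \<open>Dividing by \<open>D + 1\<close> instead of \<open>D\<close> avoids a zero
      denominator; at this \<open>t\<close> the quadratic equals
      \<open>- t^2 * (D + 2)\<close>.\<close>
    define t where "t = - c / (D + 1)"
    have "D + 1 \<noteq> 0" using \<open>D \<ge> 0\<close> by simp
    hence c: "c = - t * (D + 1)" by (simp add: t_def)
    have "2 * t * c + t\<^sup>2 * D = - (t\<^sup>2 * (D + 2))"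
      by (subst c) (simp add: power2_eq_square algebra_simps)
    also have "\<dots> < 0" using \<open>D \<ge> 0\<close> \<open>c \<noteq> 0\<close> c by auto
    finally show False using quad[of t] by simp
  qed
  thus ?thesis by (simp add: c_def)
qed

lemma eigenbasis_step:
  fixes B :: "'a::euclidean_space \<Rightarrow> 'a \<Rightarrow> real" and e :: "nat \<Rightarrow> 'a"
  assumes bil: "bilinear B" and sym: "\<And>u v. B u v = B v u"
    and e: "onb r e" "\<And>i x. i < r \<Longrightarrow> B (e i) x = l i * (e i \<bullet> x)" and r: "r < DIM('a)"
  obtains v where "norm v = 1" "\<And>i. i < r \<Longrightarrow> e i \<bullet> v = 0" "\<And>x. B v x = B v v * (v \<bullet> x)"
proof -
  define S where "S = {u. \<forall>i<r. e i \<bullet> u = 0}"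
  have sub: "subspace S" unfolding S_def subspace_def by (auto simp: inner_add_right)
  have lin: "B c (\<Sum>i\<in>J. g i) = (\<Sum>i\<in>J. B c (g i))" "B c (x + y) = B c x + B c y"
     "B c (s *\<^sub>R x) = s * B c x" for c g J x y s
    using bil by (auto simp: bilinear_def linear_sum linear_add linear_scale)
  have S: "S = {u. \<forall>w\<in>e ` {..<r}. orthogonal w u}" by (auto simp: S_def orthogonal_def)
  have "dim (e ` {..<r}) \<le> card (e ` {..<r})" by (rule dim_le_card') simp
  also have "\<dots> \<le> r" using card_image_le[of "{..<r}" e] by simp
  finally have "dim (e ` {..<r}) < DIM('a)" using r by simp
  then obtain a where a: "a \<noteq> 0" "\<And>w. w \<in> span (e ` {..<r}) \<Longrightarrow> orthogonal a w"
    using orthogonal_to_subspace_exists by blast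
  have "a \<bullet> e i = 0" if "i < r" for i
    using a(2)[OF span_base, of "e i"] that by (auto simp: orthogonal_def)
  hence aS: "a \<in> S" by (simp add: S_def inner_commute)
  define K where "K = S \<inter> sphere 0 1"
  have "closed S" using sub by (rule closed_subspace)
  hence "compact K" unfolding K_def using compact_sphere by (simp add: closed_Int_compact)
  moreover have "K \<noteq> {}"
  proof -
    have "a /\<^sub>R norm a \<in> K" using aS a(1) sub by (auto simp: K_def subspace_scale)
    thus ?thesis by auto
  qed
  moreover have "continuous_on K (\<lambda>u. B u u)"
  proof -
    have "bounded_bilinear B" using bil bilinear_conv_bounded_bilinear by blast
    thus ?thesis by (rule bounded_bilinear.continuous_on[OF _ continuous_on_id continuous_on_id])
  qed
  ultimately have "\<exists>v\<in>K. \<forall>u\<in>K. B v v \<le> B u u" by (rule continuous_attains_inf)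
  then obtain v where v: "v \<in> K" "\<And>u. u \<in> K \<Longrightarrow> B v v \<le> B u u" by blast
  have vS: "v \<in> S" "norm v = 1" using v by (auto simp: K_def)
  show ?thesis
  proof
    show "norm v = 1" by fact
    show "e i \<bullet> v = 0" if "i < r" for i using vS that by (auto simp: S_def)
    fix x
    define y where "y = x - (\<Sum>i<r. (e i \<bullet> x) *\<^sub>R e i)"
    have "e j \<bullet> y = 0" if "j < r" for j
    proof -
      have "e j \<bullet> (\<Sum>i<r. (e i \<bullet> x) *\<^sub>R e i) = (\<Sum>i<r. (e i \<bullet> x) * (if j = i then 1 else 0))"
        using e(1) that unfolding onb_def inner_sum_right by (intro sum.cong) auto
      also have "\<dots> = e j \<bullet> x" using that by (simp add: if_distrib cong: if_cong)
      finally show ?thesis by (simp add: y_def inner_diff_right)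
    qed
    hence yS: "y \<in> S" by (simp add: S_def)
    have By: "B v y = B v v * (v \<bullet> y)"
      by (rule rayleigh_min_eigen[OF bil sym sub vS _ yS]) (use v(2) in \<open>auto simp: K_def\<close>)
    have ve: "v \<bullet> e i = 0" "B v (e i) = 0" if "i < r" for i
      using vS(1) e(2)[OF that, of v] that sym[of v "e i"] by (auto simp: S_def inner_commute)
    have x: "x = y + (\<Sum>i<r. (e i \<bullet> x) *\<^sub>R e i)" by (simp add: y_def)
    have "B v x = B v y" by (subst x) (simp add: lin ve)
    moreover have "v \<bullet> x = v \<bullet> y" by (subst x) (simp add: inner_add_right inner_sum_right ve)
    ultimately show "B v x = B v v * (v \<bullet> x)" using By by simp
  qed
qed

text \<open>The initial vectors are preserved because later frames begin with prescribed
  eigenvectors: the radial direction, and often a tangent eigenvector as second one.\<close>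

lemma eigenbasis_extend:
  fixes B :: "'a::euclidean_space \<Rightarrow> 'a \<Rightarrow> real" and e :: "nat \<Rightarrow> 'a"
  assumes bil: "bilinear B" and sym: "\<And>u v. B u v = B v u"
    and e: "onb r e" "\<And>i x. i < r \<Longrightarrow> B (e i) x = B (e i) (e i) * (e i \<bullet> x)" and r: "r \<le> DIM('a)"
  shows "\<exists>e'. (\<forall>i<r. e' i = e i) \<and> onb DIM('a) e' \<and>
    (\<forall>i<DIM('a). \<forall>x. B (e' i) x = B (e' i) (e' i) * (e' i \<bullet> x))"
  using e r
proof (induction "DIM('a) - r" arbitrary: r e)
  case 0
  hence "r = DIM('a)" by simp
  thus ?case using 0(2,3) by (intro exI[of _ e] conjI allI impI refl) blast+
next
  case (Suc n)
  have r: "r < DIM('a)" using Suc by simp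
  obtain v where v: "norm v = 1" "\<And>i. i < r \<Longrightarrow> e i \<bullet> v = 0" "\<And>x. B v x = B v v * (v \<bullet> x)"
    using eigenbasis_step[OF bil sym Suc.prems(1,2) r] by blast
  define f where "f = e(r := v)"
  have f: "onb (Suc r) f"
    using Suc.prems(1) v by (auto simp: onb_def f_def less_Suc_eq inner_commute norm_eq_1)
  have g: "B (f i) x = B (f i) (f i) * (f i \<bullet> x)" if "i < Suc r" for i x
  proof (cases "i = r")
    case True
    thus ?thesis using v(3)[of x] by (simp only: f_def fun_upd_same)
  next
    case False
    hence "i < r" using that by simp
    thus ?thesis using Suc.prems(2)[of i x] False by (simp only: f_def fun_upd_other not_False_eq_True)
  qed
  have "\<exists>e'. (\<forall>i<Suc r. e' i = f i) \<and> onb DIM('a) e' \<and>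
    (\<forall>i<DIM('a). \<forall>x. B (e' i) x = B (e' i) (e' i) * (e' i \<bullet> x))"
  proof (rule Suc.hyps(1))
    show "n = DIM('a) - Suc r" using Suc.hyps(2) r by linarith
    show "Suc r \<le> DIM('a)" using r by linarith
  qed (fact f, rule g)
  then obtain e' where "\<forall>i<Suc r. e' i = f i" "onb DIM('a) e'"
    "\<forall>i<DIM('a). \<forall>x. B (e' i) x = B (e' i) (e' i) * (e' i \<bullet> x)" by blast
  moreover have "e' i = e i" if "i < r" for i
    using \<open>\<forall>i<Suc r. e' i = f i\<close> that by (simp add: f_def)
  ultimately show ?case by blast
qed

section \<open>Inverse concavity of Hessian quotients\<close>

lemma jet2_reflect: "jet2 f a b c \<Longrightarrow> jet2 (\<lambda>t. f (- t)) a (- b) c"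
proof -
  assume j: "jet2 f a b c"
  obtain f' where f': "\<forall>\<^sub>F t in nhds 0. (f has_real_derivative f' t) (at t)"
    "(f' has_real_derivative c) (at 0)" "f 0 = a" "f' 0 = b" using j by (rule jet2E)
  have "jet2 (\<lambda>t. f (- t)) (f 0) (f' 0 * - 1) (c * (- 1)\<^sup>2 + f' 0 * 0)"
  proof (rule jet2_compose)
    show "jet2 uminus 0 (- 1) 0" using jet2_uminus[OF jet2_id] by simp
  qed (fact f'(1), fact f'(2))
  thus ?thesis unfolding f'(3,4) by simp
qed

lemma esm_diag:
  assumes "k \<le> d"
  shows "esm d (int k) (\<lambda>i j. if i = j then x i else 0) = es {..<d} (int k) x"
proof (rule esm_orthogonal_diag[where Q = "\<lambda>i j. if i = j then 1 else 0"])
  have delta: "(\<Sum>m<d. (if i = m then 1 else 0) * g m) = g i" if "i < d" for i and g :: "nat \<Rightarrow> real"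
  proof -
    have "(\<Sum>m<d. (if i = m then 1 else 0) * g m) = (\<Sum>m<d. if i = m then g m else 0)"
      by (rule sum.cong) auto
    thus ?thesis using that by simp
  qed
  fix i j assume ij: "i < d" "j < d"
  show "(\<Sum>m<d. (if i = m then 1 else 0) * (if j = m then 1 else 0)) = (if i = j then 1 else (0::real))"
    using delta[OF ij(1), of "\<lambda>m. if j = m then 1 else 0"] by auto
  have "(\<Sum>m<d. x m * (if i = m then 1 else 0) * (if j = m then 1 else 0))
     = (\<Sum>m<d. (if i = m then 1 else 0) * (x m * (if j = m then 1 else 0)))"
    by (rule sum.cong) auto
  also have "\<dots> = (if i = j then x i else 0)" unfolding delta[OF ij(1)] by auto
  finally show "(if i = j then x i else 0) = (\<Sum>m<d. x m * (if i = m then 1 else 0) * (if j = m then 1 else 0))" ..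
qed (rule assms)

lemma jet2_es:
  assumes "\<And>i. i < d \<Longrightarrow> jet2 (f i) (x i) (y i) (z i)" "k \<le> d"
  shows "jet2 (\<lambda>t. es {..<d} (int k) (\<lambda>i. f i t)) (es {..<d} (int k) x)
    (\<Sum>a<d. y a * es ({..<d} - {a}) (int k - 1) x)
    ((\<Sum>a<d. z a * es ({..<d} - {a}) (int k - 1) x) +
     (\<Sum>a<d. \<Sum>b\<in>{..<d}-{a}. y a * y b * es ({..<d} - {a} - {b}) (int k - 2) x))"
proof -
  have J: "jet2 (\<lambda>t. esm d (int k) (\<lambda>i j. if i = j then f i t else 0)) (es {..<d} (int k) x)
    (\<Sum>a<d. (if a = a then y a else 0) * es ({..<d} - {a}) (int k - 1) x)
    ((\<Sum>a<d. (if a = a then z a else 0) * es ({..<d} - {a}) (int k - 1) x) +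
     (\<Sum>a<d. \<Sum>b\<in>{..<d}-{a}. ((if a = a then y a else 0) * (if b = b then y b else 0)
        - (if a = b then y a else 0) * (if b = a then y b else 0)) * es ({..<d} - {a} - {b}) (int k - 2) x))"
  proof (rule jet2_esm[where X = "\<lambda>i j. if i = j then y i else 0" and Y = "\<lambda>i j. if i = j then z i else 0"])
    fix i j assume "i < d" "j < d"
    thus "jet2 (\<lambda>t. if i = j then f i t else 0) (if i = j then x i else 0) (if i = j then y i else 0) (if i = j then z i else 0)"
      using assms(1)[of i] jet2_const[of 0] by auto
  qed
  have e: "(\<Sum>b\<in>{..<d}-{a}. ((if a = a then y a else 0) * (if b = b then y b else 0)
        - (if a = b then y a else 0) * (if b = a then y b else 0)) * es ({..<d} - {a} - {b}) (int k - 2) x)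
     = (\<Sum>b\<in>{..<d}-{a}. y a * y b * es ({..<d} - {a} - {b}) (int k - 2) x)" for a
    by (intro sum.cong refl) auto
  show ?thesis using J unfolding e esm_diag[OF assms(2)] by simp
qed

definition dlog :: "nat \<Rightarrow> int \<Rightarrow> (nat \<Rightarrow> real) \<Rightarrow> nat \<Rightarrow> real" where
  "dlog d k x a = es ({..<d} - {a}) (k - 1) x / es {..<d} k x"

definition ddlog :: "nat \<Rightarrow> int \<Rightarrow> (nat \<Rightarrow> real) \<Rightarrow> nat \<Rightarrow> nat \<Rightarrow> real" where
  "ddlog d k x a b = es ({..<d} - {a} - {b}) (k - 2) x / es {..<d} k x"

text \<open>The second derivative of \<open>ln (esm d k)\<close> at the diagonal matrix
  \<open>x\<close> in the direction \<open>X\<close>. Terms with \<open>a = b\<close> may stay in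
  the sum because their bracket is zero.\<close>

definition hess :: "nat \<Rightarrow> int \<Rightarrow> (nat \<Rightarrow> real) \<Rightarrow> (nat \<Rightarrow> nat \<Rightarrow> real) \<Rightarrow> real" where
  "hess d k x X = (\<Sum>a<d. \<Sum>b<d. (X a a * X b b - X a b * X b a) * ddlog d k x a b)
     - (\<Sum>a<d. X a a * dlog d k x a)\<^sup>2"

lemma jet2_ln_esm:
  assumes "\<And>i j. i < d \<Longrightarrow> j < d \<Longrightarrow> jet2 (A i j) (if i = j then x i else 0) (X i j) (Y i j)"
    and "es {..<d} k x > 0"
  shows "jet2 (\<lambda>t. ln (esm d k (\<lambda>i j. A i j t))) (ln (es {..<d} k x))
    (\<Sum>a<d. X a a * dlog d k x a) ((\<Sum>a<d. Y a a * dlog d k x a) + hess d k x X)"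
proof -
  have e: "(\<Sum>b\<in>{..<d}-{a}. (X a a * X b b - X a b * X b a) * es ({..<d} - {a} - {b}) (k - 2) x)
    = (\<Sum>b<d. (X a a * X b b - X a b * X b a) * es ({..<d} - {a} - {b}) (k - 2) x)" if "a < d" for a
    by (rule sum.mono_neutral_left) (use that in auto)
  have e2: "(\<Sum>a<d. \<Sum>b\<in>{..<d}-{a}. (X a a * X b b - X a b * X b a) * es ({..<d} - {a} - {b}) (k - 2) x)
    = (\<Sum>a<d. \<Sum>b<d. (X a a * X b b - X a b * X b a) * es ({..<d} - {a} - {b}) (k - 2) x)"
    by (intro sum.cong refl e) auto
  show ?thesis
    using jet2_ln[OF jet2_esm[OF assms(1)] assms(2)]
    unfolding e2 hess_def dlog_def ddlog_def
    by (simp add: add_divide_distrib sum_divide_distrib algebra_simps)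
qed

text \<open>Gradient and second derivative, at the diagonal matrix with entries \<open>x\<close>, of
  \<open>log \<sigma>\<^sub>k - log \<sigma>\<^sub>m\<close> as a function of the matrix.\<close>

definition qd :: "nat \<Rightarrow> int \<Rightarrow> int \<Rightarrow> (nat \<Rightarrow> real) \<Rightarrow> nat \<Rightarrow> real" where
  "qd d k m x a = dlog d k x a - dlog d m x a"

definition qh :: "nat \<Rightarrow> int \<Rightarrow> int \<Rightarrow> (nat \<Rightarrow> real) \<Rightarrow> (nat \<Rightarrow> nat \<Rightarrow> real) \<Rightarrow> real" where
  "qh d k m x X = hess d k x X - hess d m x X"

lemma jet2_ln_quot:
  assumes "\<And>i j. i < d \<Longrightarrow> j < d \<Longrightarrow> jet2 (A i j) (if i = j then x i else 0) (X i j) (Y i j)"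
    and "es {..<d} k x > 0" "es {..<d} m x > 0"
  shows "jet2 (\<lambda>t. ln (esm d k (\<lambda>i j. A i j t)) - ln (esm d m (\<lambda>i j. A i j t)))
    (ln (es {..<d} k x) - ln (es {..<d} m x))
    (\<Sum>a<d. X a a * qd d k m x a) ((\<Sum>a<d. Y a a * qd d k m x a) + qh d k m x X)"
  using jet2_diff[OF jet2_ln_esm[OF assms(1,2)] jet2_ln_esm[OF assms(1,3)]]
  by (simp add: qd_def qh_def right_diff_distrib sum_subtractf algebra_simps)

lemma sum_sq_le: "finite A \<Longrightarrow> (\<Sum>j\<in>A. r j)\<^sup>2 \<le> real (card A) * (\<Sum>j\<in>A. (r j :: real)\<^sup>2)"
  using Cauchy_Schwarz_ineq_sum[of "\<lambda>_. 1" r A] by simp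

lemma ln_telescope:
  assumes "p \<le> (q::nat)" "\<And>j. p \<le> j \<Longrightarrow> j \<le> q \<Longrightarrow> E j > (0::real)"
  shows "ln (E p) - ln (E q) = - (\<Sum>j=p..<q. ln (E (Suc j) / E j))"
  using assms
proof (induction q rule: dec_induct)
  case (step n)
  have "E n > 0" "E (Suc n) > 0" using step by auto
  hence e: "ln (E (Suc n) / E n) = ln (E (Suc n)) - ln (E n)" by (rule ln_divide_pos[rotated])
  have "ln (E p) - ln (E n) = - (\<Sum>j = p..<n. ln (E (Suc j) / E j))" using step by simp
  thus ?case using step.hyps(1) e by (simp add: sum.atLeastLessThan_Suc del: ln_div ln_divide_pos)
qed simp

text \<open>Superadditivity and homogeneity of degree one give
  \<open>Q (\<mu> + t \<nu>) + Q (\<mu> - t \<nu>) <= 2 * Q \<mu>\<close>. Adding the reflected jet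
  cancels the first-order part, and the minimum test is applied to a function with second
  coefficient \<open>- 2 * c\<close>.\<close>

lemma quotient_concave_jet:
  assumes pos: "\<And>i. i < d \<Longrightarrow> \<mu> i > 0" and j: "j < d"
    and J: "jet2 (\<lambda>t. es {..<d} (int j + 1) (\<lambda>i. \<mu> i + t * \<nu> i) / es {..<d} (int j) (\<lambda>i. \<mu> i + t * \<nu> i)) a b c"
  shows "c \<le> 0"
proof -
  let ?y = "\<lambda>t i. \<mu> i + t * \<nu> i"
  let ?Q = "\<lambda>y. es {..<d} (int j + 1) y / es {..<d} (int j) y"
  have "\<forall>\<^sub>F t in nhds 0. \<forall>i\<in>{..<d}. ?y t i > 0 \<and> ?y (-t) i > 0"
  proof (intro eventually_ball_finite finite_lessThan ballI eventually_conj)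
    fix i assume "i \<in> {..<d}"
    hence p: "\<mu> i > 0" using pos by simp
    have "((\<lambda>t. \<mu> i + t * \<nu> i) \<longlongrightarrow> \<mu> i + 0 * \<nu> i) (nhds 0)"
      "((\<lambda>t. \<mu> i + (-t) * \<nu> i) \<longlongrightarrow> \<mu> i + (-0) * \<nu> i) (nhds 0)"
      by (intro tendsto_intros filterlim_ident)+
    thus "\<forall>\<^sub>F t in nhds 0. ?y t i > 0" "\<forall>\<^sub>F t in nhds 0. ?y (-t) i > 0"
      using p by (auto dest: order_tendstoD)
  qed
  hence ev: "\<forall>\<^sub>F t in nhds 0. 2 * a - (?Q (?y t) + ?Q (?y (-t))) \<ge> 0"
  proof eventually_elim
    case (elim t)
    have "?Q (?y t) + ?Q (?y (-t)) \<le> ?Q (\<lambda>i. ?y t i + ?y (-t) i)"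
      using elim j by (intro es_quot_superadd) auto
    also have "(\<lambda>i. ?y t i + ?y (-t) i) = (\<lambda>i. 2 * \<mu> i)" by (simp add: fun_eq_iff)
    also have "?Q (\<lambda>i. 2 * \<mu> i) = 2 * ?Q \<mu>"
      using es_scale[of "{..<d}" "Suc j" 2 \<mu>] es_scale[of "{..<d}" j 2 \<mu>]
      by (simp add: add.commute)
    also have "?Q \<mu> = a" using jet2_at0[OF J] by simp
    finally show ?case by simp
  qed
  have "jet2 (\<lambda>t. 2 * a - (?Q (?y t) + ?Q (?y (-t)))) (2 * a - (a + a)) (0 - (b + - b)) (0 - (c + c))"
    using jet2_diff[OF jet2_const[of "2 * a"] jet2_add[OF J jet2_reflect[OF J]]] by simp
  from jet2_min(2)[OF this] ev show ?thesis by simp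
qed

text \<open>Along a line in the space of inverses, \<open>log sigma_k - log sigma_m\<close> becomes
  minus a sum of \<open>k - m\<close> logarithms of concave quotients. A second derivative of
  \<open>- log\<close> of a concave function is at least the square of the logarithmic derivative,
  and Cauchy-Schwarz over the \<open>k - m\<close> terms yields the right side.\<close>

lemma qh_diag_ineq:
  assumes x: "\<And>i. i < d \<Longrightarrow> x i > 0" and mk: "m < k" "k \<le> d"
  shows "qh d (int k) (int m) x (\<lambda>i j. if i = j then z i else 0)
      + 2 * (\<Sum>a<d. qd d (int k) (int m) x a * (z a)\<^sup>2 / x a)
     \<ge> (\<Sum>a<d. z a * qd d (int k) (int m) x a)\<^sup>2 / real (k - m)"
proof -
  let ?I = "{..<d}"
  \<comment> \<open>The line \<open>\<mu> + t * \<nu>\<close> is chosen so that its entrywise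
    inverse starts at \<open>x\<close> with velocity \<open>z\<close>. The acceleration of the
    inverse is then \<open>2 * z^2 / x\<close>, which is the correction term of the
    statement.\<close>
  define \<mu> where "\<mu> i = inverse (x i)" for i
  define \<nu> where "\<nu> i = - z i / (x i)\<^sup>2" for i
  define y where "y t i = \<mu> i + t * \<nu> i" for t i
  define X where "X i j = (if i = j then z i else 0)" for i j :: nat
  define Y where "Y i j = (if i = j then 2 * (z i)\<^sup>2 / x i else 0)" for i j :: nat
  have \<mu>: "\<mu> i > 0" if "i < d" for i using x[OF that] by (simp add: \<mu>_def)
  have jy: "jet2 (\<lambda>t. y t i) (\<mu> i) (\<nu> i) 0" for i
    using jet2_add[OF jet2_const[of "\<mu> i"] jet2_mult[OF jet2_id jet2_const[of "\<nu> i"]]]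
    by (simp add: y_def)
  have ji: "jet2 (\<lambda>t. inverse (y t i)) (x i) (z i) (2 * (z i)\<^sup>2 / x i)" if "i < d" for i
  proof -
    have xi: "x i > 0" using x that .
    have "- \<nu> i / (\<mu> i)\<^sup>2 = z i" "2 * (\<nu> i)\<^sup>2 / \<mu> i ^ 3 - 0 / (\<mu> i)\<^sup>2 = 2 * (z i)\<^sup>2 / x i" "inverse (\<mu> i) = x i"
      using xi by (auto simp: \<mu>_def \<nu>_def field_simps power2_eq_square power3_eq_cube)
    thus ?thesis using jet2_inverse[OF jy[of i]] \<mu>[OF that] by simp
  qed
  have jA: "jet2 (\<lambda>t. if i = j then inverse (y t i) else 0) (if i = j then x i else 0) (X i j) (Y i j)"
    if "i < d" "j < d" for i j
    using ji[of i] that jet2_const[of 0] by (auto simp: X_def Y_def)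
  have pk: "es ?I (int k) x > 0" "es ?I (int m) x > 0" using x mk by (auto intro!: es_pos)
  define L where "L t = ln (es ?I (int k) (\<lambda>i. inverse (y t i))) - ln (es ?I (int m) (\<lambda>i. inverse (y t i)))" for t
  have J1: "jet2 L (L 0) (\<Sum>a<d. X a a * qd d (int k) (int m) x a)
     ((\<Sum>a<d. Y a a * qd d (int k) (int m) x a) + qh d (int k) (int m) x X)"
  proof -
    have J: "jet2 L (ln (es ?I (int k) x) - ln (es ?I (int m) x)) (\<Sum>a<d. X a a * qd d (int k) (int m) x a)
     ((\<Sum>a<d. Y a a * qd d (int k) (int m) x a) + qh d (int k) (int m) x X)"
      using jet2_ln_quot[OF jA pk] mk unfolding L_def by (simp add: esm_diag)
    thus ?thesis using jet2_at0[OF J] by simp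
  qed
  define E where "E t j = es ?I (int j) (y t)" for t j
  \<comment> \<open>By \<open>es_inverse\<close>, degrees \<open>k\<close> and \<open>m\<close> of
    the inverses become the complementary degrees \<open>p\<close> and \<open>q\<close>, both
    divided by the full product, which cancels in the difference of logarithms.\<close>
  define p where "p = d - k"
  define q where "q = d - m"
  have pq: "p < q" "q \<le> d" "q - p = k - m" using mk by (auto simp: p_def q_def)
  have ypos: "\<forall>\<^sub>F t in nhds 0. \<forall>i\<in>?I. y t i > 0"
  proof (intro eventually_ball_finite finite_lessThan ballI)
    fix i assume "i \<in> ?I"
    hence p: "\<mu> i > 0" using \<mu> by simp
    have "((\<lambda>t. \<mu> i + t * \<nu> i) \<longlongrightarrow> \<mu> i + 0 * \<nu> i) (nhds 0)"
      by (intro tendsto_intros filterlim_ident)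
    thus "\<forall>\<^sub>F t in nhds 0. y t i > 0" unfolding y_def using p by (auto dest: order_tendstoD)
  qed
  have Epos: "E 0 j > 0" if "j \<le> d" for j
    unfolding E_def using \<mu> that by (intro es_pos) (auto simp: y_def)
  have jE: "\<exists>b c. jet2 (\<lambda>t. E t j) (E 0 j) b c" if "j \<le> d" for j
  proof -
    have "\<exists>b c. jet2 (\<lambda>t. es ?I (int j) (\<lambda>i. y t i)) (es ?I (int j) \<mu>) b c"
      using jet2_es[of d "\<lambda>i t. y t i" \<mu> \<nu> "\<lambda>_. 0" j, OF jy that] by blast
    moreover have "es ?I (int j) \<mu> = E 0 j" unfolding E_def by (rule es_cong) (simp add: y_def)
    ultimately show ?thesis by (simp add: E_def)
  qed
  have "\<exists>b c. jet2 (\<lambda>t. E t (Suc j) / E t j) (E 0 (Suc j) / E 0 j) b c" if "j < d" for j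
  proof -
    obtain b c where 1: "jet2 (\<lambda>t. E t (Suc j)) (E 0 (Suc j)) b c" using jE[of "Suc j"] \<open>j < d\<close> by auto
    obtain b' c' where 2: "jet2 (\<lambda>t. E t j) (E 0 j) b' c'" using jE[of j] \<open>j < d\<close> by auto
    have "E 0 j \<noteq> 0" using Epos[of j] that by auto
    thus ?thesis using jet2_mult[OF 1 jet2_inverse[OF 2]] unfolding divide_inverse by blast
  qed
  then obtain b c where jQ: "\<And>j. j < d \<Longrightarrow> jet2 (\<lambda>t. E t (Suc j) / E t j) (E 0 (Suc j) / E 0 j) (b j) (c j)"
    by metis
  have cneg: "c j \<le> 0" if "j < d" for j
  proof -
    have yl: "y t = (\<lambda>i. \<mu> i + t * \<nu> i)" for t by (simp add: y_def fun_eq_iff)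
    have "int (Suc j) = int j + 1" by simp
    hence J: "jet2 (\<lambda>t. es ?I (int j + 1) (\<lambda>i. \<mu> i + t * \<nu> i) / es ?I (int j) (\<lambda>i. \<mu> i + t * \<nu> i))
      (E 0 (Suc j) / E 0 j) (b j) (c j)"
      using jQ[OF that] unfolding E_def yl by (simp only:)
    show ?thesis by (rule quotient_concave_jet[OF \<mu> that J])
  qed
  define r where "r j = b j / (E 0 (Suc j) / E 0 j)" for j
  define w where "w j = c j / (E 0 (Suc j) / E 0 j)" for j
  \<comment> \<open>The part \<open>w j\<close> is nonpositive by concavity of the quotient, and
    \<open>- (r j)^2\<close> comes from the logarithm.\<close>
  have J2: "jet2 (\<lambda>t. - (\<Sum>j=p..<q. ln (E t (Suc j) / E t j))) (- (\<Sum>j=p..<q. ln (E 0 (Suc j) / E 0 j)))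
     (- (\<Sum>j=p..<q. r j)) (- (\<Sum>j=p..<q. w j - (r j)\<^sup>2))"
  proof (intro jet2_uminus jet2_sum)
    fix j assume "j \<in> {p..<q}"
    hence "j < d" using pq by auto
    thus "jet2 (\<lambda>t. ln (E t (Suc j) / E t j)) (ln (E 0 (Suc j) / E 0 j)) (r j) (w j - (r j)\<^sup>2)"
      unfolding r_def w_def by (intro jet2_ln jQ) (auto intro!: divide_pos_pos Epos)
  qed
  have ev: "\<forall>\<^sub>F t in nhds 0. L t = - (\<Sum>j=p..<q. ln (E t (Suc j) / E t j))"
    using ypos
  proof eventually_elim
    case (elim t)
    have Ep: "E t j > 0" if "j \<le> d" for j
      unfolding E_def using elim that by (intro es_pos) auto
    have "es ?I (int kk) (\<lambda>i. inverse (y t i)) = E t (d - kk) / E t d" if "kk \<le> d" for kk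
      using es_inverse[of ?I "y t" "int kk"] elim Ep[of d] that
      unfolding E_def by (simp add: of_nat_diff field_simps)
    hence "L t = ln (E t p / E t d) - ln (E t q / E t d)" using mk by (simp add: L_def p_def q_def)
    also have "\<dots> = ln (E t p) - ln (E t q)"
      using Ep[of d] Ep[of p] Ep[of q] pq by (simp add: ln_div)
    also have "\<dots> = - (\<Sum>j=p..<q. ln (E t (Suc j) / E t j))"
      using pq Ep by (intro ln_telescope) auto
    finally show ?case .
  qed
  have eq1: "(\<Sum>a<d. X a a * qd d (int k) (int m) x a) = - (\<Sum>j=p..<q. r j)"
    and eq2: "(\<Sum>a<d. Y a a * qd d (int k) (int m) x a) + qh d (int k) (int m) x X = - (\<Sum>j=p..<q. w j - (r j)\<^sup>2)"
    by (rule jet2_unique(2)[OF J1 J2 ev], rule jet2_unique(3)[OF J1 J2 ev])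
  have w: "w j \<le> 0" if "j \<in> {p..<q}" for j
  proof -
    have "j < d" using that pq by auto
    thus ?thesis unfolding w_def using cneg[of j] Epos[of j] Epos[of "Suc j"]
      by (intro divide_nonpos_pos divide_pos_pos) auto
  qed
  \<comment> \<open>The number of telescoped quotients is \<open>q - p = k - m\<close>; this is
    where the constant in the gain comes from.\<close>
  have "(\<Sum>j=p..<q. r j)\<^sup>2 \<le> real (k - m) * (\<Sum>j=p..<q. (r j)\<^sup>2)"
    using sum_sq_le[of "{p..<q}" r] pq by simp
  hence "(\<Sum>a<d. X a a * qd d (int k) (int m) x a)\<^sup>2 / real (k - m) \<le> (\<Sum>j=p..<q. (r j)\<^sup>2)"
  proof -
    have "real (k - m) > 0" using mk by simp
    moreover have "(\<Sum>a<d. X a a * qd d (int k) (int m) x a)\<^sup>2 = (\<Sum>j=p..<q. r j)\<^sup>2"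
      by (simp only: eq1 power2_minus)
    ultimately show ?thesis
      using \<open>(\<Sum>j=p..<q. r j)\<^sup>2 \<le> real (k - m) * (\<Sum>j=p..<q. (r j)\<^sup>2)\<close>
      by (simp only: pos_divide_le_eq mult.commute)
  qed
  also have "\<dots> \<le> (\<Sum>a<d. Y a a * qd d (int k) (int m) x a) + qh d (int k) (int m) x X"
    unfolding eq2 using sum_nonpos[of "{p..<q}" w] w by (simp add: sum_subtractf)
  finally have fin: "(\<Sum>a<d. X a a * qd d (int k) (int m) x a)\<^sup>2 / real (k - m)
    \<le> (\<Sum>a<d. Y a a * qd d (int k) (int m) x a) + qh d (int k) (int m) x X" .
  have Xe: "X = (\<lambda>i j. if i = j then z i else 0)" by (simp add: X_def fun_eq_iff)
  show ?thesis
  proof -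
    have e1: "(\<Sum>a<d. Y a a * qd d (int k) (int m) x a) = 2 * (\<Sum>a<d. qd d (int k) (int m) x a * (z a)\<^sup>2 / x a)"
      unfolding sum_distrib_left by (intro sum.cong refl) (simp add: Y_def)
    have e2: "(\<Sum>a<d. X a a * qd d (int k) (int m) x a) = (\<Sum>a<d. z a * qd d (int k) (int m) x a)"
      by (intro sum.cong refl) (simp add: X_def)
    have q: "qh d (int k) (int m) x (\<lambda>i j. if i = j then z i else 0) = qh d (int k) (int m) x X"
      by (rule arg_cong[OF Xe[symmetric]])
    show ?thesis unfolding q using fin[unfolded e1 e2] by (simp only: add.commute)
  qed
qed

section \<open>Inverse concavity for full matrices and its semi-definite limit\<close>

context
  fixes d k m :: nat
  assumes mk: "m < k" "k \<le> d"
begin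

private abbreviation "D \<equiv> qd d (int k) (int m)"
private abbreviation "Hs \<equiv> qh d (int k) (int m)"

lemma qd_eq:
  assumes "es {..<d} (int k) x > 0" "es {..<d} (int m) x > 0" "a < d"
  shows "D x a = (es ({..<d} - {a}) (int k - 1) x * es ({..<d} - {a}) (int m) x
     - es ({..<d} - {a}) (int k) x * es ({..<d} - {a}) (int m - 1) x)
     / (es {..<d} (int k) x * es {..<d} (int m) x)"
proof -
  have "es {..<d} j x = es ({..<d} - {a}) j x + x a * es ({..<d} - {a}) (j - 1) x" for j
    using assms(3) by (intro es_remove) auto
  hence num: "es ({..<d} - {a}) (int k - 1) x * es {..<d} (int m) x - es ({..<d} - {a}) (int m - 1) x * es {..<d} (int k) x
    = es ({..<d} - {a}) (int k - 1) x * es ({..<d} - {a}) (int m) x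
     - es ({..<d} - {a}) (int k) x * es ({..<d} - {a}) (int m - 1) x"
    by (simp only:) (simp add: algebra_simps)
  have "D x a = (es ({..<d} - {a}) (int k - 1) x * es {..<d} (int m) x - es ({..<d} - {a}) (int m - 1) x * es {..<d} (int k) x)
     / (es {..<d} (int k) x * es {..<d} (int m) x)"
    using assms(1,2) unfolding qd_def dlog_def by (subst diff_frac_eq) auto
  thus ?thesis unfolding num .
qed

text \<open>Quantitative ellipticity: the strong Newton inequality bounds the subtracted product in
  \<open>qd_eq\<close> by the fraction \<open>m / k\<close> of the other one, and
  \<open>m < k\<close> leaves a positive remainder.\<close>

lemma qd_ge:
  assumes x: "\<And>i. i < d \<Longrightarrow> x i \<ge> 0" and "es {..<d} (int k) x > 0" "es {..<d} (int m) x > 0" "a < d"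
  shows "D x a \<ge> (1 - real m / real k) * (es ({..<d} - {a}) (int k - 1) x * es ({..<d} - {a}) (int m) x)
     / (es {..<d} (int k) x * es {..<d} (int m) x)"
proof -
  let ?u = "es ({..<d} - {a}) (int k - 1) x * es ({..<d} - {a}) (int m) x"
  let ?v = "es ({..<d} - {a}) (int k) x * es ({..<d} - {a}) (int m - 1) x"
  have "real k * ?v \<le> real m * ?u"
    using es_newton_strong[of "{..<d} - {a}" x "int m" "int k"] x mk by simp
  hence "?v \<le> real m / real k * ?u" using mk by (simp add: field_simps)
  hence "(1 - real m / real k) * ?u \<le> ?u - ?v" by (simp add: algebra_simps)
  thus ?thesis unfolding qd_eq[OF assms(2-4)] using assms(2,3) by (intro divide_right_mono) auto
qed

lemma qd_nonneg:
  assumes "\<And>i. i < d \<Longrightarrow> x i \<ge> 0" "es {..<d} (int k) x > 0" "es {..<d} (int m) x > 0" "a < d"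
  shows "D x a \<ge> 0"
proof -
  have "0 \<le> (1 - real m / real k) * (es ({..<d} - {a}) (int k - 1) x * es ({..<d} - {a}) (int m) x)
     / (es {..<d} (int k) x * es {..<d} (int m) x)"
    using assms mk by (intro divide_nonneg_nonneg mult_nonneg_nonneg es_nonneg) (auto simp: less_imp_le)
  thus ?thesis using qd_ge[OF assms] by simp
qed

text \<open>Two neighbouring Newton inequalities are multiplied and the common factor is cancelled.
  Where that factor could vanish, the left side is already zero, so this case is split off
  first.\<close>

lemma es_newton_two:
  assumes "finite I" "\<And>i. i \<in> I \<Longrightarrow> x i > 0" "m' \<le> k'" 
  shows "es I k' x * es I (m' - 2) x \<le> es I (k' - 2) x * es I m' x"
proof (cases "m' - 2 < 0 \<or> int (card I) < k'")
  case True
  have nn: "es I j x \<ge> 0" for j using assms(2) by (intro es_nonneg) (simp add: less_imp_le)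
  have "es I k' x * es I (m' - 2) x = 0" using True es_large[OF assms(1)] by auto
  thus ?thesis using mult_nonneg_nonneg[OF nn[of "k' - 2"] nn[of m']] by linarith
next
  case False
  have nn: "\<And>i. i \<in> I \<Longrightarrow> x i \<ge> 0" using assms(2) by (simp add: less_imp_le)
  have p: "es I (m' - 1) x > 0" "es I (k' - 1) x > 0"
    using False assms by (auto intro!: es_pos)
  have 1: "es I k' x * es I (m' - 1) x \<le> es I (k' - 1) x * es I m' x"
    by (rule es_newton[OF assms(1) nn assms(3)])
  have "es I (k' - 1) x * es I (m' - 1 - 1) x \<le> es I (k' - 1 - 1) x * es I (m' - 1) x"
    by (rule es_newton[OF assms(1) nn]) (use assms(3) in auto)
  hence 2: "es I (k' - 1) x * es I (m' - 2) x \<le> es I (k' - 2) x * es I (m' - 1) x" by simp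
  have "(es I k' x * es I (m' - 1) x) * (es I (k' - 1) x * es I (m' - 2) x)
     \<le> (es I (k' - 1) x * es I m' x) * (es I (k' - 2) x * es I (m' - 1) x)"
    by (rule mult_mono[OF 1 2]) (auto intro!: mult_nonneg_nonneg es_nonneg nn)
  hence "(es I (m' - 1) x * es I (k' - 1) x) * (es I k' x * es I (m' - 2) x)
    \<le> (es I (m' - 1) x * es I (k' - 1) x) * (es I (k' - 2) x * es I m' x)"
    by (simp only: ac_simps)
  thus ?thesis by (rule mult_left_le_imp_le) (use p in simp)
qed

text \<open>Let \<open>s j\<close> and \<open>S j\<close> denote the symmetric functions without and
  with the indices \<open>a\<close>, \<open>b\<close>. The contribution of degree \<open>j\<close>
  collapses to \<open>(1 - s j / S j) / (x a * x b)\<close>, so the claim becomes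
  \<open>s k / S k <= s m / S m\<close>, a consequence of the one-step and two-step Newton
  inequalities.\<close>

lemma offdiag_pair:
  assumes x: "\<And>i. i < d \<Longrightarrow> x i > 0" and ab: "a < d" "b < d" "a \<noteq> b"
  shows "D x a / x b + D x b / x a - (ddlog d (int k) x a b - ddlog d (int m) x a b) \<ge> 0"
proof -
  let ?J = "{..<d} - {a} - {b}"
  let ?s = "\<lambda>j. es ?J j x"
  let ?S = "\<lambda>j. es {..<d} j x"
  have eqJ: "{..<d} - {b} - {a} = ?J" by auto
  have ea: "es ({..<d} - {a}) j x = ?s j + x b * ?s (j - 1)" for j
    using ab by (intro es_remove) auto
  have eb: "es ({..<d} - {b}) j x = ?s j + x a * ?s (j - 1)" for j
    using ab es_remove[of "{..<d} - {b}" a j x] unfolding eqJ by auto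
  have S: "?S j = ?s j + (x a + x b) * ?s (j - 1) + x a * x b * ?s (j - 2)" for j
    using ab es_remove[of "{..<d}" a j x] unfolding ea by (simp add: algebra_simps)
  have xa: "x a > 0" and xb: "x b > 0" using x ab by auto
  have key: "(es ({..<d} - {a}) (j - 1) x / x b + es ({..<d} - {b}) (j - 1) x / x a - ?s (j - 2)) = (?S j - ?s j) / (x a * x b)" for j
  proof -
    have "?S j - ?s j = (x a + x b) * ?s (j - 1) + x a * x b * ?s (j - 2)" by (simp add: S)
    thus ?thesis unfolding ea eb using xa xb by (simp add: field_simps)
  qed
  have Sp: "?S (int k) > 0" "?S (int m) > 0" using x mk by (auto intro!: es_pos)
  have t: "dlog d (int j) x a / x b + dlog d (int j) x b / x a - ddlog d (int j) x a b
      = (1 - ?s (int j) / ?S (int j)) / (x a * x b)" if "?S (int j) > 0" for j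
  proof -
    have "dlog d (int j) x a / x b + dlog d (int j) x b / x a - ddlog d (int j) x a b
      = (es ({..<d} - {a}) (int j - 1) x / x b + es ({..<d} - {b}) (int j - 1) x / x a - ?s (int j - 2)) / ?S (int j)"
      unfolding dlog_def ddlog_def by (simp add: add_divide_distrib diff_divide_distrib mult.commute)
    also have "\<dots> = ((?S (int j) - ?s (int j)) / ?S (int j)) / (x a * x b)"
      unfolding key by simp
    finally show ?thesis using that by (simp add: diff_divide_distrib)
  qed
  have nn: "\<And>i. i \<in> ?J \<Longrightarrow> x i \<ge> 0" using x by (simp add: less_imp_le)
  have "?s (int k) * ?s (int m - 1) \<le> ?s (int k - 1) * ?s (int m)"
    by (rule es_newton[OF _ nn]) (use mk in auto)
  moreover have "?s (int k) * ?s (int m - 2) \<le> ?s (int k - 2) * ?s (int m)"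
    by (rule es_newton_two) (use x mk in auto)
  ultimately have "(x a + x b) * (?s (int k) * ?s (int m - 1)) + x a * x b * (?s (int k) * ?s (int m - 2))
     \<le> (x a + x b) * (?s (int k - 1) * ?s (int m)) + x a * x b * (?s (int k - 2) * ?s (int m))"
    using xa xb by (intro add_mono mult_left_mono) auto
  hence "?s (int k) * ?S (int m) \<le> ?s (int m) * ?S (int k)"
    unfolding S by (simp add: algebra_simps)
  hence le: "?s (int k) / ?S (int k) \<le> ?s (int m) / ?S (int m)"
    using Sp by (simp add: divide_le_eq pos_le_divide_eq mult.commute)
  have "D x a / x b + D x b / x a - (ddlog d (int k) x a b - ddlog d (int m) x a b)
    = (dlog d (int k) x a / x b + dlog d (int k) x b / x a - ddlog d (int k) x a b)
    - (dlog d (int m) x a / x b + dlog d (int m) x b / x a - ddlog d (int m) x a b)"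
    unfolding qd_def by (simp add: diff_divide_distrib)
  also have "\<dots> = (?s (int m) / ?S (int m) - ?s (int k) / ?S (int k)) / (x a * x b)"
    unfolding t[OF Sp(1)] t[OF Sp(2)] by (simp add: diff_divide_distrib)
  also have "\<dots> \<ge> 0" using le xa xb by simp
  finally show ?thesis .
qed

text \<open>At a diagonal matrix the second derivative has no mixed terms between diagonal and
  off-diagonal entries. The diagonal part is \<open>qh_diag_ineq\<close>; the off-diagonal part
  follows from \<open>offdiag_pair\<close> after symmetrising in the two indices, which the symmetry
  of \<open>X\<close> permits.\<close>

lemma qh_full_ineq:
  assumes x: "\<And>i. i < d \<Longrightarrow> x i > 0" and sym: "\<And>i j. X i j = X j i"
  shows "Hs x X + 2 * (\<Sum>a<d. \<Sum>i<d. D x a * (X a i)\<^sup>2 / x i) \<ge> (\<Sum>a<d. X a a * D x a)\<^sup>2 / real (k - m)"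
proof -
  let ?K = "\<lambda>a b. ddlog d (int k) x a b - ddlog d (int m) x a b"
  let ?X0 = "\<lambda>i j. if i = j then X i i else 0"
  let ?o = "\<lambda>a b. if a = b then 0 else (X a b)\<^sup>2"
  have split1: "Hs x X = Hs x ?X0 - (\<Sum>a<d. \<Sum>b<d. ?o a b * ?K a b)"
  proof -
    have "(X a a * X b b - X a b * X b a) * kk = (?X0 a a * ?X0 b b - ?X0 a b * ?X0 b a) * kk - ?o a b * kk"
      for a b kk
    proof (cases "a = b")
      case False
      thus ?thesis by (simp add: sym[of b a] power2_eq_square left_diff_distrib)
    qed simp
    hence "hess d j x X = hess d j x ?X0 - (\<Sum>a<d. \<Sum>b<d. ?o a b * ddlog d j x a b)" for j
      unfolding hess_def by (simp add: sum_subtractf)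
    thus ?thesis unfolding qh_def by (simp add: right_diff_distrib sum_subtractf)
  qed
  have split2: "(\<Sum>a<d. \<Sum>i<d. D x a * (X a i)\<^sup>2 / x i)
    = (\<Sum>a<d. D x a * (X a a)\<^sup>2 / x a) + (\<Sum>a<d. \<Sum>b<d. ?o a b * (D x a / x b))"
  proof -
    have "(\<Sum>i<d. D x a * (X a i)\<^sup>2 / x i) = D x a * (X a a)\<^sup>2 / x a + (\<Sum>b<d. ?o a b * (D x a / x b))"
      if "a < d" for a
    proof -
      have "(\<Sum>i<d. D x a * (X a i)\<^sup>2 / x i)
        = (\<Sum>i<d. (if i = a then D x a * (X a a)\<^sup>2 / x a else 0) + ?o a i * (D x a / x i))"
        by (rule sum.cong) auto
      also have "\<dots> = (\<Sum>i<d. if i = a then D x a * (X a a)\<^sup>2 / x a else 0) + (\<Sum>b<d. ?o a b * (D x a / x b))"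
        by (rule sum.distrib)
      finally show ?thesis using that by simp
    qed
    thus ?thesis by (simp add: sum.distrib)
  qed
  have swap: "(\<Sum>a<d. \<Sum>b<d. ?o a b * (D x a / x b)) = (\<Sum>a<d. \<Sum>b<d. ?o a b * (D x b / x a))"
  proof -
    have o: "?o a b = ?o b a" for a b using sym[of a b] by auto
    show ?thesis by (subst sum.swap, intro sum.cong refl, subst o, rule refl)
  qed
  have "0 \<le> (\<Sum>a<d. \<Sum>b<d. ?o a b * (D x a / x b + D x b / x a - ?K a b))"
  proof (intro sum_nonneg)
    fix a b assume "a \<in> {..<d}" "b \<in> {..<d}"
    thus "0 \<le> ?o a b * (D x a / x b + D x b / x a - ?K a b)"
      using offdiag_pair[of x a b, OF x] by (cases "a = b") auto
  qed
  also have "\<dots> = (\<Sum>a<d. \<Sum>b<d. ?o a b * (D x a / x b)) + (\<Sum>a<d. \<Sum>b<d. ?o a b * (D x b / x a)) - (\<Sum>a<d. \<Sum>b<d. ?o a b * ?K a b)"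
    by (simp only: distrib_left right_diff_distrib sum.distrib sum_subtractf)
  finally have off: "0 \<le> 2 * (\<Sum>a<d. \<Sum>b<d. ?o a b * (D x a / x b)) - (\<Sum>a<d. \<Sum>b<d. ?o a b * ?K a b)"
    unfolding swap by simp
  have diag: "Hs x ?X0 + 2 * (\<Sum>a<d. D x a * (X a a)\<^sup>2 / x a) \<ge> (\<Sum>a<d. X a a * D x a)\<^sup>2 / real (k - m)"
    by (rule qh_diag_ineq[OF x mk, where z = "\<lambda>a. X a a"])
  show ?thesis using off diag unfolding split1 split2 by simp
qed

text \<open>In the application at least the radial eigenvalue is zero, so
  \<open>(X a i)^2 / x i\<close> has no direct meaning; a bound that holds for every shift
  \<open>\<eta> > 0\<close> replaces it. The inequality is applied at \<open>x + \<eta>\<close>, and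
  the limit exists because the derivatives of the quotient have only sigma_k and sigma_m in their
  denominators.\<close>

lemma qh_limit_ineq:
  assumes x: "\<And>i. i < d \<Longrightarrow> x i \<ge> 0" and pos: "es {..<d} (int k) x > 0" "es {..<d} (int m) x > 0"
    and sym: "\<And>i j. X i j = X j i"
    and Y: "\<And>a \<eta>. a < d \<Longrightarrow> \<eta> > 0 \<Longrightarrow> Y a \<ge> 2 * (\<Sum>i<d. (X a i)\<^sup>2 / (x i + \<eta>))"
  shows "Hs x X + (\<Sum>a<d. D x a * Y a) \<ge> (\<Sum>a<d. X a a * D x a)\<^sup>2 / real (k - m)"
proof -
  define z where "z \<eta> i = x i + \<eta>" for \<eta> i
  have ev: "\<forall>\<^sub>F \<eta> in at_right 0. (\<Sum>a<d. X a a * D (z \<eta>) a)\<^sup>2 / real (k - m) \<le> Hs (z \<eta>) X + (\<Sum>a<d. D (z \<eta>) a * Y a)"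
    unfolding eventually_at_right_field
  proof (intro exI[of _ 1] conjI allI impI)
    fix \<eta> :: real assume \<eta>: "0 < \<eta>" "\<eta> < 1"
    have zp: "z \<eta> i > 0" if "i < d" for i using x[OF that] \<eta> by (simp add: z_def)
    have "2 * (\<Sum>a<d. \<Sum>i<d. D (z \<eta>) a * (X a i)\<^sup>2 / z \<eta> i) = (\<Sum>a<d. D (z \<eta>) a * (2 * (\<Sum>i<d. (X a i)\<^sup>2 / z \<eta> i)))"
      by (simp add: sum_distrib_left algebra_simps)
    also have "\<dots> \<le> (\<Sum>a<d. D (z \<eta>) a * Y a)"
    proof (intro sum_mono mult_left_mono)
      fix a assume a: "a \<in> {..<d}"
      show "2 * (\<Sum>i<d. (X a i)\<^sup>2 / z \<eta> i) \<le> Y a" using Y[of a \<eta>] a \<eta> by (simp add: z_def)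
      show "0 \<le> D (z \<eta>) a"
      proof (rule qd_nonneg)
        show "0 \<le> z \<eta> i" if "i < d" for i using zp[OF that] by simp
        show "0 < es {..<d} (int k) (z \<eta>)" "0 < es {..<d} (int m) (z \<eta>)"
          using zp mk by (auto intro!: es_pos)
      qed (use a in simp)
    qed
    finally show "(\<Sum>a<d. X a a * D (z \<eta>) a)\<^sup>2 / real (k - m) \<le> Hs (z \<eta>) X + (\<Sum>a<d. D (z \<eta>) a * Y a)"
      using qh_full_ineq[of "z \<eta>" X, OF zp] sym by simp
  qed auto
  have zi: "((\<lambda>\<eta>. z \<eta> i) \<longlongrightarrow> x i) (at_right 0)" for i
  proof -
    have "((\<lambda>\<eta>. x i + \<eta>) \<longlongrightarrow> x i + 0) (at_right 0)" by (intro tendsto_intros)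
    thus ?thesis by (simp add: z_def)
  qed
  have es: "((\<lambda>\<eta>. es I j (z \<eta>)) \<longlongrightarrow> es I j x) (at_right 0)" for I j
    unfolding es_def by (intro tendsto_sum tendsto_prod zi)
  have dl: "((\<lambda>\<eta>. dlog d j (z \<eta>) a) \<longlongrightarrow> dlog d j x a) (at_right 0)"
    "((\<lambda>\<eta>. ddlog d j (z \<eta>) a b) \<longlongrightarrow> ddlog d j x a b) (at_right 0)"
    if "es {..<d} j x > 0" for j a b
    unfolding dlog_def ddlog_def using that by (intro tendsto_divide es; simp)+
  have h: "((\<lambda>\<eta>. hess d j (z \<eta>) X) \<longlongrightarrow> hess d j x X) (at_right 0)" if "es {..<d} j x > 0" for j
    unfolding hess_def using that by (intro tendsto_intros dl)
  have D: "((\<lambda>\<eta>. D (z \<eta>) a) \<longlongrightarrow> D x a) (at_right 0)" for a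
    unfolding qd_def by (intro tendsto_intros dl pos)
  have H: "((\<lambda>\<eta>. Hs (z \<eta>) X) \<longlongrightarrow> Hs x X) (at_right 0)"
    unfolding qh_def by (intro tendsto_intros h pos)
  show ?thesis
  proof (rule tendsto_le[OF _ _ _ ev])
    show "((\<lambda>\<eta>. Hs (z \<eta>) X + (\<Sum>a<d. D (z \<eta>) a * Y a)) \<longlongrightarrow> Hs x X + (\<Sum>a<d. D x a * Y a)) (at_right 0)"
      by (intro tendsto_intros H D)
    show "((\<lambda>\<eta>. (\<Sum>a<d. X a a * D (z \<eta>) a)\<^sup>2 / real (k - m)) \<longlongrightarrow> (\<Sum>a<d. X a a * D x a)\<^sup>2 / real (k - m)) (at_right 0)"
      using mk by (intro tendsto_intros D) auto
  qed simp
qed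

section \<open>Uniform ellipticity\<close>

lemma es_upper:
  assumes "finite I" "card I \<le> d" "\<And>i. i \<in> I \<Longrightarrow> 0 \<le> x i \<and> x i \<le> B" "B \<ge> 1"
  shows "es I j x \<le> (real d * B) ^ d"
proof (cases "I = {}")
  case True
  have "0 < d" using mk by simp
  hence "1 \<le> real d * B" using assms(4) mult_mono[of 1 "real d" 1 B] by simp
  hence "1 \<le> (real d * B) ^ d" by (rule one_le_power)
  thus ?thesis using True by (auto simp: es_empty)
next
  case False
  have "0 < d" using mk by simp
  hence dB: "1 \<le> real d * B" using assms(4) mult_mono[of 1 "real d" 1 B] by simp
  have step: "es I (int i) x \<le> (real d * B) ^ i" for i
  proof (induction i)
    case 0 thus ?case using assms by simp
  next
    case (Suc i)
    have "es I (int i + 1) x \<le> real d * B * es I (int i) x"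
      by (rule es_bound_step) (use assms in auto)
    also have "\<dots> \<le> real d * B * (real d * B) ^ i" using Suc dB by (intro mult_left_mono) auto
    finally show ?case by (simp add: add.commute)
  qed
  show ?thesis
  proof (cases "0 \<le> j \<and> j \<le> int d")
    case True
    have "es I (int (nat j)) x \<le> (real d * B) ^ nat j" by (rule step)
    also have "\<dots> \<le> (real d * B) ^ d" using True dB by (intro power_increasing) auto
    finally show ?thesis using True by simp
  next
    case False
    hence "es I j x = 0" using es_large[OF assms(1), of j x] assms(2) by auto
    thus ?thesis using dB by simp
  qed
qed

lemma es_lower_iter:
  assumes "finite I" "card I \<le> d" "\<And>i. i \<in> I \<Longrightarrow> 0 \<le> x i \<and> x i \<le> B" "B \<ge> 0"
  shows "es I (int (i + j)) x \<le> (real d * B) ^ j * es I (int i) x"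
proof (induction j)
  case (Suc j)
  have "es I (int (i + j) + 1) x \<le> real d * B * es I (int (i + j)) x"
    by (rule es_bound_step) (use assms in auto)
  also have "\<dots> \<le> real d * B * ((real d * B) ^ j * es I (int i) x)"
    using Suc assms by (intro mult_left_mono) auto
  finally show ?case by (simp add: algebra_simps)
qed simp

text \<open>The constants depend on an upper bound for the entries and on a lower bound for sigma_k
  and sigma_m, but on no lower bound for the entries themselves. Hence they persist where the form
  degenerates.\<close>

lemma qd_uniform:
  assumes B: "B \<ge> 1" and s: "s > 0"
  shows "\<exists>c C. c > 0 \<and> C > 0 \<and> (\<forall>x. (\<forall>i<d. 0 \<le> x i \<and> x i \<le> B) \<longrightarrow> es {..<d} (int k) x \<ge> s \<longrightarrow> es {..<d} (int m) x \<ge> s \<longrightarrow>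
     (\<forall>a<d. c \<le> D x a \<and> D x a \<le> C \<and> (\<forall>j\<in>{k,m}. 0 \<le> dlog d (int j) x a \<and> dlog d (int j) x a \<le> C
       \<and> (\<forall>b<d. 0 \<le> ddlog d (int j) x a b \<and> ddlog d (int j) x a b \<le> C))))"
proof -
  define M where "M = (real d * B) ^ d"
  have d: "0 < d" using mk by simp
  have dB: "1 \<le> real d * B" using d B mult_mono[of 1 "real d" 1 B] by simp
  hence M: "M \<ge> 1" unfolding M_def by (rule one_le_power)
  \<comment> \<open>Three bounds are composed: without the index \<open>a\<close>, sigma_(k-1) is at
    least \<open>s / (d B + B)\<close>; comparing degrees down to \<open>m\<close> costs one factor
    \<open>M\<close>; and \<open>M * M\<close> bounds the denominator in
    \<open>qd_ge\<close>.\<close>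
  define c where "c = (1 - real m / real k) * ((s / (real d * B + B)) * ((s / (real d * B + B)) / M)) / (M * M)"
  have mk': "1 - real m / real k > 0" using mk by simp
  have c: "c > 0" unfolding c_def using mk' s M dB B by (intro divide_pos_pos mult_pos_pos) auto
  define C where "C = M / s"
  have C: "C > 0" using M s by (simp add: C_def)
  show ?thesis
  proof (intro exI conjI allI impI ballI)
    show "c > 0" "C > 0" by fact+
    fix x :: "nat \<Rightarrow> real" and a
    assume x: "\<forall>i<d. 0 \<le> x i \<and> x i \<le> B" and sk: "s \<le> es {..<d} (int k) x" and sm: "s \<le> es {..<d} (int m) x" and a: "a < d"
    have x0: "\<And>i. i < d \<Longrightarrow> 0 \<le> x i" using x by simp
    have up: "es I j x \<le> M" if "I \<subseteq> {..<d}" for I j unfolding M_def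
    proof (rule es_upper)
      show "finite I" using that finite_subset by blast
      show "card I \<le> d" using card_mono[OF finite_lessThan that] by simp
    qed (use x B that in auto)
    have nn: "es I j x \<ge> 0" if "I \<subseteq> {..<d}" for I j using that x0 by (intro es_nonneg) auto
    have lt: "0 \<le> dlog d (int j) x a'" "dlog d (int j) x a' \<le> C" "0 \<le> ddlog d (int j) x a' b" "ddlog d (int j) x a' b \<le> C"
      if "j \<in> {k,m}" for j b a'
    proof -
      have sj: "s \<le> es {..<d} (int j) x" using that sk sm by auto
      have q: "0 \<le> es J i x / es {..<d} (int j) x" "es J i x / es {..<d} (int j) x \<le> C" if "J \<subseteq> {..<d}" for J i
      proof -
        show "0 \<le> es J i x / es {..<d} (int j) x"
          by (rule divide_nonneg_nonneg[OF nn[OF that]]) (use sj s in linarith)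
        show "es J i x / es {..<d} (int j) x \<le> C" unfolding C_def
          by (rule frac_le[OF _ up[OF that] s sj]) (use M in linarith)
      qed
      have "{..<d} - {a'} \<subseteq> {..<d}" "{..<d} - {a'} - {b} \<subseteq> {..<d}" by auto
      thus "0 \<le> dlog d (int j) x a'" "dlog d (int j) x a' \<le> C" "0 \<le> ddlog d (int j) x a' b" "ddlog d (int j) x a' b \<le> C"
        unfolding dlog_def ddlog_def using q by blast+
    qed
    show "0 \<le> dlog d (int j) x a" "dlog d (int j) x a \<le> C" if "j \<in> {k,m}" for j by (rule lt(1)[OF that], rule lt(2)[OF that])
    show "0 \<le> ddlog d (int j) x a b" "ddlog d (int j) x a b \<le> C" if "j \<in> {k,m}" for j b by (rule lt(3)[OF that], rule lt(4)[OF that])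
    show "D x a \<le> C" unfolding qd_def using lt[of k a] lt[of m a] by auto
    let ?J = "{..<d} - {a}"
    have J: "finite ?J" "card ?J \<le> d" using a by auto
    have xJ: "0 \<le> x i \<and> x i \<le> B" if "i \<in> ?J" for i using x that by auto
    define r where "r = k - 1 - m"
    have kr: "int k - 1 = int (m + r)" using mk by (simp add: r_def)
    have "s \<le> es ?J (int k) x + x a * es ?J (int k - 1) x"
      using sk es_remove[of "{..<d}" a "int k" x] a by simp
    also have "\<dots> \<le> real d * B * es ?J (int k - 1) x + B * es ?J (int k - 1) x"
    proof (rule add_mono)
      have "es ?J (int k - 1 + 1) x \<le> real d * B * es ?J (int k - 1) x"
        by (rule es_bound_step) (use J xJ mk B in auto)
      thus "es ?J (int k) x \<le> real d * B * es ?J (int k - 1) x" by simp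
      show "x a * es ?J (int k - 1) x \<le> B * es ?J (int k - 1) x"
        using x a nn[of ?J "int k - 1"] by (intro mult_right_mono) auto
    qed
    finally have "s \<le> (real d * B + B) * es ?J (int k - 1) x" by (simp add: algebra_simps)
    hence A: "s / (real d * B + B) \<le> es ?J (int k - 1) x"
      using dB B by (simp add: divide_le_eq mult.commute)
    have "es ?J (int k - 1) x \<le> (real d * B) ^ r * es ?J (int m) x"
      unfolding kr by (rule es_lower_iter) (use J xJ B in auto)
    also have "\<dots> \<le> M * es ?J (int m) x"
      unfolding M_def using mk dB nn[of ?J "int m"]
      by (intro mult_right_mono power_increasing) (auto simp: r_def)
    finally have "s / (real d * B + B) \<le> es ?J (int m) x * M" using A by (simp only: mult.commute)
    moreover have "M > 0" using M by simp
    ultimately have "s / (real d * B + B) / M \<le> es ?J (int m) x" by (simp only: pos_divide_le_eq)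
    with A have prod: "(s / (real d * B + B)) * ((s / (real d * B + B)) / M) \<le> es ?J (int k - 1) x * es ?J (int m) x"
      using s dB B M by (intro mult_mono) (auto intro!: divide_nonneg_nonneg nn)
    have pk: "es {..<d} (int k) x > 0" "es {..<d} (int m) x > 0" using sk sm s by auto
    have "c \<le> (1 - real m / real k) * (es ?J (int k - 1) x * es ?J (int m) x) / (es {..<d} (int k) x * es {..<d} (int m) x)"
      unfolding c_def
    proof (rule frac_le)
      show "0 \<le> (1 - real m / real k) * (es ?J (int k - 1) x * es ?J (int m) x)"
        using mk' nn[of ?J] by (intro mult_nonneg_nonneg) auto
      show "(1 - real m / real k) * ((s / (real d * B + B)) * ((s / (real d * B + B)) / M))
        \<le> (1 - real m / real k) * (es ?J (int k - 1) x * es ?J (int m) x)"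
        using mk' by (intro mult_left_mono prod) simp
      show "0 < es {..<d} (int k) x * es {..<d} (int m) x" using pk by simp
      show "es {..<d} (int k) x * es {..<d} (int m) x \<le> M * M"
        using up[OF order_refl] pk M by (intro mult_mono) auto
    qed
    also have "\<dots> \<le> D x a" by (rule qd_ge[OF x0 pk a])
    finally show "c \<le> D x a" .
  qed
qed

end

section \<open>Deleting small rows and columns\<close>

definition cut :: "nat set \<Rightarrow> (nat \<Rightarrow> nat \<Rightarrow> real) \<Rightarrow> nat \<Rightarrow> nat \<Rightarrow> real" where
  "cut Z X i j = (if i \<in> Z \<or> j \<in> Z then 0 else X i j)"

lemma abs_mult_le: "\<bar>a\<bar> \<le> A \<Longrightarrow> \<bar>b\<bar> \<le> B \<Longrightarrow> \<bar>a * b\<bar> \<le> A * (B::real)"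
  unfolding abs_mult by (rule mult_mono) auto

text \<open>The second-order test at a touching point controls third derivatives only away from the
  radial and the touching direction. Entries in those two rows and columns are of size
  \<open>s\<close>, so they can be set to zero at a cost proportional to \<open>s\<close>.\<close>

lemma linear_cut:
  assumes B: "\<And>i j. i < d \<Longrightarrow> j < d \<Longrightarrow> \<bar>X i j\<bar> \<le> B"
    and s: "\<And>i j. i < d \<Longrightarrow> j < d \<Longrightarrow> i \<in> Z \<or> j \<in> Z \<Longrightarrow> \<bar>X i j\<bar> \<le> s" and s0: "0 \<le> s" and B0: "0 \<le> B"
    and w: "\<And>i. i < d \<Longrightarrow> \<bar>w i\<bar> \<le> C" and C: "0 \<le> C"
  shows "\<bar>(\<Sum>a<d. X a a * w a)\<^sup>2 - (\<Sum>a<d. cut Z X a a * w a)\<^sup>2\<bar> \<le> (real d * (s * C)) * (real d * (2 * B * C))"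
proof -
  let ?p = "\<Sum>a<d. X a a * w a" and ?q = "\<Sum>a<d. cut Z X a a * w a"
  have "\<bar>?p - ?q\<bar> \<le> real d * (s * C)"
  proof -
    have "\<bar>?p - ?q\<bar> = \<bar>\<Sum>a<d. (X a a - cut Z X a a) * w a\<bar>"
      by (simp add: left_diff_distrib sum_subtractf)
    also have "\<dots> \<le> (\<Sum>a<d. s * C)"
    proof (rule order_trans[OF sum_abs], rule sum_mono)
      fix a assume "a \<in> {..<d}"
      thus "\<bar>(X a a - cut Z X a a) * w a\<bar> \<le> s * C"
        using s[of a a] w[of a] s0 by (intro abs_mult_le) (auto simp: cut_def)
    qed
    finally show ?thesis by simp
  qed
  moreover have "\<bar>?p + ?q\<bar> \<le> real d * (2 * B * C)"
  proof -
    have "\<bar>?p + ?q\<bar> = \<bar>\<Sum>a<d. (X a a + cut Z X a a) * w a\<bar>"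
      by (simp add: distrib_right sum.distrib)
    also have "\<dots> \<le> (\<Sum>a<d. 2 * B * C)"
    proof (rule order_trans[OF sum_abs], rule sum_mono)
      fix a assume "a \<in> {..<d}"
      thus "\<bar>(X a a + cut Z X a a) * w a\<bar> \<le> 2 * B * C"
        using B[of a a] w[of a] B0 by (intro abs_mult_le) (auto simp: cut_def)
    qed
    finally show ?thesis by simp
  qed
  ultimately have "\<bar>(?p - ?q) * (?p + ?q)\<bar> \<le> (real d * (s * C)) * (real d * (2 * B * C))"
    by (rule abs_mult_le)
  thus ?thesis by (simp add: power2_eq_square algebra_simps)
qed

lemma hess_cut:
  assumes B: "\<And>i j. i < d \<Longrightarrow> j < d \<Longrightarrow> \<bar>X i j\<bar> \<le> B"
    and s: "\<And>i j. i < d \<Longrightarrow> j < d \<Longrightarrow> i \<in> Z \<or> j \<in> Z \<Longrightarrow> \<bar>X i j\<bar> \<le> s" and s0: "0 \<le> s" and B0: "0 \<le> B"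
    and w: "\<And>i. i < d \<Longrightarrow> \<bar>dlog d k x i\<bar> \<le> C" and C: "0 \<le> C"
    and dd: "\<And>i j. i < d \<Longrightarrow> j < d \<Longrightarrow> \<bar>ddlog d k x i j\<bar> \<le> C"
  shows "\<bar>hess d k x X - hess d k x (cut Z X)\<bar> \<le> s * (2 * (real d)\<^sup>2 * B * C * (1 + C))"
proof -
  let ?X = "cut Z X"
  let ?E = "\<lambda>Y a b. Y a a * Y b b - Y a b * Y b (a::nat) :: real"
  \<comment> \<open>If \<open>a\<close> or \<open>b\<close> lies in \<open>Z\<close>, each of the
    two products contains a small factor and the cut bracket is zero; otherwise the bracket is
    unchanged.\<close>
  have E: "\<bar>?E X a b - ?E ?X a b\<bar> \<le> 2 * (s * B)" if ab: "a < d" "b < d" for a b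
  proof (cases "a \<in> Z \<or> b \<in> Z")
    case True
    have "\<bar>X a a * X b b\<bar> \<le> s * B"
    proof (cases "a \<in> Z")
      case True thus ?thesis using s[of a a] B[of b b] ab by (intro abs_mult_le) auto
    next
      case False
      hence "\<bar>X b b * X a a\<bar> \<le> s * B" using s[of b b] B[of a a] ab True by (intro abs_mult_le) auto
      thus ?thesis by (simp add: mult.commute)
    qed
    moreover have "\<bar>X a b * X b a\<bar> \<le> s * B" using s[of a b] B[of b a] ab True by (intro abs_mult_le) auto
    moreover have "?E ?X a b = 0" using True by (auto simp: cut_def)
    ultimately show ?thesis by linarith
  next
    case False
    thus ?thesis using s0 B0 by (simp add: cut_def)
  qed
  have 1: "\<bar>(\<Sum>a<d. \<Sum>b<d. ?E X a b * ddlog d k x a b) - (\<Sum>a<d. \<Sum>b<d. ?E ?X a b * ddlog d k x a b)\<bar>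
    \<le> (real d)\<^sup>2 * (2 * (s * B) * C)"
  proof -
    have "(\<Sum>a<d. \<Sum>b<d. ?E X a b * ddlog d k x a b) - (\<Sum>a<d. \<Sum>b<d. ?E ?X a b * ddlog d k x a b)
      = (\<Sum>a<d. \<Sum>b<d. (?E X a b - ?E ?X a b) * ddlog d k x a b)"
      by (simp only: sum_subtractf left_diff_distrib)
    moreover have "\<bar>\<Sum>a<d. \<Sum>b<d. (?E X a b - ?E ?X a b) * ddlog d k x a b\<bar> \<le> (\<Sum>a<d. \<Sum>b<d. 2 * (s * B) * C)"
    proof (rule order_trans[OF sum_abs], rule sum_mono, rule order_trans[OF sum_abs], rule sum_mono)
      fix a b assume "a \<in> {..<d}" "b \<in> {..<d}"
      thus "\<bar>(?E X a b - ?E ?X a b) * ddlog d k x a b\<bar> \<le> 2 * (s * B) * C"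
        by (intro abs_mult_le E dd) auto
    qed
    ultimately show ?thesis by (simp add: power2_eq_square)
  qed
  have 2: "\<bar>(\<Sum>a<d. X a a * dlog d k x a)\<^sup>2 - (\<Sum>a<d. ?X a a * dlog d k x a)\<^sup>2\<bar> \<le> (real d * (s * C)) * (real d * (2 * B * C))"
    by (rule linear_cut[OF B s s0 B0 w C])
  have "\<bar>hess d k x X - hess d k x ?X\<bar> \<le> (real d)\<^sup>2 * (2 * (s * B) * C) + (real d * (s * C)) * (real d * (2 * B * C))"
    using 1 2 unfolding hess_def by linarith
  also have "\<dots> = s * (2 * (real d)\<^sup>2 * B * C * (1 + C))" by (simp add: power2_eq_square algebra_simps)
  finally show ?thesis .
qed

section \<open>Directional derivatives of continuously differentiable functions\<close>

abbreviation dr :: "'a::euclidean_space \<Rightarrow> ('a \<Rightarrow> real) \<Rightarrow> 'a \<Rightarrow> real" where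
  "dr u f \<equiv> \<lambda>x. frechet_derivative f (at x) u"

lemma frechet_derivative_cong_open:
  assumes "open U" "x \<in> U" "\<And>y. y \<in> U \<Longrightarrow> f y = g y"
  shows "frechet_derivative f (at x) = frechet_derivative g (at x)"
proof -
  have "(f has_derivative f') (at x) \<longleftrightarrow> (g has_derivative f') (at x)" for f'
    using has_derivative_transform_within_open[of _ f' x UNIV U] assms by metis
  thus ?thesis unfolding frechet_derivative_def by simp
qed

lemma differentiable_on_cong_open:
  assumes "open U" "\<And>y. y \<in> U \<Longrightarrow> f y = g y" "f differentiable_on U"
  shows "g differentiable_on U"
proof -
  have "g differentiable (at x)" if x: "x \<in> U" for x
  proof -
    obtain f' where "(f has_derivative f') (at x)"
      using assms(1,3) x by (auto simp: differentiable_on_eq_differentiable_at differentiable_def)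
    hence "(g has_derivative f') (at x)"
      using has_derivative_transform_within_open[of f f' x UNIV U g] assms(1,2) x by blast
    thus ?thesis by (auto simp: differentiable_def)
  qed
  thus ?thesis using assms(1) by (simp add: differentiable_on_eq_differentiable_at)
qed

lemma Ck_cong:
  assumes "open U" "\<And>y. y \<in> U \<Longrightarrow> f y = g y" "Ck k U f"
  shows "Ck k U g"
  using assms
proof (induction k arbitrary: f g)
  case 0
  thus ?case using continuous_on_cong[of U U f g] by simp
next
  case (Suc k)
  have "Ck k U (dr i g)" if "i \<in> Basis" for i
  proof (rule Suc.IH[of "dr i f"])
    show "Ck k U (dr i f)" using Suc that by simp
    show "dr i f y = dr i g y" if "y \<in> U" for y
      using frechet_derivative_cong_open[OF Suc.prems(1) that, of f g] Suc.prems(2) by simp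
  qed fact
  thus ?case using Suc differentiable_on_cong_open[of U f g] by simp
qed

lemma Ck_differentiable: "Ck (Suc k) U f \<Longrightarrow> open U \<Longrightarrow> x \<in> U \<Longrightarrow> f differentiable (at x)"
  by (simp add: differentiable_on_eq_differentiable_at)

lemma Ck_has_derivative:
  "Ck (Suc k) U f \<Longrightarrow> open U \<Longrightarrow> x \<in> U \<Longrightarrow> (f has_derivative (\<lambda>u. dr u f x)) (at x)"
  using Ck_differentiable frechet_derivative_works by blast

lemma Ck_mono: "Ck k U f \<Longrightarrow> j \<le> k \<Longrightarrow> Ck j U f"
proof (induction j arbitrary: f k)
  case 0
  show ?case
  proof (cases k)
    case (Suc m)
    thus ?thesis using 0 differentiable_imp_continuous_on by auto
  qed (use 0 in simp)
next
  case (Suc j)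
  then obtain m where m: "k = Suc m" by (cases k) auto
  show ?case using Suc m by auto
qed

lemma Ck_subset: "Ck k U f \<Longrightarrow> V \<subseteq> U \<Longrightarrow> Ck k V f"
proof (induction k arbitrary: f)
  case 0 thus ?case using continuous_on_subset by auto
next
  case (Suc k) thus ?case using differentiable_on_subset by auto
qed

lemma Ck_continuous: "Ck k U f \<Longrightarrow> continuous_on U f"
  using Ck_mono[of k U f 0] by simp

lemma Ck_SucI:
  assumes U: "open U" and d: "\<And>x. x \<in> U \<Longrightarrow> (f has_derivative f' x) (at x)"
    and C: "\<And>i. i \<in> Basis \<Longrightarrow> Ck k U (\<lambda>x. f' x i)"
  shows "Ck (Suc k) U f"
proof -
  have "dr i f x = f' x i" if "x \<in> U" for i x
    using frechet_derivative_at[OF d[OF that]] by simp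
  hence "Ck k U (dr i f)" if "i \<in> Basis" for i
    by (intro Ck_cong[OF U _ C[OF that]]) simp
  moreover have "f differentiable_on U"
    using d U by (auto simp: differentiable_on_eq_differentiable_at differentiable_def)
  ultimately show ?thesis by simp
qed

lemma Ck_const: "open U \<Longrightarrow> Ck k U (\<lambda>x. c)"
proof (induction k arbitrary: c)
  case (Suc k)
  show ?case by (rule Ck_SucI[where f' = "\<lambda>_ _. 0"]) (use Suc in \<open>auto intro: derivative_eq_intros\<close>)
qed simp

lemma Ck_add: "open U \<Longrightarrow> Ck k U f \<Longrightarrow> Ck k U g \<Longrightarrow> Ck k U (\<lambda>x. f x + g x)"
proof (induction k arbitrary: f g)
  case 0 thus ?case by (simp add: continuous_on_add)
next
  case (Suc k)
  show ?case
  proof (rule Ck_SucI[where f' = "\<lambda>x u. dr u f x + dr u g x"])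
    show "((\<lambda>x. f x + g x) has_derivative (\<lambda>u. dr u f x + dr u g x)) (at x)" if "x \<in> U" for x
      using Ck_has_derivative[OF Suc.prems(2,1) that] Ck_has_derivative[OF Suc.prems(3,1) that]
      by (rule has_derivative_add)
  qed (use Suc in auto)
qed

lemma Ck_mult: "open U \<Longrightarrow> Ck k U f \<Longrightarrow> Ck k U g \<Longrightarrow> Ck k U (\<lambda>x. f x * g x)"
proof (induction k arbitrary: f g)
  case 0 thus ?case by (simp add: continuous_on_mult)
next
  case (Suc k)
  show ?case
  proof (rule Ck_SucI[where f' = "\<lambda>x u. f x * dr u g x + dr u f x * g x"])
    show "((\<lambda>x. f x * g x) has_derivative (\<lambda>u. f x * dr u g x + dr u f x * g x)) (at x)" if "x \<in> U" for x
      using Ck_has_derivative[OF Suc.prems(2,1) that] Ck_has_derivative[OF Suc.prems(3,1) that]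
      by (rule has_derivative_mult)
    fix i :: 'a assume i: "i \<in> Basis"
    have "Ck k U f" "Ck k U g" by (rule Ck_mono[OF Suc.prems(2)], simp, rule Ck_mono[OF Suc.prems(3)], simp)
    moreover have "Ck k U (dr i f)" "Ck k U (dr i g)" using Suc.prems i by auto
    ultimately show "Ck k U (\<lambda>x. f x * dr i g x + dr i f x * g x)"
      using Suc.IH Suc.prems(1) by (intro Ck_add) auto
  qed fact
qed

lemma Ck_sum: "open U \<Longrightarrow> (\<And>i. i \<in> S \<Longrightarrow> Ck k U (f i)) \<Longrightarrow> Ck k U (\<lambda>x. \<Sum>i\<in>S. f i x)"
proof (induction S rule: infinite_finite_induct)
  case (insert a S)
  thus ?case using Ck_add[of U k "f a"] by simp
qed (auto simp: Ck_const)

lemma Ck_inner: "open U \<Longrightarrow> Ck k U (\<lambda>x. x \<bullet> a)"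
proof (cases k)
  case (Suc m)
  assume "open U"
  thus ?thesis unfolding Suc
    by (intro Ck_SucI[where f' = "\<lambda>x u. u \<bullet> a"] Ck_const) (auto intro!: derivative_eq_intros)
qed (auto intro!: continuous_intros)

lemma Ck_powr:
  assumes "open U" "Ck k U g" "\<And>x. x \<in> U \<Longrightarrow> g x > 0"
  shows "Ck k U (\<lambda>x. g x powr s)"
  using assms
proof (induction k arbitrary: s)
  case 0
  hence "g x \<noteq> 0" if "x \<in> U" for x using that by fastforce
  thus ?case using 0 by (auto intro!: continuous_on_powr continuous_on_const)
next
  case (Suc k)
  show ?case
  proof (rule Ck_SucI[where f' = "\<lambda>x u. (s * g x powr (s - 1)) * dr u g x"])
    show "((\<lambda>x. g x powr s) has_derivative (\<lambda>u. (s * g x powr (s - 1)) * dr u g x)) (at x)" if "x \<in> U" for x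
    proof -
      have "((\<lambda>z. z powr s) has_real_derivative s * g x powr (s - 1)) (at (g x))"
        using Suc.prems(3)[OF that] by (rule has_real_derivative_powr)
      from has_derivative_compose[OF Ck_has_derivative[OF Suc.prems(2,1) that] this[unfolded has_field_derivative_def]]
      show ?thesis by simp
    qed
    fix i :: 'a assume i: "i \<in> Basis"
    have "Ck k U g" using Ck_mono[OF Suc.prems(2)] by auto
    thus "Ck k U (\<lambda>x. (s * g x powr (s - 1)) * dr i g x)"
      using Suc i by (intro Ck_mult Ck_const Suc.IH) auto
  qed fact
qed

lemma dr_expand:
  assumes "f differentiable (at x)"
  shows "dr u f x = (\<Sum>i\<in>Basis. (u \<bullet> i) * dr i f x)"
proof -
  have l: "linear (frechet_derivative f (at x))" using assms by (rule linear_frechet_derivative)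
  have "dr u f x = frechet_derivative f (at x) (\<Sum>i\<in>Basis. (u \<bullet> i) *\<^sub>R i)"
    by (simp only: euclidean_representation)
  also have "\<dots> = (\<Sum>i\<in>Basis. (u \<bullet> i) * dr i f x)"
    by (simp add: linear_sum[OF l] linear_scale[OF l])
  finally show ?thesis .
qed

lemma Ck_compose:
  fixes g :: "'a::euclidean_space \<Rightarrow> 'a"
  assumes "open U" "open V" "Ck k V f" "\<And>i. i \<in> Basis \<Longrightarrow> Ck k U (\<lambda>x. g x \<bullet> i)" "\<And>x. x \<in> U \<Longrightarrow> g x \<in> V"
  shows "Ck k U (\<lambda>x. f (g x))"
  using assms
proof (induction k arbitrary: f)
  case 0
  have "continuous_on U g" using 0(4) by (subst continuous_on_componentwise) simp
  thus ?case using 0(3,5) continuous_on_compose2[of V f U g] by auto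
next
  case (Suc k)
  let ?g' = "\<lambda>x u. \<Sum>i\<in>Basis. dr u (\<lambda>x. g x \<bullet> i) x *\<^sub>R i"
  have gd: "(g has_derivative ?g' x) (at x)" if "x \<in> U" for x
  proof -
    have "(\<lambda>x. g x \<bullet> i) differentiable (at x)" if "i \<in> Basis" for i
      using Ck_differentiable[OF Suc.prems(4)[OF that] Suc.prems(1) \<open>x \<in> U\<close>] .
    hence "((\<lambda>x. g x \<bullet> i) has_derivative (\<lambda>u. ?g' x u \<bullet> i)) (at x)" if "i \<in> Basis" for i
      using that by (simp add: inner_sum_left inner_Basis if_distrib cong: if_cong) (simp add: frechet_derivative_works[symmetric])
    thus ?thesis using has_derivative_componentwise_within[of g "?g' x" x UNIV] by simp
  qed
  have fd: "f differentiable (at (g x))" if "x \<in> U" for x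
    using Ck_differentiable[OF Suc.prems(3,2)] Suc.prems(5)[OF that] by blast
  show ?case
  proof (rule Ck_SucI[where f' = "\<lambda>x u. \<Sum>i\<in>Basis. dr u (\<lambda>x. g x \<bullet> i) x * dr i f (g x)"])
    fix x assume x: "x \<in> U"
    have "((\<lambda>x. f (g x)) has_derivative (\<lambda>u. dr (?g' x u) f (g x))) (at x)"
      using has_derivative_compose[OF gd[OF x]] fd[OF x] frechet_derivative_works by blast
    moreover have "dr (?g' x u) f (g x) = (\<Sum>i\<in>Basis. dr u (\<lambda>x. g x \<bullet> i) x * dr i f (g x))" for u
      by (subst dr_expand[OF fd[OF x]]) (simp add: inner_sum_left inner_Basis if_distrib cong: if_cong)
    ultimately show "((\<lambda>x. f (g x)) has_derivative (\<lambda>u. \<Sum>i\<in>Basis. dr u (\<lambda>x. g x \<bullet> i) x * dr i f (g x))) (at x)"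
      by simp
  next
    fix j :: 'a assume j: "j \<in> Basis"
    have "Ck k U (\<lambda>x. dr i f (g x))" if "i \<in> Basis" for i
    proof (rule Suc.IH)
      show "Ck k V (dr i f)" using Suc.prems(3) that by simp
      show "Ck k U (\<lambda>x. g x \<bullet> i)" if "i \<in> Basis" for i by (rule Ck_mono[OF Suc.prems(4)[OF that]]) simp
    qed (use Suc.prems in auto)
    moreover have "Ck k U (dr j (\<lambda>x. g x \<bullet> i))" if "i \<in> Basis" for i using Suc.prems(4)[OF that] j by simp
    ultimately show "Ck k U (\<lambda>x. \<Sum>i\<in>Basis. dr j (\<lambda>x. g x \<bullet> i) x * dr i f (g x))"
      using Suc.prems(1) by (intro Ck_sum Ck_mult) auto
  qed fact
qed

lemma Ck_norm_powr:
  assumes "open U" "0 \<notin> U"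
  shows "Ck k U (\<lambda>x. norm x powr s)"
proof -
  have "Ck k U (\<lambda>x. \<Sum>i\<in>Basis. (x \<bullet> i) * (x \<bullet> i))"
    using assms by (intro Ck_sum Ck_mult Ck_inner)
  hence "Ck k U (\<lambda>x. x \<bullet> x)" by (subst euclidean_inner)
  hence a: "Ck k U (\<lambda>x. (x \<bullet> x) powr (s / 2))"
  proof (rule Ck_powr[OF assms(1)])
    fix x assume "x \<in> U"
    hence "x \<noteq> 0" using assms by auto
    thus "x \<bullet> x > 0" by simp
  qed
  have b: "(x \<bullet> x) powr (s / 2) = norm x powr s" if "x \<in> U" for x
  proof -
    have "norm x > 0" using that assms by auto
    have "x \<bullet> x = norm x powr 2"
      using \<open>norm x > 0\<close> powr_numeral[of "norm x" "num.Bit0 num.One"] by (simp only: power2_norm_eq_inner)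
    hence "(x \<bullet> x) powr (s / 2) = norm x powr (2 * (s / 2))" by (simp only: powr_powr)
    thus ?thesis by simp
  qed
  show ?thesis by (rule Ck_cong[OF assms(1) b a])
qed

lemma Ck_dr:
  assumes "open U" "Ck (Suc k) U f"
  shows "Ck k U (dr u f)"
proof -
  have "Ck k U (\<lambda>x. \<Sum>i\<in>Basis. (u \<bullet> i) * dr i f x)"
    using assms by (intro Ck_sum Ck_mult Ck_const) auto
  thus ?thesis
    by (rule Ck_cong[OF assms(1), rotated]) (use dr_expand[OF Ck_differentiable[OF assms(2,1)]] in simp)
qed

lemma dr_linear:
  assumes "open U" "Ck (Suc k) U f" "x \<in> U"
  shows "linear (\<lambda>u. dr u f x)"
  using linear_frechet_derivative[OF Ck_differentiable[OF assms(2,1,3)]] .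

lemma DERIV_line:
  assumes "open U" "Ck (Suc k) U f" "x + t *\<^sub>R u \<in> U"
  shows "((\<lambda>s. f (x + s *\<^sub>R u)) has_real_derivative dr u f (x + t *\<^sub>R u)) (at t)"
proof -
  have "((\<lambda>s. x + s *\<^sub>R u) has_derivative (\<lambda>h. h *\<^sub>R u)) (at t)"
    by (auto intro!: derivative_eq_intros)
  from has_derivative_compose[OF this Ck_has_derivative[OF assms(2,1,3)]]
  have "((\<lambda>s. f (x + s *\<^sub>R u)) has_derivative (\<lambda>h. dr (h *\<^sub>R u) f (x + t *\<^sub>R u))) (at t)" .
  moreover have "dr (h *\<^sub>R u) f (x + t *\<^sub>R u) = dr u f (x + t *\<^sub>R u) * h" for h
    using linear_scale[OF dr_linear[OF assms]] by simp
  ultimately show ?thesis by (simp add: has_field_derivative_def)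
qed

lemma line_eventually:
  fixes x :: "'a::real_normed_vector"
  assumes "open U" "x \<in> U"
  shows "\<forall>\<^sub>F t in nhds 0. x + t *\<^sub>R u \<in> U"
proof -
  have "open ((\<lambda>t. x + t *\<^sub>R u) -` U)"
    using assms(1) by (intro open_vimage continuous_intros)
  hence "\<forall>\<^sub>F t in nhds 0. t \<in> (\<lambda>t. x + t *\<^sub>R u) -` U"
    by (rule eventually_nhds_in_open) (use assms(2) in simp)
  thus ?thesis by simp
qed

lemma jet2_line:
  assumes U: "open U" "x \<in> U" and f: "Ck 2 U f"
  shows "jet2 (\<lambda>t. f (x + t *\<^sub>R u)) (f x) (dr u f x) (dr u (dr u f) x)"
proof (rule jet2I[where f' = "\<lambda>t. dr u f (x + t *\<^sub>R u)"])
  have f2: "Ck (Suc (Suc 0)) U f" using f by (simp add: numeral_2_eq_2)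
  show "\<forall>\<^sub>F t in nhds 0. ((\<lambda>t. f (x + t *\<^sub>R u)) has_real_derivative dr u f (x + t *\<^sub>R u)) (at t)"
    using line_eventually[OF U] by eventually_elim (rule DERIV_line[OF U(1) f2])
  show "((\<lambda>t. dr u f (x + t *\<^sub>R u)) has_real_derivative dr u (dr u f) x) (at 0)"
    using DERIV_line[OF U(1) Ck_dr[OF U(1) f2], of x 0 u u] U(2) by simp
qed auto

text \<open>Schwarz's theorem. The mixed second difference over a parallelogram with sides
  \<open>h *R u\<close> and \<open>h *R v\<close> is evaluated by the mean value theorem in both
  orders. This gives points near \<open>x\<close> where the two mixed derivatives coincide, and
  continuity lets \<open>h\<close> tend to 0.\<close>

lemma dr_commute:
  assumes U: "open U" "x \<in> U" and f: "Ck 2 U f"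
  shows "dr v (dr u f) x = dr u (dr v f) x"
proof -
  have f2: "Ck (Suc (Suc 0)) U f" using f by (simp add: numeral_2_eq_2)
  have key: "\<exists>p q. 0 \<le> p \<and> p \<le> h \<and> 0 \<le> q \<and> q \<le> h \<and>
      f (x + h *\<^sub>R u + h *\<^sub>R v) - f (x + h *\<^sub>R u) - f (x + h *\<^sub>R v) + f x = h * h * dr v (dr u f) (x + p *\<^sub>R u + q *\<^sub>R v)"
    if h: "h > 0" and sub: "\<And>p q. 0 \<le> p \<Longrightarrow> p \<le> h \<Longrightarrow> 0 \<le> q \<Longrightarrow> q \<le> h \<Longrightarrow> x + p *\<^sub>R u + q *\<^sub>R v \<in> U" for h u v
  proof -
    let ?\<phi> = "\<lambda>s. f (x + h *\<^sub>R v + s *\<^sub>R u) - f (x + s *\<^sub>R u)"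
    have "\<exists>p. 0 < p \<and> p < h \<and> ?\<phi> h - ?\<phi> 0 = (h - 0) * (dr u f (x + h *\<^sub>R v + p *\<^sub>R u) - dr u f (x + p *\<^sub>R u))"
    proof (rule MVT2[OF h])
      fix p assume p: "0 \<le> p" "p \<le> h"
      have "x + p *\<^sub>R u \<in> U" using sub[of p 0] p h by simp
      moreover have "x + h *\<^sub>R v + p *\<^sub>R u \<in> U" using sub[of p h] p h by (simp add: ac_simps)
      ultimately show "(?\<phi> has_real_derivative dr u f (x + h *\<^sub>R v + p *\<^sub>R u) - dr u f (x + p *\<^sub>R u)) (at p)"
        by (intro DERIV_diff DERIV_line[OF U(1) f2])
    qed
    then obtain p where p: "0 < p" "p < h" "?\<phi> h - ?\<phi> 0 = h * (dr u f (x + h *\<^sub>R v + p *\<^sub>R u) - dr u f (x + p *\<^sub>R u))" by auto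
    let ?\<psi> = "\<lambda>s. dr u f (x + p *\<^sub>R u + s *\<^sub>R v)"
    have "\<exists>q. 0 < q \<and> q < h \<and> ?\<psi> h - ?\<psi> 0 = (h - 0) * dr v (dr u f) (x + p *\<^sub>R u + q *\<^sub>R v)"
    proof (rule MVT2[OF h])
      fix q assume "0 \<le> q" "q \<le> h"
      hence "x + p *\<^sub>R u + q *\<^sub>R v \<in> U" using sub[of p q] p by simp
      thus "(?\<psi> has_real_derivative dr v (dr u f) (x + p *\<^sub>R u + q *\<^sub>R v)) (at q)"
        by (rule DERIV_line[OF U(1) Ck_dr[OF U(1) f2]])
    qed
    then obtain q where q: "0 < q" "q < h" "?\<psi> h - ?\<psi> 0 = h * dr v (dr u f) (x + p *\<^sub>R u + q *\<^sub>R v)" by auto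
    have "x + p *\<^sub>R u + h *\<^sub>R v = x + h *\<^sub>R v + p *\<^sub>R u" "x + h *\<^sub>R u + h *\<^sub>R v = x + h *\<^sub>R v + h *\<^sub>R u" by simp_all
    note e = this
    have q3: "dr u f (x + p *\<^sub>R u + h *\<^sub>R v) - dr u f (x + p *\<^sub>R u) = h * dr v (dr u f) (x + p *\<^sub>R u + q *\<^sub>R v)"
      using q(3) by simp
    have "f (x + h *\<^sub>R v + h *\<^sub>R u) - f (x + h *\<^sub>R u) - (f (x + h *\<^sub>R v) - f x) = h * (h * dr v (dr u f) (x + p *\<^sub>R u + q *\<^sub>R v))"
      using p(3) unfolding q3[symmetric] e by simp
    hence "f (x + h *\<^sub>R u + h *\<^sub>R v) - f (x + h *\<^sub>R u) - f (x + h *\<^sub>R v) + f x = h * h * dr v (dr u f) (x + p *\<^sub>R u + q *\<^sub>R v)"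
      unfolding e mult.assoc by linarith
    thus ?thesis using p q by (intro exI[of _ p] exI[of _ q]) simp
  qed
  obtain r where r: "r > 0" "ball x r \<subseteq> U" using U openE by blast
  \<comment> \<open>Parameters below \<open>R\<close> keep \<open>x + p *R u + q *R v\<close> inside
    the ball of radius \<open>r\<close>; the summand 1 prevents a zero denominator.\<close>
  define R where "R = r / (norm u + norm v + 1)"
  have R: "R > 0" unfolding R_def using r by (intro divide_pos_pos) (auto intro: add_nonneg_pos)
  have sub: "x + p *\<^sub>R u + q *\<^sub>R v \<in> U" "norm (p *\<^sub>R u + q *\<^sub>R v) \<le> h * (norm u + norm v)"
    if "0 \<le> p" "p \<le> h" "0 \<le> q" "q \<le> h" "h < R" for p q h
  proof -
    have "norm (p *\<^sub>R u + q *\<^sub>R v) \<le> p * norm u + q * norm v"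
      using norm_triangle_ineq[of "p *\<^sub>R u" "q *\<^sub>R v"] that by simp
    also have "\<dots> \<le> h * norm u + h * norm v" using that by (intro add_mono mult_right_mono) auto
    finally show n: "norm (p *\<^sub>R u + q *\<^sub>R v) \<le> h * (norm u + norm v)" by (simp add: distrib_left)
    also have "\<dots> \<le> R * (norm u + norm v)" using that by (intro mult_right_mono) auto
    also have "\<dots> < R * (norm u + norm v + 1)" using R by simp
    also have "\<dots> = r" unfolding R_def by (simp add: add_nonneg_pos less_imp_neq[symmetric])
    finally have "dist x (x + p *\<^sub>R u + q *\<^sub>R v) < r" by (simp add: dist_norm norm_minus_commute algebra_simps)
    thus "x + p *\<^sub>R u + q *\<^sub>R v \<in> U" using r by auto
  qed
  define h where "h n = R / (real n + 2)" for n
  have h: "h n > 0" "h n < R" for n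
    using R by (auto simp: h_def divide_less_eq)
  have hlim: "h \<longlonglongrightarrow> 0" unfolding h_def by real_asymp
  have "\<exists>a b. (\<exists>p q. 0 \<le> p \<and> p \<le> h n \<and> 0 \<le> q \<and> q \<le> h n \<and> a = x + p *\<^sub>R u + q *\<^sub>R v) \<and>
    (\<exists>p q. 0 \<le> p \<and> p \<le> h n \<and> 0 \<le> q \<and> q \<le> h n \<and> b = x + p *\<^sub>R u + q *\<^sub>R v) \<and>
    dr v (dr u f) a = dr u (dr v f) b" for n
  proof -
    obtain p q where pq: "0 \<le> p" "p \<le> h n" "0 \<le> q" "q \<le> h n"
      "f (x + h n *\<^sub>R u + h n *\<^sub>R v) - f (x + h n *\<^sub>R u) - f (x + h n *\<^sub>R v) + f x = h n * h n * dr v (dr u f) (x + p *\<^sub>R u + q *\<^sub>R v)"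
      using key[OF h(1), of n u v] sub(1)[OF _ _ _ _ h(2)] by blast
    have sub': "x + p *\<^sub>R v + q *\<^sub>R u \<in> U" if "0 \<le> p" "p \<le> h n" "0 \<le> q" "q \<le> h n" for p q
      using sub(1)[of q "h n" p] that h(2)[of n] by (simp add: ac_simps)
    obtain p' q' where pq': "0 \<le> p'" "p' \<le> h n" "0 \<le> q'" "q' \<le> h n"
      "f (x + h n *\<^sub>R v + h n *\<^sub>R u) - f (x + h n *\<^sub>R v) - f (x + h n *\<^sub>R u) + f x = h n * h n * dr u (dr v f) (x + p' *\<^sub>R v + q' *\<^sub>R u)"
      using key[OF h(1), of n v u] sub' by blast
    have e: "x + h n *\<^sub>R v + h n *\<^sub>R u = x + h n *\<^sub>R u + h n *\<^sub>R v" by simp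
    have "h n * h n * dr v (dr u f) (x + p *\<^sub>R u + q *\<^sub>R v) = h n * h n * dr u (dr v f) (x + p' *\<^sub>R v + q' *\<^sub>R u)"
      using pq(5) pq'(5) unfolding e by linarith
    hence "dr v (dr u f) (x + p *\<^sub>R u + q *\<^sub>R v) = dr u (dr v f) (x + q' *\<^sub>R u + p' *\<^sub>R v)"
    proof -
      have "x + p' *\<^sub>R v + q' *\<^sub>R u = x + q' *\<^sub>R u + p' *\<^sub>R v" by simp
      moreover have "h n * h n \<noteq> 0" using h(1)[of n] by simp
      ultimately show ?thesis
        using \<open>h n * h n * dr v (dr u f) (x + p *\<^sub>R u + q *\<^sub>R v) = h n * h n * dr u (dr v f) (x + p' *\<^sub>R v + q' *\<^sub>R u)\<close>
        by (metis mult_left_cancel)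
    qed
    thus ?thesis using pq(1-4) pq'(1-4) by blast
  qed
  then obtain a b where ab: "\<And>n. \<exists>p q. 0 \<le> p \<and> p \<le> h n \<and> 0 \<le> q \<and> q \<le> h n \<and> a n = x + p *\<^sub>R u + q *\<^sub>R v"
    "\<And>n. \<exists>p q. 0 \<le> p \<and> p \<le> h n \<and> 0 \<le> q \<and> q \<le> h n \<and> b n = x + p *\<^sub>R u + q *\<^sub>R v"
    "\<And>n. dr v (dr u f) (a n) = dr u (dr v f) (b n)" by metis
  have lim: "c \<longlonglongrightarrow> x" if c: "\<And>n. \<exists>p q. 0 \<le> p \<and> p \<le> h n \<and> 0 \<le> q \<and> q \<le> h n \<and> c n = x + p *\<^sub>R u + q *\<^sub>R v" for c
  proof -
    have "norm (c n - x) \<le> h n * (norm u + norm v)" for n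
    proof -
      obtain p q where "0 \<le> p" "p \<le> h n" "0 \<le> q" "q \<le> h n" "c n = x + p *\<^sub>R u + q *\<^sub>R v" using c by blast
      thus ?thesis using sub(2)[of p "h n" q] h(2)[of n] by simp
    qed
    hence "\<forall>\<^sub>F n in sequentially. norm (c n - x) \<le> h n * (norm u + norm v)"
      by (rule always_eventually[OF allI])
    moreover have "(\<lambda>n. h n * (norm u + norm v)) \<longlonglongrightarrow> 0" using tendsto_mult_left_zero[OF hlim] .
    ultimately have "(\<lambda>n. c n - x) \<longlonglongrightarrow> 0" by (rule Lim_null_comparison)
    thus ?thesis by (simp add: LIM_zero_iff)
  qed
  have cont: "isCont (dr v (dr u f)) x" for u v
    using Ck_continuous[OF Ck_dr[OF U(1) Ck_dr[OF U(1) f2]]] U continuous_on_eq_continuous_at by blast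
  have "(\<lambda>n. dr v (dr u f) (a n)) \<longlonglongrightarrow> dr v (dr u f) x"
    using isCont_tendsto_compose[OF cont lim[OF ab(1)]] .
  moreover have "(\<lambda>n. dr u (dr v f) (b n)) \<longlonglongrightarrow> dr u (dr v f) x"
    using isCont_tendsto_compose[OF cont lim[OF ab(2)]] .
  ultimately show ?thesis unfolding ab(3) by (rule LIMSEQ_unique)
qed

section \<open>Homogeneous extension\<close>

definition proj :: "real \<Rightarrow> 'a::euclidean_space \<Rightarrow> 'a \<Rightarrow> 'a" where
  "proj c b y = y /\<^sub>R norm y - c *\<^sub>R b"

text \<open>The sphere of the cap has centre \<open>- c *R b\<close>, so \<open>proj\<close> shifts
  it from the origin. The factor \<open>norm y\<close> gives degree one, for which the Euclidean
  Hessian has the radial direction in its kernel and equals \<open>W\<close> on tangent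
  vectors.\<close>

definition hext :: "real \<Rightarrow> 'a::euclidean_space \<Rightarrow> ('a \<Rightarrow> real) \<Rightarrow> 'a \<Rightarrow> real" where
  "hext c b f y = norm y * f (proj c b y)"

definition cdom :: "real \<Rightarrow> 'a::euclidean_space \<Rightarrow> 'a set \<Rightarrow> 'a set" where
  "cdom c b U = {y. y \<noteq> 0 \<and> proj c b y \<in> U}"

lemma proj_unit: "norm y = 1 \<Longrightarrow> proj c b y = y - c *\<^sub>R b"
  by (simp add: proj_def)

lemma proj_scale: "s > 0 \<Longrightarrow> proj c b (s *\<^sub>R y) = proj c b y"
  by (simp add: proj_def)

lemma hext_scale: "s > 0 \<Longrightarrow> hext c b f (s *\<^sub>R y) = s * hext c b f y"
  by (simp add: hext_def proj_scale)

lemma cdom_scale: "s > 0 \<Longrightarrow> y \<in> cdom c b U \<Longrightarrow> s *\<^sub>R y \<in> cdom c b U"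
  by (simp add: cdom_def proj_scale)

lemma open_cdom:
  assumes "open U"
  shows "open (cdom c b U)"
proof -
  have "continuous_on (-{0}) (proj c b)"
    unfolding proj_def by (intro continuous_intros) auto
  hence "open {y \<in> -{0}. proj c b y \<in> U}"
    using assms continuous_open_preimage[of "-{0}" "proj c b" U] open_delete[OF open_UNIV, of "0::'a"]
    by (simp add: vimage_def Int_def Compl_eq_Diff_UNIV[symmetric])
  moreover have "{y \<in> -{0}. proj c b y \<in> U} = cdom c b U" by (auto simp: cdom_def)
  ultimately show ?thesis by simp
qed

lemma Ck_hext:
  assumes U: "open U" and f: "Ck k U f"
  shows "Ck k (cdom c b U) (hext c b f)"
proof -
  let ?W = "cdom c b U"
  have W: "open ?W" by (rule open_cdom[OF U])
  have W0: "0 \<notin> ?W" by (simp add: cdom_def)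
  have n1: "Ck k ?W (\<lambda>y. norm y)"
  proof (rule Ck_cong[OF W _ Ck_norm_powr[OF W W0, of k 1]])
    fix y assume "y \<in> ?W"
    thus "norm y powr 1 = norm y" by simp
  qed
  have g: "Ck k ?W (\<lambda>y. proj c b y \<bullet> i)" if "i \<in> Basis" for i
  proof -
    have "Ck k ?W (\<lambda>y. (y \<bullet> i) * norm y powr (-1) + - (c * (b \<bullet> i)))"
      by (intro Ck_add Ck_mult Ck_inner Ck_const W Ck_norm_powr W0)
    thus ?thesis
    proof (rule Ck_cong[OF W, rotated])
      fix y assume "y \<in> ?W"
      hence "norm y > 0" using W0 by auto
      thus "(y \<bullet> i) * norm y powr (-1) + - (c * (b \<bullet> i)) = proj c b y \<bullet> i"
        by (simp add: proj_def inner_diff_left powr_minus mult.commute)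
    qed
  qed
  have "Ck k ?W (\<lambda>y. f (proj c b y))"
    by (rule Ck_compose[OF W U f g]) (auto simp: cdom_def)
  from Ck_mult[OF W n1 this] show ?thesis by (simp add: hext_def[abs_def])
qed

lemma proj_has_derivative:
  assumes "y \<noteq> 0"
  shows "(proj c b has_derivative (\<lambda>h. h /\<^sub>R norm y - ((y \<bullet> h) / norm y ^ 3) *\<^sub>R y)) (at y)"
proof -
  have n: "(norm has_derivative (\<lambda>h. h \<bullet> sgn y)) (at y)"
    using has_derivative_norm[OF assms] by simp
  have "((\<lambda>y. inverse (norm y)) has_derivative (\<lambda>h. - (inverse (norm y) * (h \<bullet> sgn y) * inverse (norm y)))) (at y)"
    by (rule Deriv.has_derivative_inverse[OF _ n]) (use assms in simp)
  from has_derivative_scaleR[OF this has_derivative_ident]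
  have 1: "((\<lambda>x. inverse (norm x) *\<^sub>R x) has_derivative
     (\<lambda>h. inverse (norm y) *\<^sub>R h + (- (inverse (norm y) * (h \<bullet> sgn y) * inverse (norm y))) *\<^sub>R y)) (at y)" .
  have 2: "(- (inverse (norm y) * (h \<bullet> sgn y) * inverse (norm y))) = - ((y \<bullet> h) / norm y ^ 3)" for h
    by (simp add: sgn_div_norm power3_eq_cube divide_inverse inner_commute)
  from has_derivative_diff[OF 1 has_derivative_const[of "c *\<^sub>R b"]]
  show ?thesis unfolding 2 proj_def[abs_def] by simp
qed

lemma dr_hext:
  assumes U: "open U" "Ck (Suc k) U f" and y: "y \<in> cdom c b U"
  shows "dr u (hext c b f) y = (y \<bullet> u) / norm y * f (proj c b y) + dr u f (proj c b y)
    - (y \<bullet> u) / (norm y)\<^sup>2 * dr y f (proj c b y)"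
proof -
  have y0: "y \<noteq> 0" and yU: "proj c b y \<in> U" using y by (auto simp: cdom_def)
  let ?g' = "\<lambda>h. h /\<^sub>R norm y - ((y \<bullet> h) / norm y ^ 3) *\<^sub>R y"
  have n: "(norm has_derivative (\<lambda>h. h \<bullet> sgn y)) (at y)"
    using has_derivative_norm[OF y0] by simp
  have l: "linear (\<lambda>u. dr u f (proj c b y))" by (rule dr_linear[OF U yU])
  have "((\<lambda>y. f (proj c b y)) has_derivative (\<lambda>h. dr (?g' h) f (proj c b y))) (at y)"
    by (rule has_derivative_compose[OF proj_has_derivative[OF y0] Ck_has_derivative[OF U(2,1) yU]])
  from has_derivative_mult[OF n this]
  have "(hext c b f has_derivative (\<lambda>h. norm y * dr (?g' h) f (proj c b y) + (h \<bullet> sgn y) * f (proj c b y))) (at y)"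
    by (simp add: hext_def[abs_def])
  from fun_cong[OF frechet_derivative_at[OF this], of u, symmetric]
  have "dr u (hext c b f) y = norm y * dr (?g' u) f (proj c b y) + (u \<bullet> sgn y) * f (proj c b y)" .
  also have "dr (?g' u) f (proj c b y) = inverse (norm y) * dr u f (proj c b y) - ((y \<bullet> u) / norm y ^ 3) * dr y f (proj c b y)"
    using linear_diff[OF l, of "u /\<^sub>R norm y" "((y \<bullet> u) / norm y ^ 3) *\<^sub>R y"] linear_scale[OF l] by simp
  also have "norm y * (inverse (norm y) * dr u f (proj c b y) - ((y \<bullet> u) / norm y ^ 3) * dr y f (proj c b y))
    = dr u f (proj c b y) - (y \<bullet> u) / (norm y)\<^sup>2 * dr y f (proj c b y)"
    using y0 by (simp add: right_diff_distrib power3_eq_cube power2_eq_square)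
  also have "u \<bullet> sgn y = (y \<bullet> u) / norm y" by (simp add: sgn_div_norm inner_commute divide_inverse mult.commute)
  finally show ?thesis by simp
qed

text \<open>The derivative at 0 sees only the value \<open>S 0\<close>, so the factors that occur in
  \<open>D2_hext\<close> never have to be differentiated.\<close>

lemma DERIV_t_mult:
  fixes S :: "real \<Rightarrow> real"
  assumes "isCont S 0"
  shows "((\<lambda>t. t * S t) has_real_derivative S 0) (at 0)"
  using assms unfolding DERIV_def isCont_def
  by (rule Lim_transform_eventually) (auto simp: eventually_at_filter)

text \<open>Along \<open>y + t *R v\<close> the inner product with \<open>u\<close> is
  \<open>t * (u \<bullet> v)\<close>. The two terms of \<open>dr_hext\<close> that carry this inner
  product therefore contribute just their values at \<open>t = 0\<close>: the term
  \<open>f * (u \<bullet> v)\<close> and the second fundamental form correction.\<close>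

lemma D2_hext:
  assumes U: "open U" "Ck 2 U f" and y: "norm y = 1" "y - c *\<^sub>R b \<in> U" and uv: "y \<bullet> u = 0" "y \<bullet> v = 0"
  shows "dr v (dr u (hext c b f)) y = dr v (dr u f) (y - c *\<^sub>R b)
    - (u \<bullet> v) * dr y f (y - c *\<^sub>R b) + f (y - c *\<^sub>R b) * (u \<bullet> v)"
proof -
  let ?W = "cdom c b U"
  let ?\<xi> = "y - c *\<^sub>R b"
  have f2: "Ck (Suc (Suc 0)) U f" using U(2) by (simp add: numeral_2_eq_2)
  have f1: "Ck (Suc 0) U (dr u f)" by (rule Ck_dr[OF U(1) f2])
  have W: "open ?W" by (rule open_cdom[OF U(1)])
  have yW: "y \<in> ?W" using y by (auto simp: cdom_def proj_unit)
  have y0: "y \<noteq> 0" using y by auto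
  define q where "q t = y + t *\<^sub>R v" for t
  have q0: "q 0 = y" by (simp add: q_def)
  have qd: "(q has_derivative (\<lambda>h. h *\<^sub>R v)) (at 0)"
    unfolding q_def[abs_def] by (auto intro!: derivative_eq_intros)
  have gq: "((\<lambda>t. proj c b (q t)) has_derivative (\<lambda>h. h *\<^sub>R v)) (at 0)"
  proof -
    have "(proj c b has_derivative (\<lambda>h. h /\<^sub>R norm y - ((y \<bullet> h) / norm y ^ 3) *\<^sub>R y)) (at (q 0))"
      unfolding q0 by (rule proj_has_derivative[OF y0])
    from has_derivative_compose[OF qd this] show ?thesis by (simp add: y(1) uv(2))
  qed
  have cq: "isCont q 0" by (rule has_derivative_continuous[OF qd])
  have cg: "isCont (\<lambda>t. proj c b (q t)) 0" by (rule has_derivative_continuous[OF gq])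
  have pq0: "proj c b (q 0) = ?\<xi>" by (simp add: q0 proj_unit y)
  have contU: "isCont (\<lambda>t. \<phi> (proj c b (q t))) 0" if "Ck j U \<phi>" for \<phi> j
  proof -
    have "isCont \<phi> ?\<xi>"
      using Ck_continuous[OF that] U(1) y(2) continuous_on_eq_continuous_at by blast
    thus ?thesis using isCont_o2[OF cg, of \<phi>] by (simp only: pq0)
  qed
  have nq: "isCont (\<lambda>t. norm (q t)) 0" using cq by (intro continuous_intros)
  let ?A = "\<lambda>t. (u \<bullet> v) / norm (q t) * f (proj c b (q t))"
  let ?C = "\<lambda>t. (u \<bullet> v) / (norm (q t))\<^sup>2 * (dr y f (proj c b (q t)) + t * dr v f (proj c b (q t)))"
  have 1: "((\<lambda>t. t * ?A t) has_real_derivative ?A 0) (at 0)"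
    by (rule DERIV_t_mult) (intro continuous_intros nq contU[OF U(2)], simp add: q0 y0)
  have 2: "((\<lambda>t. t * ?C t) has_real_derivative ?C 0) (at 0)"
    by (rule DERIV_t_mult) (intro continuous_intros nq contU[OF Ck_dr[OF U(1) f2]], simp add: q0 y0)
  have 3: "((\<lambda>t. dr u f (proj c b (q t))) has_real_derivative dr v (dr u f) ?\<xi>) (at 0)"
  proof -
    have "((\<lambda>t. dr u f (proj c b (q t))) has_derivative (\<lambda>h. dr (h *\<^sub>R v) (dr u f) ?\<xi>)) (at 0)"
      using has_derivative_compose[OF gq, of "dr u f"] Ck_has_derivative[OF f1 U(1) y(2)] by (simp only: pq0)
    moreover have "dr (h *\<^sub>R v) (dr u f) ?\<xi> = dr v (dr u f) ?\<xi> * h" for h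
      using linear_scale[OF dr_linear[OF U(1) f1 y(2)], of h v] by simp
    ultimately show ?thesis by (simp add: has_field_derivative_def)
  qed
  have D: "((\<lambda>t. t * ?A t + dr u f (proj c b (q t)) - t * ?C t) has_real_derivative ?A 0 + dr v (dr u f) ?\<xi> - ?C 0) (at 0)"
    by (rule DERIV_diff[OF DERIV_add[OF 1 3] 2])
  have "\<forall>\<^sub>F t in nhds 0. q t \<in> ?W" unfolding q_def by (rule line_eventually[OF W yW])
  hence ev: "\<forall>\<^sub>F t in nhds 0. dr u (hext c b f) (q t) = t * ?A t + dr u f (proj c b (q t)) - t * ?C t"
  proof eventually_elim
    case (elim t)
    have pU: "proj c b (q t) \<in> U" using elim by (simp add: cdom_def)
    have l: "linear (\<lambda>u. dr u f (proj c b (q t)))" by (rule dr_linear[OF U(1) f2 pU])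
    have "dr (q t) f (proj c b (q t)) = dr y f (proj c b (q t)) + t * dr v f (proj c b (q t))"
      unfolding q_def[of t] using linear_add[OF l] linear_scale[OF l] by (simp add: q_def)
    moreover have "q t \<bullet> u = t * (u \<bullet> v)"
      using uv(1) inner_commute[of v u] by (simp add: q_def inner_add_left)
    ultimately show ?case using dr_hext[OF U(1) f2 elim, of u] by (simp add: algebra_simps)
  qed
  have "((\<lambda>t. dr u (hext c b f) (y + t *\<^sub>R v)) has_real_derivative dr v (dr u (hext c b f)) (y + 0 *\<^sub>R v)) (at 0)"
    by (rule DERIV_line[OF W Ck_dr[OF W Ck_hext[OF U(1) f2]]]) (use yW in simp)
  hence "((\<lambda>t. dr u (hext c b f) (q t)) has_real_derivative dr v (dr u (hext c b f)) y) (at 0)" by (simp add: q_def)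
  moreover have "((\<lambda>t. dr u (hext c b f) (q t)) has_real_derivative ?A 0 + dr v (dr u f) ?\<xi> - ?C 0) (at 0)"
    using D DERIV_cong_ev[OF refl ev refl] by blast
  ultimately have "dr v (dr u (hext c b f)) y = ?A 0 + dr v (dr u f) ?\<xi> - ?C 0" by (rule DERIV_unique)
  thus ?thesis by (simp add: q0 y proj_unit mult.commute)
qed

section \<open>Homogeneous functions\<close>

text \<open>The weight \<open>N\<close> makes the bound iterable: the norms of arguments treated
  earlier become the weight for the next one, which gives bounds for bilinear and trilinear
  forms.\<close>

lemma linear_family_bound:
  fixes F :: "'b \<Rightarrow> 'a::euclidean_space \<Rightarrow> real"
  assumes "\<And>y. y \<in> K \<Longrightarrow> linear (F y)" "\<And>i. i \<in> Basis \<Longrightarrow> \<exists>C\<ge>0. \<forall>y\<in>K. \<bar>F y i\<bar> \<le> C * N y"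
    and N: "\<And>y. y \<in> K \<Longrightarrow> N y \<ge> 0"
  shows "\<exists>C\<ge>0. \<forall>y\<in>K. \<forall>u. \<bar>F y u\<bar> \<le> C * N y * norm u"
proof -
  obtain C where C: "\<And>i. i \<in> Basis \<Longrightarrow> C i \<ge> 0" "\<And>i y. i \<in> Basis \<Longrightarrow> y \<in> K \<Longrightarrow> \<bar>F y i\<bar> \<le> C i * N y"
    using assms(2) by metis
  show ?thesis
  proof (intro exI[of _ "\<Sum>i\<in>Basis. C i"] conjI ballI allI)
    show "0 \<le> (\<Sum>i\<in>Basis. C i)" using C(1) by (rule sum_nonneg)
    fix y u assume y: "y \<in> K"
    have l: "linear (F y)" using assms(1) y .
    have "F y u = F y (\<Sum>i\<in>Basis. (u \<bullet> i) *\<^sub>R i)" by (simp only: euclidean_representation)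
    also have "\<dots> = (\<Sum>i\<in>Basis. (u \<bullet> i) * F y i)" by (simp add: linear_sum[OF l] linear_scale[OF l])
    finally have "\<bar>F y u\<bar> \<le> (\<Sum>i\<in>Basis. \<bar>(u \<bullet> i) * F y i\<bar>)" by (simp only: sum_abs)
    also have "\<dots> \<le> (\<Sum>i\<in>Basis. norm u * (C i * N y))"
    proof (rule sum_mono)
      fix i :: 'a assume i: "i \<in> Basis"
      show "\<bar>(u \<bullet> i) * F y i\<bar> \<le> norm u * (C i * N y)"
        unfolding abs_mult by (intro mult_mono Basis_le_norm[OF i] C(2)[OF i y]) auto
    qed
    also have "\<dots> = (\<Sum>i\<in>Basis. C i) * N y * norm u" by (simp add: sum_distrib_right sum_distrib_left ac_simps)
    finally show "\<bar>F y u\<bar> \<le> (\<Sum>i\<in>Basis. C i) * N y * norm u" .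
  qed
qed

lemma DERIV_curve:
  assumes U: "open U" "Ck (Suc j) U f" and q: "(q has_vector_derivative w) (at 0)" "q 0 \<in> U"
  shows "((\<lambda>t. f (q t)) has_real_derivative dr w f (q 0)) (at 0)"
proof -
  have "((\<lambda>t. f (q t)) has_derivative (\<lambda>h. dr (h *\<^sub>R w) f (q 0))) (at 0)"
    using has_derivative_compose[OF q(1)[unfolded has_vector_derivative_def] Ck_has_derivative[OF U(2,1) q(2)]] .
  moreover have "dr (h *\<^sub>R w) f (q 0) = dr w f (q 0) * h" for h
    using linear_scale[OF dr_linear[OF U q(2)], of h w] by simp
  ultimately show ?thesis by (simp add: has_field_derivative_def)
qed

locale homog4 =
  fixes \<Omega> :: "'a::euclidean_space set" and H :: "'a \<Rightarrow> real"
  assumes op: "open \<Omega>" and scale: "\<And>s y. s > 0 \<Longrightarrow> y \<in> \<Omega> \<Longrightarrow> s *\<^sub>R y \<in> \<Omega>"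
    and CkH: "Ck 4 \<Omega> H" and hom: "\<And>s y. s > 0 \<Longrightarrow> y \<in> \<Omega> \<Longrightarrow> H (s *\<^sub>R y) = s * H y"
begin

definition M :: "'a \<Rightarrow> 'a \<Rightarrow> 'a \<Rightarrow> real" where "M y u v = dr v (dr u H) y"
definition T :: "'a \<Rightarrow> 'a \<Rightarrow> 'a \<Rightarrow> 'a \<Rightarrow> real" where "T y u v w = dr w (dr v (dr u H)) y"
definition Q :: "'a \<Rightarrow> 'a \<Rightarrow> 'a \<Rightarrow> 'a \<Rightarrow> 'a \<Rightarrow> real" where "Q y u v w z = dr z (dr w (dr v (dr u H))) y"

lemma CkH0: "j \<le> 4 \<Longrightarrow> Ck j \<Omega> H"
  using Ck_mono[OF CkH] .

lemma CkH1: "j \<le> 3 \<Longrightarrow> Ck j \<Omega> (dr u H)"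
  by (rule Ck_dr[OF op CkH0]) simp

lemma CkH2: "j \<le> 2 \<Longrightarrow> Ck j \<Omega> (dr v (dr u H))"
  by (rule Ck_dr[OF op CkH1]) simp

lemma CkH3: "j \<le> 1 \<Longrightarrow> Ck j \<Omega> (dr w (dr v (dr u H)))"
  by (rule Ck_dr[OF op CkH2]) simp

lemma M_sym: "y \<in> \<Omega> \<Longrightarrow> M y u v = M y v u"
  unfolding M_def by (rule dr_commute[OF op _ CkH0]) simp_all

lemma dr_cong: "y \<in> \<Omega> \<Longrightarrow> (\<And>x. x \<in> \<Omega> \<Longrightarrow> f x = g x) \<Longrightarrow> dr u f y = dr u g y"
  using frechet_derivative_cong_open[OF op] by metis

lemma T_perm12: "y \<in> \<Omega> \<Longrightarrow> T y u v w = T y v u w"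
  unfolding T_def by (rule dr_cong) (use M_sym in \<open>simp_all add: M_def\<close>)

lemma T_perm23: "y \<in> \<Omega> \<Longrightarrow> T y u v w = T y u w v"
  unfolding T_def by (rule dr_commute[OF op _ CkH1]) simp_all

lemma T_perm13: "y \<in> \<Omega> \<Longrightarrow> T y u v w = T y w v u"
  using T_perm12 T_perm23 by metis

lemma Q_perm12: "y \<in> \<Omega> \<Longrightarrow> Q y u v w z = Q y v u w z"
  unfolding Q_def by (rule dr_cong) (use T_perm12 in \<open>simp_all add: T_def\<close>)

lemma Q_perm23: "y \<in> \<Omega> \<Longrightarrow> Q y u v w z = Q y u w v z"
  unfolding Q_def by (rule dr_cong) (use T_perm23 in \<open>simp_all add: T_def\<close>)

lemma Q_perm34: "y \<in> \<Omega> \<Longrightarrow> Q y u v w z = Q y u v z w"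
  unfolding Q_def by (rule dr_commute[OF op _ CkH2]) simp_all

lemma Q_pairs: "y \<in> \<Omega> \<Longrightarrow> Q y u u v v = Q y v v u u"
  by (metis Q_perm12 Q_perm23 Q_perm34)

lemma M_linear: "y \<in> \<Omega> \<Longrightarrow> linear (M y u)"
  using dr_linear[OF op CkH1[of "Suc 0"], of y u] by (simp add: M_def[abs_def])

lemma M_bilinear: "y \<in> \<Omega> \<Longrightarrow> bilinear (M y)"
proof -
  assume y: "y \<in> \<Omega>"
  have "(\<lambda>x. M y x v) = M y v" for v using M_sym[OF y] by auto
  thus ?thesis unfolding bilinear_def using M_linear[OF y] by simp
qed

lemma T_linear: "y \<in> \<Omega> \<Longrightarrow> linear (T y u v)"
  using dr_linear[OF op CkH2[of "Suc 0" u v], of y] by (simp add: T_def[abs_def])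

lemma jet_H: "y \<in> \<Omega> \<Longrightarrow> jet2 (\<lambda>t. H (y + t *\<^sub>R a)) (H y) (dr a H y) (M y a a)"
  using jet2_line[OF op _ CkH0, of y a] by (simp add: M_def)

lemma jet_M: "y \<in> \<Omega> \<Longrightarrow> jet2 (\<lambda>t. M (y + t *\<^sub>R a) u v) (M y u v) (T y u v a) (Q y u v a a)"
  using jet2_line[OF op _ CkH2[of 2 u v], of y a] by (simp add: M_def T_def Q_def)

lemma euler: "y \<in> \<Omega> \<Longrightarrow> dr y H y = H y"
proof -
  assume y: "y \<in> \<Omega>"
  have 1: "((\<lambda>t. H (y + t *\<^sub>R y)) has_real_derivative dr y H y) (at 0)"
    using jet2_DERIV[OF jet_H[OF y]] .
  have 2: "((\<lambda>t. (1 + t) * H y) has_real_derivative H y) (at 0)"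
    by (auto intro!: derivative_eq_intros)
  have "((\<lambda>t. H (y + t *\<^sub>R y)) has_real_derivative H y) (at 0)"
  proof (rule has_field_derivative_transform_within[OF 2, of 1])
    fix t :: real assume "dist t 0 < 1"
    hence "1 + t > 0" by (simp add: dist_real_def)
    from hom[OF this y] show "(1 + t) * H y = H (y + t *\<^sub>R y)" by (simp add: scaleR_add_left)
  qed auto
  thus ?thesis using 1 DERIV_unique by blast
qed

text \<open>Differentiating Euler's identity \<open>dr y H y = H y\<close> in the direction
  \<open>v\<close> produces an extra \<open>dr v H\<close> from the direction slot, and this equals
  the derivative of the right side.\<close>

lemma M_radial: "y \<in> \<Omega> \<Longrightarrow> M y y v = 0"
proof -
  assume y: "y \<in> \<Omega>"
  have "isCont (\<lambda>t. dr v H (y + t *\<^sub>R v)) 0"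
  proof (rule DERIV_isCont)
    show "((\<lambda>t. dr v H (y + t *\<^sub>R v)) has_real_derivative dr v (dr v H) (y + 0 *\<^sub>R v)) (at 0)"
      by (rule DERIV_line[OF op CkH1[of "Suc 0"]]) (use y in simp_all)
  qed
  hence 1: "((\<lambda>t. t * dr v H (y + t *\<^sub>R v)) has_real_derivative dr v H (y + 0 *\<^sub>R v)) (at 0)"
    unfolding DERIV_def isCont_def by (rule Lim_transform_eventually) (auto simp: eventually_at_filter)
  have 2: "((\<lambda>t. dr y H (y + t *\<^sub>R v)) has_real_derivative dr v (dr y H) (y + 0 *\<^sub>R v)) (at 0)"
    by (rule DERIV_line[OF op CkH1[of "Suc 0"]]) (use y in simp_all)
  have 3: "((\<lambda>t. H (y + t *\<^sub>R v)) has_real_derivative dr v H (y + 0 *\<^sub>R v)) (at 0)"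
    by (rule DERIV_line[OF op CkH0[of "Suc 0"]]) (use y in simp_all)
  have ev: "\<forall>\<^sub>F t in nhds 0. H (y + t *\<^sub>R v) = dr y H (y + t *\<^sub>R v) + t * dr v H (y + t *\<^sub>R v)"
    using line_eventually[OF op y, of v]
  proof eventually_elim
    case (elim t)
    have l: "linear (\<lambda>u. dr u H (y + t *\<^sub>R v))" by (rule dr_linear[OF op CkH0[of "Suc 0"] elim]) simp
    show ?case using euler[OF elim] linear_add[OF l, of y "t *\<^sub>R v"] linear_scale[OF l, of t v] by simp
  qed
  have "((\<lambda>t. H (y + t *\<^sub>R v)) has_real_derivative dr v (dr y H) (y + 0 *\<^sub>R v) + dr v H (y + 0 *\<^sub>R v)) (at 0)"
    using DERIV_cong_ev[OF refl ev refl] DERIV_add[OF 2 1] by blast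
  from DERIV_unique[OF 3 this] show ?thesis by (simp add: M_def)
qed

text \<open>The identity \<open>M x x v = 0\<close> holds along \<open>x = y + t *R a\<close>.
  Expanding the moving slot and comparing the resulting jet with that of zero gives both formulas at
  once.\<close>

lemma T_radial: "y \<in> \<Omega> \<Longrightarrow> T y y v a = - M y a v"
  and Q_radial: "y \<in> \<Omega> \<Longrightarrow> Q y y v a a = - 2 * T y a v a"
proof -
  assume y: "y \<in> \<Omega>"
  have J: "jet2 (\<lambda>t. M (y + t *\<^sub>R a) y v + t * M (y + t *\<^sub>R a) a v)
     (M y y v + 0 * M y a v) (T y y v a + (1 * M y a v + 0 * T y a v a))
     (Q y y v a a + (0 * M y a v + 2 * (1 * T y a v a) + 0 * Q y a v a a))"
    by (intro jet2_add jet2_mult jet2_id jet_M y)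
  have ev: "\<forall>\<^sub>F t in nhds 0. M (y + t *\<^sub>R a) y v + t * M (y + t *\<^sub>R a) a v = 0"
    using line_eventually[OF op y, of a]
  proof eventually_elim
    case (elim t)
    have "M (y + t *\<^sub>R a) (y + t *\<^sub>R a) v = 0" by (rule M_radial[OF elim])
    thus ?case using M_bilinear[OF elim] by (simp add: bilinear_ladd bilinear_lmul)
  qed
  from jet2_unique[OF J jet2_const[of 0] ev]
  show "T y y v a = - M y a v" "Q y y v a a = - 2 * T y a v a" by simp_all
qed

lemma M_scale: "s > 0 \<Longrightarrow> y \<in> \<Omega> \<Longrightarrow> M (s *\<^sub>R y) u v = M y u v / s"
proof -
  assume s: "s > 0" and y: "y \<in> \<Omega>"
  have sy: "s *\<^sub>R x \<in> \<Omega>" if "x \<in> \<Omega>" for x using scale[OF s that] .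
  have D1: "dr u H (s *\<^sub>R x) = dr u H x" if x: "x \<in> \<Omega>" for x u
  proof -
    have v: "((\<lambda>t. s *\<^sub>R (x + t *\<^sub>R u)) has_vector_derivative s *\<^sub>R u) (at 0)"
      by (auto intro!: derivative_eq_intros)
    have "((\<lambda>t. H (s *\<^sub>R (x + t *\<^sub>R u))) has_real_derivative dr (s *\<^sub>R u) H (s *\<^sub>R (x + 0 *\<^sub>R u))) (at 0)"
      by (rule DERIV_curve[OF op CkH0[of "Suc 0"] v]) (use sy[OF x] in simp_all)
    moreover have "\<forall>\<^sub>F t in nhds 0. H (s *\<^sub>R (x + t *\<^sub>R u)) = s * H (x + t *\<^sub>R u)"
      using line_eventually[OF op x, of u] by eventually_elim (rule hom[OF s])
    ultimately have 1: "((\<lambda>t. s * H (x + t *\<^sub>R u)) has_real_derivative dr (s *\<^sub>R u) H (s *\<^sub>R x)) (at 0)"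
      using DERIV_cong_ev[OF refl _ refl] by fastforce
    have 2: "((\<lambda>t. s * H (x + t *\<^sub>R u)) has_real_derivative s * dr u H x) (at 0)"
      using DERIV_cmult[OF jet2_DERIV[OF jet_H[OF x]]] .
    have l: "linear (\<lambda>u. dr u H (s *\<^sub>R x))" by (rule dr_linear[OF op CkH0[of "Suc 0"] sy[OF x]]) simp
    have "s * dr u H (s *\<^sub>R x) = s * dr u H x"
      using DERIV_unique[OF 1 2] linear_scale[OF l, of s u] by simp
    thus ?thesis using s by simp
  qed
  have v: "((\<lambda>t. s *\<^sub>R (y + t *\<^sub>R v)) has_vector_derivative s *\<^sub>R v) (at 0)"
    by (auto intro!: derivative_eq_intros)
  have "((\<lambda>t. dr u H (s *\<^sub>R (y + t *\<^sub>R v))) has_real_derivative dr (s *\<^sub>R v) (dr u H) (s *\<^sub>R (y + 0 *\<^sub>R v))) (at 0)"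
    by (rule DERIV_curve[OF op CkH1[of "Suc 0"] v]) (use sy[OF y] in simp_all)
  moreover have "\<forall>\<^sub>F t in nhds 0. dr u H (s *\<^sub>R (y + t *\<^sub>R v)) = dr u H (y + t *\<^sub>R v)"
    using line_eventually[OF op y, of v] by eventually_elim (rule D1)
  ultimately have 1: "((\<lambda>t. dr u H (y + t *\<^sub>R v)) has_real_derivative dr (s *\<^sub>R v) (dr u H) (s *\<^sub>R y)) (at 0)"
    using DERIV_cong_ev[OF refl _ refl] by fastforce
  have 2: "((\<lambda>t. dr u H (y + t *\<^sub>R v)) has_real_derivative dr v (dr u H) (y + 0 *\<^sub>R v)) (at 0)"
    by (rule DERIV_line[OF op CkH1[of "Suc 0"]]) (use y in simp_all)
  have "s * M (s *\<^sub>R y) u v = M y u v"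
    using DERIV_unique[OF 1 2] linear_scale[OF M_linear[OF sy[OF y], of u], of s v] by (simp add: M_def)
  thus ?thesis using s by (simp add: field_simps)
qed

lemma M_cont: "continuous_on \<Omega> (\<lambda>y. M y u v)"
  unfolding M_def using Ck_continuous[OF CkH2[of 0]] by simp

lemma T_cont: "continuous_on \<Omega> (\<lambda>y. T y u v w)"
  unfolding T_def using Ck_continuous[OF CkH3[of 0]] by simp

section \<open>Bounds and joint continuity of the derivatives\<close>

lemma compact_bound:
  assumes "compact K" "K \<subseteq> \<Omega>" "continuous_on \<Omega> (F :: 'a \<Rightarrow> real)"
  shows "\<exists>C\<ge>0. \<forall>y\<in>K. \<bar>F y\<bar> \<le> C * 1"
proof -
  have "compact (F ` K)" using assms continuous_on_subset compact_continuous_image by blast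
  then obtain C where C: "\<forall>x\<in>F ` K. norm x \<le> C" using compact_imp_bounded bounded_iff by blast
  show ?thesis
  proof (intro exI[of _ "\<bar>C\<bar>"] conjI ballI)
    fix y assume "y \<in> K"
    hence "norm (F y) \<le> C" using C by blast
    thus "\<bar>F y\<bar> \<le> \<bar>C\<bar> * 1" by simp
  qed simp
qed

lemma M_bound:
  assumes K: "compact K" "K \<subseteq> \<Omega>"
  shows "\<exists>C\<ge>0. \<forall>y\<in>K. \<forall>u v. \<bar>M y u v\<bar> \<le> C * norm u * norm v"
proof -
  have 1: "\<exists>C\<ge>0. \<forall>y\<in>K. \<forall>v. \<bar>M y u v\<bar> \<le> C * 1 * norm v" for u
    by (rule linear_family_bound) (use M_linear K compact_bound[OF K M_cont] in auto)
  have "\<exists>C\<ge>0. \<forall>yv\<in>K \<times> UNIV. \<forall>u. \<bar>M (fst yv) u (snd yv)\<bar> \<le> C * norm (snd yv) * norm u"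
  proof (rule linear_family_bound)
    fix yv :: "'a \<times> 'a" assume "yv \<in> K \<times> UNIV"
    hence "fst yv \<in> \<Omega>" using K by auto
    thus "linear (\<lambda>u. M (fst yv) u (snd yv))" using M_bilinear[of "fst yv"] unfolding bilinear_def by blast
  next
    fix i :: 'a
    obtain C where "C \<ge> 0" "\<forall>y\<in>K. \<forall>v. \<bar>M y i v\<bar> \<le> C * 1 * norm v" using 1[of i] by blast
    thus "\<exists>C\<ge>0. \<forall>yv\<in>K \<times> UNIV. \<bar>M (fst yv) i (snd yv)\<bar> \<le> C * norm (snd yv)"
      by (intro exI[of _ C]) auto
  qed simp
  then obtain C where "C \<ge> 0" and C: "\<forall>yv\<in>K \<times> UNIV. \<forall>u. \<bar>M (fst yv) u (snd yv)\<bar> \<le> C * norm (snd yv) * norm u" by blast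
  have "\<bar>M y u v\<bar> \<le> C * norm u * norm v" if "y \<in> K" for y u v
    using C[rule_format, of "(y,v)" u] that by (simp add: ac_simps)
  thus ?thesis using \<open>C \<ge> 0\<close> by blast
qed

lemma T_bound:
  assumes K: "compact K" "K \<subseteq> \<Omega>"
  shows "\<exists>C\<ge>0. \<forall>y\<in>K. \<forall>u v w. \<bar>T y u v w\<bar> \<le> C * norm u * norm v * norm w"
proof -
  have lin: "linear (\<lambda>v. T y u v w)" "linear (\<lambda>u. T y u v w)" if "y \<in> \<Omega>" for y u v w
  proof -
    have "(\<lambda>v. T y u v w) = T y u w" using T_perm23[OF that] by auto
    thus "linear (\<lambda>v. T y u v w)" using T_linear[OF that] by simp
    have "(\<lambda>u. T y u v w) = T y w v" using T_perm13[OF that] by auto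
    thus "linear (\<lambda>u. T y u v w)" using T_linear[OF that] by simp
  qed
  have 1: "\<exists>C\<ge>0. \<forall>y\<in>K. \<forall>w. \<bar>T y u v w\<bar> \<le> C * 1 * norm w" for u v
    by (rule linear_family_bound) (use T_linear K compact_bound[OF K T_cont] in auto)
  have 2: "\<exists>C\<ge>0. \<forall>yw\<in>K \<times> UNIV. \<forall>v. \<bar>T (fst yw) u v (snd yw)\<bar> \<le> C * norm (snd yw) * norm v" for u
  proof (rule linear_family_bound)
    fix yw :: "'a \<times> 'a" assume "yw \<in> K \<times> UNIV"
    hence "fst yw \<in> \<Omega>" using K by auto
    thus "linear (\<lambda>v. T (fst yw) u v (snd yw))" by (rule lin)
  next
    fix i :: 'a
    obtain C where "C \<ge> 0" "\<forall>y\<in>K. \<forall>w. \<bar>T y u i w\<bar> \<le> C * 1 * norm w" using 1[of u i] by blast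
    thus "\<exists>C\<ge>0. \<forall>yw\<in>K \<times> UNIV. \<bar>T (fst yw) u i (snd yw)\<bar> \<le> C * norm (snd yw)"
      by (intro exI[of _ C]) auto
  qed simp
  have "\<exists>C\<ge>0. \<forall>z\<in>(K \<times> UNIV) \<times> UNIV. \<forall>u. \<bar>T (fst (fst z)) u (snd z) (snd (fst z))\<bar> \<le> C * (norm (snd (fst z)) * norm (snd z)) * norm u"
  proof (rule linear_family_bound)
    fix z :: "('a \<times> 'a) \<times> 'a" assume "z \<in> (K \<times> UNIV) \<times> UNIV"
    hence "fst (fst z) \<in> \<Omega>" using K by auto
    thus "linear (\<lambda>u. T (fst (fst z)) u (snd z) (snd (fst z)))" by (rule lin)
  next
    fix i :: 'a
    obtain C where "C \<ge> 0" "\<forall>yw\<in>K \<times> UNIV. \<forall>v. \<bar>T (fst yw) i v (snd yw)\<bar> \<le> C * norm (snd yw) * norm v" using 2[of i] by blast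
    thus "\<exists>C\<ge>0. \<forall>z\<in>(K \<times> UNIV) \<times> UNIV. \<bar>T (fst (fst z)) i (snd z) (snd (fst z))\<bar> \<le> C * (norm (snd (fst z)) * norm (snd z))"
      by (intro exI[of _ C]) (auto simp: mult.assoc)
  qed simp
  then obtain C where "C \<ge> 0" and C: "\<forall>z\<in>(K \<times> UNIV) \<times> UNIV. \<forall>u. \<bar>T (fst (fst z)) u (snd z) (snd (fst z))\<bar> \<le> C * (norm (snd (fst z)) * norm (snd z)) * norm u" by blast
  have "\<bar>T y u v w\<bar> \<le> C * norm u * norm v * norm w" if "y \<in> K" for y u v w
    using C[rule_format, of "((y,w),v)" u] that by (simp add: ac_simps)
  thus ?thesis using \<open>C \<ge> 0\<close> by blast
qed

lemma M_cont_pair: "continuous_on (\<Omega> \<times> UNIV) (\<lambda>z. M (fst z) (snd z) (snd z))"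
proof -
  have eq: "M y v v = (\<Sum>i\<in>Basis. \<Sum>j\<in>Basis. (v \<bullet> i) * ((v \<bullet> j) * M y i j))" if "y \<in> \<Omega>" for y v
  proof -
    have l: "linear (M y u)" for u by (rule M_linear[OF that])
    have ex: "M y u x = (\<Sum>j\<in>Basis. (x \<bullet> j) * M y u j)" for u x
    proof -
      have "M y u x = M y u (\<Sum>j\<in>Basis. (x \<bullet> j) *\<^sub>R j)" by (simp only: euclidean_representation)
      thus ?thesis by (simp add: linear_sum[OF l] linear_scale[OF l])
    qed
    have "M y v v = (\<Sum>i\<in>Basis. (v \<bullet> i) * M y i v)" by (subst ex) (simp only: M_sym[OF that, of v])
    also have "\<dots> = (\<Sum>i\<in>Basis. (v \<bullet> i) * (\<Sum>j\<in>Basis. (v \<bullet> j) * M y i j))" by (simp only: ex[of _ v])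
    finally show ?thesis by (simp only: sum_distrib_left)
  qed
  have c: "continuous_on (\<Omega> \<times> UNIV) (\<lambda>z. M (fst z) i j)" for i j
    by (rule continuous_on_compose2[OF M_cont continuous_on_fst[OF continuous_on_id]]) auto
  have "continuous_on (\<Omega> \<times> UNIV) (\<lambda>z. \<Sum>i\<in>Basis. \<Sum>j\<in>Basis. (snd z \<bullet> i) * ((snd z \<bullet> j) * M (fst z) i j))"
    by (intro continuous_intros c)
  thus ?thesis by (rule continuous_on_eq) (auto simp: eq)
qed

end

section \<open>The capillary cone\<close>

text \<open>\<open>esm_pos\<close> and \<open>eqn\<close> are imposed on the whole closed cone
  because they are differentiated along straight lines, which leave the sphere. They are imposed for
  every orthonormal basis so that the frame of one point can be kept fixed while the point moves.
  The minors run over all of the ambient space; the radial eigenvalue 0 does not change their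
  sums.\<close>

locale capillary_cone = homog4 \<Omega> H
  for \<Omega> :: "'a::euclidean_space set" and H :: "'a \<Rightarrow> real" +
  fixes G :: "'a \<Rightarrow> real" and b :: 'a and c p \<gamma> :: real and k m :: nat
  assumes b: "norm b = 1" and c: "0 < c" "c < 1"
    and mk: "m < k" "k < DIM('a)" and p: "p \<ge> 1" and \<gamma>: "\<gamma> = p - 1 + real (k - m)"
    and cone_sub: "\<And>y. y \<noteq> 0 \<Longrightarrow> c * norm y \<le> y \<bullet> b \<Longrightarrow> y \<in> \<Omega>"
    and CkG: "Ck 2 \<Omega> G"
    and Hpos: "\<And>y. norm y = 1 \<Longrightarrow> c \<le> y \<bullet> b \<Longrightarrow> H y > 0"
    and Gpos: "\<And>y. norm y = 1 \<Longrightarrow> c \<le> y \<bullet> b \<Longrightarrow> G y > 0"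
    and psd: "\<And>y v. norm y = 1 \<Longrightarrow> c \<le> y \<bullet> b \<Longrightarrow> y \<bullet> v = 0 \<Longrightarrow> M y v v \<ge> 0"
    and Gconv: "\<And>y v. norm y = 1 \<Longrightarrow> c \<le> y \<bullet> b \<Longrightarrow> y \<bullet> v = 0 \<Longrightarrow> dr v (dr v G) y \<ge> 0"
    and Hbd: "\<And>y. norm y = 1 \<Longrightarrow> y \<bullet> b = c \<Longrightarrow> dr b H y = 0"
    and Gbd: "\<And>y. norm y = 1 \<Longrightarrow> y \<bullet> b = c \<Longrightarrow> dr b G y \<ge> 0"
    and esm_pos: "\<And>y e. y \<noteq> 0 \<Longrightarrow> c * norm y \<le> y \<bullet> b \<Longrightarrow> onb DIM('a) e \<Longrightarrow>
        0 < esm DIM('a) (int k) (\<lambda>i j. M y (e i) (e j)) \<and> 0 < esm DIM('a) (int m) (\<lambda>i j. M y (e i) (e j))"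
    and eqn: "\<And>y e. y \<noteq> 0 \<Longrightarrow> c * norm y \<le> y \<bullet> b \<Longrightarrow> onb DIM('a) e \<Longrightarrow>
        ln (esm DIM('a) (int k) (\<lambda>i j. M y (e i) (e j))) - ln (esm DIM('a) (int m) (\<lambda>i j. M y (e i) (e j)))
        = (p - 1) * ln (H y) - \<gamma> * ln (G y)"
begin


section \<open>The cap and frames of eigenvectors\<close>

definition cap :: "'a set" where "cap = {y. norm y = 1 \<and> c \<le> y \<bullet> b}"

lemma capD: "y \<in> cap \<Longrightarrow> norm y = 1" "y \<in> cap \<Longrightarrow> c \<le> y \<bullet> b" "y \<in> cap \<Longrightarrow> y \<noteq> 0" "y \<in> cap \<Longrightarrow> y \<bullet> y = 1"
  by (auto simp: cap_def norm_eq_1)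

lemma cap_sub: "cap \<subseteq> \<Omega>"
proof
  fix y assume "y \<in> cap"
  hence "norm y = 1" "c \<le> y \<bullet> b" by (auto simp: cap_def)
  moreover from this have "y \<noteq> 0" by auto
  ultimately show "y \<in> \<Omega>" using cone_sub[of y] by simp
qed

lemma cap_dom: "y \<in> cap \<Longrightarrow> y \<in> \<Omega>"
  using cap_sub by blast

lemma compact_cap: "compact cap"
proof -
  have "cap = sphere 0 1 \<inter> {y. c \<le> y \<bullet> b}" by (auto simp: cap_def)
  moreover have "closed {y. c \<le> y \<bullet> b}" by (intro closed_Collect_le continuous_intros)
  ultimately show ?thesis using compact_sphere compact_Int_closed by metis
qed

lemma b_cap: "b \<in> cap"
  using b c by (simp add: cap_def norm_eq_1)

text \<open>Index 0 is the radial direction, with eigenvalue 0; the other indices carry the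
  eigenvalues of \<open>W\<close>. The frame diagonalises the form at \<open>y\<close> only.\<close>

definition frame :: "'a \<Rightarrow> (nat \<Rightarrow> 'a) \<Rightarrow> bool" where
  "frame y e \<longleftrightarrow> onb DIM('a) e \<and> e 0 = y \<and> (\<forall>i<DIM('a). \<forall>x. M y (e i) x = M y (e i) (e i) * (e i \<bullet> x))"

lemma frameD:
  assumes "frame y e"
  shows "onb DIM('a) e" "e 0 = y" "i < DIM('a) \<Longrightarrow> M y (e i) x = M y (e i) (e i) * (e i \<bullet> x)"
    "i < DIM('a) \<Longrightarrow> j < DIM('a) \<Longrightarrow> e i \<bullet> e j = (if i = j then 1 else 0)"
    "i < DIM('a) \<Longrightarrow> norm (e i) = 1" "0 < i \<Longrightarrow> i < DIM('a) \<Longrightarrow> y \<bullet> e i = 0"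
proof -
  show "onb DIM('a) e" using assms unfolding frame_def by blast
  show "e 0 = y" using assms unfolding frame_def by blast
  show "i < DIM('a) \<Longrightarrow> M y (e i) x = M y (e i) (e i) * (e i \<bullet> x)" using assms unfolding frame_def by blast
  show o: "i < DIM('a) \<Longrightarrow> j < DIM('a) \<Longrightarrow> e i \<bullet> e j = (if i = j then 1 else 0)" for i j
    using \<open>onb DIM('a) e\<close> unfolding onb_def by blast
  show "i < DIM('a) \<Longrightarrow> norm (e i) = 1" using onb_norm[OF \<open>onb DIM('a) e\<close>] .
  show "0 < i \<Longrightarrow> i < DIM('a) \<Longrightarrow> y \<bullet> e i = 0" using o[of 0 i] \<open>e 0 = y\<close> by simp
qed

lemma frame_extend:
  assumes y: "y \<in> cap" and v: "norm v = 1" "y \<bullet> v = 0" "\<And>x. M y v x = M y v v * (v \<bullet> x)"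
  obtains e where "frame y e" "e 1 = v"
proof -
  define f where "f i = (if i = (0::nat) then y else v)" for i
  have yO: "y \<in> \<Omega>" using cap_dom[OF y] .
  have "\<exists>e'. (\<forall>i<2. e' i = f i) \<and> onb DIM('a) e' \<and> (\<forall>i<DIM('a). \<forall>x. M y (e' i) x = M y (e' i) (e' i) * (e' i \<bullet> x))"
  proof (rule eigenbasis_extend[OF M_bilinear[OF yO] M_sym[OF yO]])
    show "onb 2 f" unfolding onb_def
    proof (intro allI impI)
      fix i j :: nat assume "i < 2" "j < 2"
      hence "i = 0 \<or> i = 1" "j = 0 \<or> j = 1" by auto
      thus "f i \<bullet> f j = (if i = j then 1 else 0)"
        using v(1,2) capD(1)[OF y] by (auto simp: f_def norm_eq_1 inner_commute)
    qed
    fix i :: nat and x assume "i < 2"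
    show "M y (f i) x = M y (f i) (f i) * (f i \<bullet> x)"
    proof (cases "i = 0")
      case True thus ?thesis using M_radial[OF yO] by (simp add: f_def)
    next
      case False
      hence "f i = v" by (simp add: f_def)
      thus ?thesis using v(3)[of x] by (simp only:)
    qed
  next
    show "2 \<le> DIM('a)" using mk by linarith
  qed
  then obtain e' where e': "\<forall>i<2. e' i = f i" "onb DIM('a) e'" "\<forall>i<DIM('a). \<forall>x. M y (e' i) x = M y (e' i) (e' i) * (e' i \<bullet> x)" by blast
  have "e' 0 = y" "e' 1 = v" using e'(1) by (auto simp: f_def)
  thus ?thesis using that[of e'] e' unfolding frame_def by blast
qed

lemma frame_diag:
  assumes "frame y e" "i < DIM('a)" "j < DIM('a)"
  shows "M y (e i) (e j) = (if i = j then M y (e i) (e i) else 0)"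
  using frameD(3)[OF assms(1,2), of "e j"] frameD(4)[OF assms] by simp

lemma frame_zero: "y \<in> cap \<Longrightarrow> frame y e \<Longrightarrow> M y (e 0) v = 0"
  by (simp only: frameD(2) M_radial[OF cap_dom])

lemma frame_eig_nonneg: "y \<in> cap \<Longrightarrow> frame y e \<Longrightarrow> i < DIM('a) \<Longrightarrow> M y (e i) (e i) \<ge> 0"
proof (cases "i = 0")
  case True
  assume "y \<in> cap" "frame y e"
  thus ?thesis using frame_zero True by simp
next
  case False
  assume "y \<in> cap" "frame y e" "i < DIM('a)"
  thus ?thesis using psd[OF capD(1,2)] frameD(6) False by auto
qed

lemma jet_frame:
  assumes "y \<in> cap" "frame y e" "i < DIM('a)" "j < DIM('a)"
  shows "jet2 (\<lambda>t. M (y + t *\<^sub>R a) (e i) (e j)) (if i = j then M y (e i) (e i) else 0) (T y (e i) (e j) a) (Q y (e i) (e j) a a)"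
  using jet_M[OF cap_dom[OF assms(1)], of a "e i" "e j"] frame_diag[OF assms(2-4)] by simp

lemma frame_es:
  assumes "y \<in> cap" "frame y e"
  shows "0 < es {..<DIM('a)} (int k) (\<lambda>i. M y (e i) (e i))" "0 < es {..<DIM('a)} (int m) (\<lambda>i. M y (e i) (e i))"
proof -
  have "esm DIM('a) (int j) (\<lambda>i j. M y (e i) (e j)) = es {..<DIM('a)} (int j) (\<lambda>i. M y (e i) (e i))" if "j \<le> DIM('a)" for j
  proof -
    have "esm DIM('a) (int j) (\<lambda>i j. M y (e i) (e j)) = esm DIM('a) (int j) (\<lambda>i j. if i = j then M y (e i) (e i) else 0)"
      by (rule esm_cong) (rule frame_diag[OF assms(2)])
    also have "\<dots> = es {..<DIM('a)} (int j) (\<lambda>i. M y (e i) (e i))" by (rule esm_diag[OF that])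
    finally show ?thesis .
  qed
  from this[of k] this[of m] esm_pos[OF capD(3)[OF assms(1)] _ frameD(1)[OF assms(2)]] mk capD(1,2)[OF assms(1)]
  show "0 < es {..<DIM('a)} (int k) (\<lambda>i. M y (e i) (e i))" "0 < es {..<DIM('a)} (int m) (\<lambda>i. M y (e i) (e i))" by auto
qed

section \<open>The equation differentiated along a line\<close>

lemma jet_eqn:
  assumes "y \<in> cap" "frame y e"
  shows "jet2 (\<lambda>t. ln (esm DIM('a) (int k) (\<lambda>i j. M (y + t *\<^sub>R a) (e i) (e j))) - ln (esm DIM('a) (int m) (\<lambda>i j. M (y + t *\<^sub>R a) (e i) (e j))))
    (ln (es {..<DIM('a)} (int k) (\<lambda>i. M y (e i) (e i))) - ln (es {..<DIM('a)} (int m) (\<lambda>i. M y (e i) (e i))))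
    (\<Sum>i<DIM('a). T y (e i) (e i) a * qd DIM('a) (int k) (int m) (\<lambda>i. M y (e i) (e i)) i)
    ((\<Sum>i<DIM('a). Q y (e i) (e i) a a * qd DIM('a) (int k) (int m) (\<lambda>i. M y (e i) (e i)) i)
      + qh DIM('a) (int k) (int m) (\<lambda>i. M y (e i) (e i)) (\<lambda>i j. T y (e i) (e j) a))"
  by (rule jet2_ln_quot[where X = "\<lambda>i j. T y (e i) (e j) a" and Y = "\<lambda>i j. Q y (e i) (e j) a a"])
    (rule jet_frame[OF assms] frame_es[OF assms]; assumption?)+

lemma jet_rhs:
  assumes y: "y \<in> cap"
  shows "jet2 (\<lambda>t. (p - 1) * ln (H (y + t *\<^sub>R a)) - \<gamma> * ln (G (y + t *\<^sub>R a)))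
    ((p - 1) * ln (H y) - \<gamma> * ln (G y))
    ((p - 1) * (dr a H y / H y) - \<gamma> * (dr a G y / G y))
    ((p - 1) * (M y a a / H y - (dr a H y / H y)\<^sup>2) - \<gamma> * (dr a (dr a G) y / G y - (dr a G y / G y)\<^sup>2))"
  using Hpos[OF capD(1)[OF y] capD(2)[OF y]] Gpos[OF capD(1)[OF y] capD(2)[OF y]]
  by (intro jet2_diff jet2_cmult jet2_ln jet_H jet2_line[OF op _ CkG] cap_dom[OF y])

lemma interior_eventually:
  assumes "y \<in> cap" "c < y \<bullet> b"
  shows "\<forall>\<^sub>F t in nhds 0. y + t *\<^sub>R a \<noteq> 0 \<and> c * norm (y + t *\<^sub>R a) \<le> (y + t *\<^sub>R a) \<bullet> b"
proof -
  have o: "open {x. x \<noteq> 0 \<and> c * norm x < x \<bullet> b}"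
    by (intro open_Collect_conj open_Collect_neq open_Collect_less continuous_intros)
  have "\<forall>\<^sub>F t in nhds 0. y + t *\<^sub>R a \<in> {x. x \<noteq> 0 \<and> c * norm x < x \<bullet> b}"
    by (rule line_eventually[OF o]) (use assms capD in auto)
  thus ?thesis by eventually_elim auto
qed

lemma interior_equation:
  assumes y: "y \<in> cap" "c < y \<bullet> b" and e: "frame y e"
  shows "(\<Sum>i<DIM('a). T y (e i) (e i) a * qd DIM('a) (int k) (int m) (\<lambda>i. M y (e i) (e i)) i)
      = (p - 1) * (dr a H y / H y) - \<gamma> * (dr a G y / G y)"
    "(\<Sum>i<DIM('a). Q y (e i) (e i) a a * qd DIM('a) (int k) (int m) (\<lambda>i. M y (e i) (e i)) i)
      + qh DIM('a) (int k) (int m) (\<lambda>i. M y (e i) (e i)) (\<lambda>i j. T y (e i) (e j) a)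
      = (p - 1) * (M y a a / H y - (dr a H y / H y)\<^sup>2) - \<gamma> * (dr a (dr a G) y / G y - (dr a G y / G y)\<^sup>2)"
proof -
  have ev: "\<forall>\<^sub>F t in nhds 0. ln (esm DIM('a) (int k) (\<lambda>i j. M (y + t *\<^sub>R a) (e i) (e j))) - ln (esm DIM('a) (int m) (\<lambda>i j. M (y + t *\<^sub>R a) (e i) (e j)))
    = (p - 1) * ln (H (y + t *\<^sub>R a)) - \<gamma> * ln (G (y + t *\<^sub>R a))"
    using interior_eventually[OF y] by eventually_elim (rule eqn[OF conjunct1 conjunct2 frameD(1)[OF e]])
  show "(\<Sum>i<DIM('a). T y (e i) (e i) a * qd DIM('a) (int k) (int m) (\<lambda>i. M y (e i) (e i)) i)
      = (p - 1) * (dr a H y / H y) - \<gamma> * (dr a G y / G y)"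
    by (rule jet2_unique(2)[OF jet_eqn[OF y(1) e] jet_rhs[OF y(1)] ev])
  show "(\<Sum>i<DIM('a). Q y (e i) (e i) a a * qd DIM('a) (int k) (int m) (\<lambda>i. M y (e i) (e i)) i)
      + qh DIM('a) (int k) (int m) (\<lambda>i. M y (e i) (e i)) (\<lambda>i j. T y (e i) (e j) a)
      = (p - 1) * (M y a a / H y - (dr a H y / H y)\<^sup>2) - \<gamma> * (dr a (dr a G) y / G y - (dr a G y / G y)\<^sup>2)"
    by (rule jet2_unique(3)[OF jet_eqn[OF y(1) e] jet_rhs[OF y(1)] ev])
qed

text \<open>With \<open>q = p - 1\<close> and \<open>\<alpha> = k - m\<close> this is the
  Cauchy-Schwarz inequality \<open>(q * r - \<omega>)^2 <= (q + \<alpha>) * (q * r^2 + \<omega>^2 /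
  \<alpha>)\<close>, where \<open>q + \<alpha> = \<gamma>\<close>. The gain with
  \<open>1 / (k - m)\<close> from inverse concavity thus pays exactly for the squares that the
  logarithms on the right side of the equation produce.\<close>

lemma structure_sign:
  fixes r g \<omega> :: real
  assumes "\<omega> = (p - 1) * r - \<gamma> * g"
  shows "- (p - 1) * r\<^sup>2 + \<gamma> * g\<^sup>2 - \<omega>\<^sup>2 / real (k - m) \<le> 0"
proof -
  define \<alpha> where "\<alpha> = real (k - m)"
  have \<alpha>: "\<alpha> > 0" and g0: "\<gamma> > 0" using mk p \<gamma> by (auto simp: \<alpha>_def)
  define q where "q = p - 1"
  have q: "q \<ge> 0" "\<gamma> = q + \<alpha>" using p \<gamma> by (auto simp: q_def \<alpha>_def)
  have e: "\<gamma> * g = q * r - \<omega>" using assms by (simp add: q_def)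
  have "(q + \<alpha>) * (q * r\<^sup>2 + \<omega>\<^sup>2 / \<alpha>) - (q * r - \<omega>)\<^sup>2 = q * \<alpha> * (r + \<omega> / \<alpha>)\<^sup>2"
    using \<alpha> by (simp add: power2_eq_square field_simps)
  also have "\<dots> \<ge> 0" using q \<alpha> by simp
  finally have "(q * r - \<omega>)\<^sup>2 \<le> \<gamma> * (q * r\<^sup>2 + \<omega>\<^sup>2 / \<alpha>)" by (simp add: q(2))
  hence "(\<gamma> * g)\<^sup>2 \<le> \<gamma> * (q * r\<^sup>2 + \<omega>\<^sup>2 / \<alpha>)" by (simp only: e)
  hence "\<gamma> * (\<gamma> * g\<^sup>2) \<le> \<gamma> * (q * r\<^sup>2 + \<omega>\<^sup>2 / \<alpha>)" by (simp add: power2_eq_square ac_simps)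
  hence "\<gamma> * g\<^sup>2 \<le> q * r\<^sup>2 + \<omega>\<^sup>2 / \<alpha>" by (rule mult_left_le_imp_le[OF _ g0])
  moreover have "- (p - 1) * r\<^sup>2 = - (q * r\<^sup>2)" by (simp add: q_def algebra_simps)
  ultimately show ?thesis unfolding \<alpha>_def[symmetric] by linarith
qed

text \<open>Differentiating the Neumann condition twice along the boundary circles.\<close>

lemma boundary_curve:
  assumes y: "y \<in> cap" "y \<bullet> b = c" and \<tau>: "y \<bullet> \<tau> = 0" "b \<bullet> \<tau> = 0" "norm \<tau> = 1"
  obtains s \<nu> q where "s > 0" "s\<^sup>2 = 1 - c\<^sup>2" "norm \<nu> = 1" "\<nu> \<bullet> b = 0" "\<nu> \<bullet> \<tau> = 0" "y = c *\<^sub>R b + s *\<^sub>R \<nu>" "q 0 = y"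
    "(q has_vector_derivative s *\<^sub>R \<tau>) (at 0)" "\<And>t. q t \<in> cap" "\<And>t. q t \<bullet> b = c"
    "\<And>t. q t = c *\<^sub>R b + s *\<^sub>R (cos t *\<^sub>R \<nu> + sin t *\<^sub>R \<tau>)"
proof -
  define s where "s = sqrt (1 - c\<^sup>2)"
  define \<nu> where "\<nu> = (y - c *\<^sub>R b) /\<^sub>R s"
  define q where "q = (\<lambda>t. c *\<^sub>R b + s *\<^sub>R (cos t *\<^sub>R \<nu> + sin t *\<^sub>R \<tau>))"
  have c2: "c\<^sup>2 < 1" using c by (simp add: power_less_one_iff abs_square_less_1)
  have s: "s > 0" "s\<^sup>2 = 1 - c\<^sup>2" using c2 by (auto simp: s_def)
  have bb: "b \<bullet> b = 1" and yy: "y \<bullet> y = 1" using b y capD by (auto simp: norm_eq_1)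
  have "(y - c *\<^sub>R b) \<bullet> (y - c *\<^sub>R b) = s\<^sup>2"
    using y(2) bb yy s(2) inner_commute[of b y] by (simp add: inner_diff_left inner_diff_right power2_eq_square)
  hence "norm (y - c *\<^sub>R b) = s" using s(1) by (simp add: norm_eq_sqrt_inner)
  hence n: "norm \<nu> = 1" using s by (simp add: \<nu>_def)
  have nb: "\<nu> \<bullet> b = 0" using y(2) bb by (simp add: \<nu>_def inner_diff_left)
  have nt: "\<nu> \<bullet> \<tau> = 0" using \<tau> by (simp add: \<nu>_def inner_diff_left)
  have yeq: "y = c *\<^sub>R b + s *\<^sub>R \<nu>" using s by (simp add: \<nu>_def)
  have q0: "q 0 = y" by (subst yeq) (simp add: q_def)
  have qd: "(q has_vector_derivative s *\<^sub>R \<tau>) (at 0)"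
    unfolding q_def by (auto intro!: derivative_eq_intros)
  have tt: "\<tau> \<bullet> \<tau> = 1" and nn: "\<nu> \<bullet> \<nu> = 1" using \<tau>(3) n by (auto simp: norm_eq_1)
  have qb: "q t \<bullet> b = c" for t using bb nb \<tau>(2) inner_commute[of b \<tau>] by (simp add: q_def inner_add_left)
  have qc: "q t \<in> cap" for t
  proof -
  define w where "w = cos t *\<^sub>R \<nu> + sin t *\<^sub>R \<tau>"
  have "w \<bullet> w = (cos t)\<^sup>2 + (sin t)\<^sup>2"
    using nn tt nt inner_commute[of \<tau> \<nu>] by (simp add: w_def inner_add_left inner_add_right power2_eq_square)
  hence ww: "w \<bullet> w = 1" by simp
  have wb: "w \<bullet> b = 0" using nb \<tau>(2) inner_commute[of b \<tau>] by (simp add: w_def inner_add_left)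
  have qw: "q t = c *\<^sub>R b + s *\<^sub>R w" by (simp add: q_def w_def)
  have "q t \<bullet> q t = c\<^sup>2 + s\<^sup>2"
    unfolding qw using bb ww wb inner_commute[of b w] by (simp add: inner_add_left inner_add_right power2_eq_square)
  hence "norm (q t) = 1" using s by (simp add: norm_eq_1)
  thus "q t \<in> cap" using qb by (simp add: cap_def)
  qed
  show ?thesis
    by (rule that[OF s n nb nt yeq q0 qd qc qb]) (simp add: q_def)
qed

text \<open>Since \<open>b\<close> is a combination of the radial direction, which is in the kernel,
  and the conormal direction, this makes the conormal direction an eigenvector at boundary
  points.\<close>

lemma boundary_mixed:
  assumes y: "y \<in> cap" "y \<bullet> b = c" and \<tau>: "y \<bullet> \<tau> = 0" "b \<bullet> \<tau> = 0"
  shows "M y b \<tau> = 0"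
proof (cases "\<tau> = 0")
  case True
  thus ?thesis using linear_0[OF M_linear[OF cap_dom[OF y(1)]]] by simp
next
  case False
  define u where "u = \<tau> /\<^sub>R norm \<tau>"
  have u: "y \<bullet> u = 0" "b \<bullet> u = 0" "norm u = 1" using \<tau> False by (auto simp: u_def)
  obtain s \<nu> q where B: "s > 0" "s\<^sup>2 = 1 - c\<^sup>2" "norm \<nu> = 1" "\<nu> \<bullet> b = 0" "\<nu> \<bullet> u = 0" "y = c *\<^sub>R b + s *\<^sub>R \<nu>" "q 0 = y"
    "(q has_vector_derivative s *\<^sub>R u) (at 0)" "\<And>t. q t \<in> cap" "\<And>t. q t \<bullet> b = c"
    "\<And>t. q t = c *\<^sub>R b + s *\<^sub>R (cos t *\<^sub>R \<nu> + sin t *\<^sub>R u)"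
    by (rule boundary_curve[OF y u]) (rule that)
  have "((\<lambda>t. dr b H (q t)) has_real_derivative dr (s *\<^sub>R u) (dr b H) (q 0)) (at 0)"
    by (rule DERIV_curve[OF op CkH1[of "Suc 0"] B(8)]) (use cap_dom[OF B(9)] in auto)
  moreover have "(\<lambda>t. dr b H (q t)) = (\<lambda>t. 0)"
    using Hbd[OF capD(1)[OF B(9)] B(10)] by auto
  ultimately have "((\<lambda>t. 0) has_real_derivative M y b (s *\<^sub>R u)) (at 0)" by (simp add: M_def B(7))
  hence "M y b (s *\<^sub>R u) = 0" using DERIV_const DERIV_unique by blast
  hence "M y b u = 0" using linear_scale[OF M_linear[OF cap_dom[OF y(1)]], of b s u] B(1) by simp
  moreover have "\<tau> = norm \<tau> *\<^sub>R u" using False by (simp add: u_def)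
  ultimately show ?thesis using linear_scale[OF M_linear[OF cap_dom[OF y(1)]], of b "norm \<tau>" u] by simp
qed

text \<open>\<open>boundary_mixed\<close> is used at every point of the circle through
  \<open>y\<close>, giving \<open>M (q t) b u\<close> as a multiple of
  \<open>sin t * M (q t) b b\<close>. Its derivative at 0 keeps only the value of
  \<open>M y b b\<close>.\<close>

lemma boundary_third:
  assumes y: "y \<in> cap" "y \<bullet> b = c" and u: "y \<bullet> u = 0" "b \<bullet> u = 0" "norm u = 1"
  shows "(1 - c\<^sup>2) * T y u u b = - c * M y b b"
proof -
  obtain s \<nu> q where B: "s > 0" "s\<^sup>2 = 1 - c\<^sup>2" "norm \<nu> = 1" "\<nu> \<bullet> b = 0" "\<nu> \<bullet> u = 0" "y = c *\<^sub>R b + s *\<^sub>R \<nu>" "q 0 = y"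
    "(q has_vector_derivative s *\<^sub>R u) (at 0)" "\<And>t. q t \<in> cap" "\<And>t. q t \<bullet> b = c"
    "\<And>t. q t = c *\<^sub>R b + s *\<^sub>R (cos t *\<^sub>R \<nu> + sin t *\<^sub>R u)"
    by (rule boundary_curve[OF y u]) (rule that)
  have bb: "b \<bullet> b = 1" using b by (simp add: norm_eq_1)
  have uu: "u \<bullet> u = 1" using u by (simp add: norm_eq_1)
  have val: "M (q t) b u = - (c / s) * (sin t * M (q t) b b)" for t
  proof -
    define w where "w = cos t *\<^sub>R \<nu> + sin t *\<^sub>R u"
    have qO: "q t \<in> \<Omega>" by (rule cap_dom[OF B(9)])
    have l: "linear (M (q t) x)" for x by (rule M_linear[OF qO])
    have qw: "q t = c *\<^sub>R b + s *\<^sub>R w" using B(11)[of t] by (simp add: w_def)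
    have ww: "w \<bullet> w = 1"
    proof -
      have "w \<bullet> w = (cos t)\<^sup>2 + (sin t)\<^sup>2"
        using B(3) uu B(5) inner_commute[of u \<nu>]
        by (simp add: w_def inner_add_left inner_add_right power2_eq_square norm_eq_1)
      thus ?thesis by simp
    qed
    have wu: "w \<bullet> u = sin t" using B(5) uu by (simp add: w_def inner_add_left)
    have wb: "w \<bullet> b = 0" using B(4) u(2) inner_commute[of b u] by (simp add: w_def inner_add_left)
    \<comment> \<open>The circle turns, so the fixed \<open>u\<close> is in general not tangent to
      it at \<open>q t\<close>; this is its component orthogonal to \<open>w\<close>. The remaining
      component along \<open>w\<close> is evaluated by means of
      \<open>M (q t) b (q t) = 0\<close>.\<close>
    let ?\<tau> = "u - sin t *\<^sub>R w"
    have "w \<bullet> ?\<tau> = 0" using ww wu by (simp add: inner_diff_right)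
    moreover have bt: "b \<bullet> ?\<tau> = 0" using u(2) wb inner_commute[of b w] by (simp add: inner_diff_right)
    ultimately have "q t \<bullet> ?\<tau> = 0" unfolding qw by (simp add: inner_add_left)
    from boundary_mixed[OF B(9,10) this bt] have 1: "M (q t) b u = sin t * M (q t) b w"
      using linear_diff[OF l, of b u "sin t *\<^sub>R w"] linear_scale[OF l, of b "sin t" w] by simp
    have "M (q t) b (q t) = 0" using M_radial[OF qO, of b] M_sym[OF qO, of b "q t"] by simp
    hence "c * M (q t) b b + s * M (q t) b w = 0"
      using linear_add[OF l, of b "c *\<^sub>R b" "s *\<^sub>R w"] linear_scale[OF l] qw by simp
    hence "M (q t) b w = - (c / s) * M (q t) b b" using B(1) by (simp add: field_simps)
    thus ?thesis using 1 by simp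
  qed
  have 1: "((\<lambda>t. M (q t) b u) has_real_derivative T y b u (s *\<^sub>R u)) (at 0)"
  proof -
    have "((\<lambda>t. dr u (dr b H) (q t)) has_real_derivative dr (s *\<^sub>R u) (dr u (dr b H)) (q 0)) (at 0)"
      by (rule DERIV_curve[OF op CkH2[of "Suc 0"] B(8)]) (use cap_dom[OF B(9)] in auto)
    thus ?thesis by (simp add: M_def T_def B(7))
  qed
  have 2: "((\<lambda>t. M (q t) b b) has_real_derivative T y b b (s *\<^sub>R u)) (at 0)"
  proof -
    have "((\<lambda>t. dr b (dr b H) (q t)) has_real_derivative dr (s *\<^sub>R u) (dr b (dr b H)) (q 0)) (at 0)"
      by (rule DERIV_curve[OF op CkH2[of "Suc 0"] B(8)]) (use cap_dom[OF B(9)] in auto)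
    thus ?thesis by (simp add: M_def T_def B(7))
  qed
  have "((\<lambda>t. - (c / s) * (sin t * M (q t) b b)) has_real_derivative - (c / s) * (cos 0 * M (q 0) b b + T y b b (s *\<^sub>R u) * sin 0)) (at 0)"
    by (intro DERIV_cmult DERIV_mult DERIV_sin 2)
  hence "((\<lambda>t. M (q t) b u) has_real_derivative - (c / s) * M y b b) (at 0)"
    by (simp add: val[abs_def] B(7))
  hence "T y b u (s *\<^sub>R u) = - (c / s) * M y b b" using 1 DERIV_unique by blast
  hence "s * T y b u u = - (c / s) * M y b b"
    using linear_scale[OF T_linear[OF cap_dom[OF y(1)]], of b u s u] by simp
  hence "s\<^sup>2 * T y b u u = - c * M y b b" using B(1) by (simp add: power2_eq_square field_simps)
  moreover have "T y b u u = T y u u b" using T_perm13[OF cap_dom[OF y(1)]] .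
  ultimately show ?thesis using B(2) by simp
qed

end

section \<open>Touching the barrier\<close>

lemma jet2_t: "jet2 f a b c \<Longrightarrow> jet2 (\<lambda>t. t * f t) 0 a (2 * b)"
  using jet2_mult[OF jet2_id, of f a b c] by simp

lemma jet2_tt: "jet2 f a b c \<Longrightarrow> jet2 (\<lambda>t. t * (t * f t)) 0 0 (2 * a)"
  using jet2_t[OF jet2_t, of f a b c] by simp

lemma esm_eigenbasis:
  fixes B :: "'a::euclidean_space \<Rightarrow> 'a \<Rightarrow> real"
  assumes bil: "bilinear B" and e: "onb DIM('a) e" "\<And>i x. i < DIM('a) \<Longrightarrow> B (e i) x = l i * (e i \<bullet> x)"
    and f: "onb DIM('a) f" and j: "j \<le> DIM('a)"
  shows "esm DIM('a) (int j) (\<lambda>i k. B (f i) (f k)) = es {..<DIM('a)} (int j) l"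
proof (rule esm_orthogonal_diag[where Q = "\<lambda>i m. f i \<bullet> e m", OF _ _ j])
  fix i k assume ik: "i < DIM('a)" "k < DIM('a)"
  show "(\<Sum>m<DIM('a). (f i \<bullet> e m) * (f k \<bullet> e m)) = (if i = k then 1 else 0)"
    using onb_parseval[OF e(1), of "f i" "f k"] f ik unfolding onb_def by simp
  have lin: "linear (\<lambda>x. B x (f k))" using bil unfolding bilinear_def by blast
  have "B (f i) (f k) = B (\<Sum>m<DIM('a). (f i \<bullet> e m) *\<^sub>R e m) (f k)" using onb_expand[OF e(1), of "f i"] by simp
  also have "\<dots> = (\<Sum>m<DIM('a). (f i \<bullet> e m) * B (e m) (f k))"
    by (simp add: linear_sum[OF lin] linear_scale[OF lin])
  also have "\<dots> = (\<Sum>m<DIM('a). l m * (f i \<bullet> e m) * (f k \<bullet> e m))"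
    by (intro sum.cong refl) (simp add: e(2) inner_commute)
  finally show "B (f i) (f k) = (\<Sum>m<DIM('a). l m * (f i \<bullet> e m) * (f k \<bullet> e m))" .
qed

context capillary_cone
begin

text \<open>Eigenframes need not depend continuously on the point. Compactness is therefore applied
  to the minors in one fixed basis, and the resulting lower bound is transferred to every frame by
  \<open>esm_eigenbasis\<close>.\<close>

lemma constants:
  "\<exists>c0 C0 B h0. c0 > 0 \<and> C0 > 0 \<and> B \<ge> 0 \<and> h0 > 0 \<and> (\<forall>y\<in>cap. h0 \<le> H y \<and>
     (\<forall>u v w. \<bar>T y u v w\<bar> \<le> B * norm u * norm v * norm w) \<and>
     (\<forall>e. frame y e \<longrightarrow> (\<forall>i<DIM('a). c0 \<le> qd DIM('a) (int k) (int m) (\<lambda>i. M y (e i) (e i)) i \<and>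
        qd DIM('a) (int k) (int m) (\<lambda>i. M y (e i) (e i)) i \<le> C0 \<and>
        (\<forall>j\<in>{k,m}. \<bar>dlog DIM('a) (int j) (\<lambda>i. M y (e i) (e i)) i\<bar> \<le> C0 \<and>
          (\<forall>i'<DIM('a). \<bar>ddlog DIM('a) (int j) (\<lambda>i. M y (e i) (e i)) i i'\<bar> \<le> C0)))))"
proof -
  obtain L where L: "L \<ge> 0" "\<forall>y\<in>cap. \<forall>u v. \<bar>M y u v\<bar> \<le> L * norm u * norm v"
    using M_bound[OF compact_cap cap_sub] by blast
  obtain B where B: "B \<ge> 0" "\<forall>y\<in>cap. \<forall>u v w. \<bar>T y u v w\<bar> \<le> B * norm u * norm v * norm w"
    using T_bound[OF compact_cap cap_sub] by blast
  have ne: "cap \<noteq> {}" using b_cap by blast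
  have "continuous_on cap H" using Ck_continuous[OF CkH] cap_sub continuous_on_subset by blast
  then obtain z where z: "z \<in> cap" "\<forall>y\<in>cap. H z \<le> H y"
    using continuous_attains_inf[OF compact_cap ne] by blast
  have h0: "H z > 0" using Hpos[OF capD(1)[OF z(1)] capD(2)[OF z(1)]] .
  \<comment> \<open>With no prescribed initial vectors, the extension lemma merely supplies some
    orthonormal basis.\<close>
  have "\<exists>e'. (\<forall>i<0. e' i = (\<lambda>_::nat. 0::'a) i) \<and> onb DIM('a) e' \<and> (\<forall>i<DIM('a). \<forall>x. M b (e' i) x = M b (e' i) (e' i) * (e' i \<bullet> x))"
    by (rule eigenbasis_extend[OF M_bilinear[OF cap_dom[OF b_cap]] M_sym[OF cap_dom[OF b_cap]]]) (auto simp: onb_def)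
  then obtain f where f: "onb DIM('a) (f :: nat \<Rightarrow> 'a)" by blast
  have cont: "continuous_on cap (\<lambda>y. esm DIM('a) j (\<lambda>i i'. M y (f i) (f i')))" for j
    unfolding esm_def
    by (intro continuous_intros continuous_on_subset[OF M_cont cap_sub])
  have "\<exists>s>0. \<forall>y\<in>cap. s \<le> esm DIM('a) (int j) (\<lambda>i i'. M y (f i) (f i'))" if j: "j \<in> {k,m}" for j
  proof -
    obtain x where x: "x \<in> cap" "\<forall>y\<in>cap. esm DIM('a) (int j) (\<lambda>i i'. M x (f i) (f i')) \<le> esm DIM('a) (int j) (\<lambda>i i'. M y (f i) (f i'))"
      using continuous_attains_inf[OF compact_cap ne cont] by blast
    have "0 < esm DIM('a) (int j) (\<lambda>i i'. M x (f i) (f i'))"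
      using esm_pos[OF capD(3)[OF x(1)] _ f] capD(1,2)[OF x(1)] j by auto
    thus ?thesis using x(2) by blast
  qed
  then obtain S where S: "\<And>j. j \<in> {k,m} \<Longrightarrow> S j > 0" "\<And>j y. j \<in> {k,m} \<Longrightarrow> y \<in> cap \<Longrightarrow> S j \<le> esm DIM('a) (int j) (\<lambda>i i'. M y (f i) (f i'))"
    by metis
  define s where "s = min (S k) (S m)"
  have s: "s > 0" using S(1) by (simp add: s_def)
  have mk': "m < k" "k \<le> DIM('a)" using mk by auto
  obtain c0 C0 where cC: "c0 > 0" "C0 > 0" "\<forall>x. (\<forall>i<DIM('a). 0 \<le> x i \<and> x i \<le> L + 1) \<longrightarrow> es {..<DIM('a)} (int k) x \<ge> s \<longrightarrow> es {..<DIM('a)} (int m) x \<ge> s \<longrightarrow>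
     (\<forall>a<DIM('a). c0 \<le> qd DIM('a) (int k) (int m) x a \<and> qd DIM('a) (int k) (int m) x a \<le> C0 \<and> (\<forall>j\<in>{k,m}. 0 \<le> dlog DIM('a) (int j) x a \<and> dlog DIM('a) (int j) x a \<le> C0
       \<and> (\<forall>b<DIM('a). 0 \<le> ddlog DIM('a) (int j) x a b \<and> ddlog DIM('a) (int j) x a b \<le> C0)))"
    using qd_uniform[OF mk', of "L + 1" s] L(1) s by auto
  show ?thesis
  proof (rule exI[of _ c0], rule exI[of _ C0], rule exI[of _ B], rule exI[of _ "H z"], intro conjI ballI)
    show "c0 > 0" "C0 > 0" "B \<ge> 0" "H z > 0" by fact+
    fix y assume y: "y \<in> cap"
    show "H z \<le> H y" using z y by blast
    show "\<forall>u v w. \<bar>T y u v w\<bar> \<le> B * norm u * norm v * norm w" using B y by blast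
    show "\<forall>e. frame y e \<longrightarrow> (\<forall>i<DIM('a). c0 \<le> qd DIM('a) (int k) (int m) (\<lambda>i. M y (e i) (e i)) i \<and>
        qd DIM('a) (int k) (int m) (\<lambda>i. M y (e i) (e i)) i \<le> C0 \<and>
        (\<forall>j\<in>{k,m}. \<bar>dlog DIM('a) (int j) (\<lambda>i. M y (e i) (e i)) i\<bar> \<le> C0 \<and>
          (\<forall>i'<DIM('a). \<bar>ddlog DIM('a) (int j) (\<lambda>i. M y (e i) (e i)) i i'\<bar> \<le> C0)))"
    proof (intro allI impI)
      fix e i assume e: "frame y e" and i: "i < DIM('a)"
      let ?l = "\<lambda>i. M y (e i) (e i)"
      have l: "\<forall>i<DIM('a). 0 \<le> ?l i \<and> ?l i \<le> L + 1"
      proof (intro allI impI conjI)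
        fix i assume i: "i < DIM('a)"
        show "0 \<le> ?l i" by (rule frame_eig_nonneg[OF y e i])
        have "\<bar>?l i\<bar> \<le> L * norm (e i) * norm (e i)" using L(2) y by blast
        thus "?l i \<le> L + 1" using frameD(5)[OF e i] by simp
      qed
      have es: "s \<le> es {..<DIM('a)} (int j) ?l" if j: "j \<in> {k,m}" for j
      proof -
        have jd: "j \<le> DIM('a)" using j mk by auto
        have "esm DIM('a) (int j) (\<lambda>i i'. M y (f i) (f i')) = es {..<DIM('a)} (int j) ?l"
          by (rule esm_eigenbasis[OF M_bilinear[OF cap_dom[OF y]] frameD(1)[OF e] frameD(3)[OF e] f jd])
        moreover have "s \<le> S j" using j by (auto simp: s_def)
        ultimately show ?thesis using S(2)[OF j y] by simp
      qed
      have F: "\<forall>a<DIM('a). c0 \<le> qd DIM('a) (int k) (int m) ?l a \<and> qd DIM('a) (int k) (int m) ?l a \<le> C0 \<and> (\<forall>j\<in>{k,m}. 0 \<le> dlog DIM('a) (int j) ?l a \<and> dlog DIM('a) (int j) ?l a \<le> C0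
       \<and> (\<forall>b<DIM('a). 0 \<le> ddlog DIM('a) (int j) ?l a b \<and> ddlog DIM('a) (int j) ?l a b \<le> C0))"
        using cC(3)[rule_format, of ?l] l es[of k] es[of m] by blast
      show "c0 \<le> qd DIM('a) (int k) (int m) ?l i \<and> qd DIM('a) (int k) (int m) ?l i \<le> C0 \<and>
        (\<forall>j\<in>{k,m}. \<bar>dlog DIM('a) (int j) ?l i\<bar> \<le> C0 \<and> (\<forall>i'<DIM('a). \<bar>ddlog DIM('a) (int j) ?l i i'\<bar> \<le> C0))"
        using F i by (simp add: abs_of_nonneg)
    qed
  qed
qed

text \<open>The exponent has degree 0, so the barrier is constant along rays and lives on the cone.
  A large \<open>A\<close> makes the squared gradient in its second derivative, of order
  \<open>A^2\<close>, dominate everything else.\<close>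

definition barrier :: "real \<Rightarrow> real \<Rightarrow> 'a \<Rightarrow> 'a \<Rightarrow> real" where
  "barrier A \<epsilon> z y = \<epsilon> * exp (A * ((z \<bullet> y) / norm y))"

text \<open>The barrier, lowered by the depth of the negative minimum, touches the form from below
  at \<open>(y, v)\<close>. The strict inequality keeps \<open>M y v v\<close> below the barrier
  value, which makes every error a multiple of that value.\<close>

definition touches :: "real \<Rightarrow> real \<Rightarrow> 'a \<Rightarrow> 'a \<Rightarrow> 'a \<Rightarrow> bool" where
  "touches A \<epsilon> z y v \<longleftrightarrow> y \<in> cap \<and> norm v = 1 \<and> y \<bullet> v = 0 \<and> M y v v < barrier A \<epsilon> z y \<and>
    (\<forall>y'\<in>cap. \<forall>v'. norm v' = 1 \<longrightarrow> y' \<bullet> v' = 0 \<longrightarrow> M y v v - barrier A \<epsilon> z y \<le> M y' v' v' - barrier A \<epsilon> z y')"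

lemma barrier_scale: "s > 0 \<Longrightarrow> barrier A \<epsilon> z (s *\<^sub>R y) = barrier A \<epsilon> z y"
  by (simp add: barrier_def)

text \<open>Removes the constraints from the minimum: the expression has degree 0 in
  \<open>y'\<close> and is quadratic in \<open>w\<close>, and its last factor is the squared length
  of the part of \<open>w\<close> orthogonal to \<open>y'\<close>. Straight lines in both arguments
  thereby become admissible test curves.\<close>

lemma touches_extend:
  assumes t: "touches A \<epsilon> z y v" and y': "y' \<noteq> 0" "c * norm y' \<le> y' \<bullet> b"
  shows "0 \<le> norm y' * M y' w w
    - (barrier A \<epsilon> z y' - (barrier A \<epsilon> z y - M y v v)) * (w \<bullet> w - (y' \<bullet> w)\<^sup>2 / (y' \<bullet> y'))"
proof -
  define n where "n = norm y'"
  define x where "x = y' /\<^sub>R n"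
  have n: "n > 0" using y' by (simp add: n_def)
  have y'x: "y' = n *\<^sub>R x" using n by (simp add: x_def)
  have nx: "norm x = 1" using n by (simp add: x_def n_def)
  have "c \<le> x \<bullet> b" using y'(2) n by (simp add: x_def n_def field_simps)
  hence x: "x \<in> cap" using nx by (simp add: cap_def)
  have xO: "x \<in> \<Omega>" by (rule cap_dom[OF x])
  have bil: "bilinear (M x)" by (rule M_bilinear[OF xO])
  have xx: "x \<bullet> x = 1" by (rule capD(4)[OF x])
  define w' where "w' = w - (x \<bullet> w) *\<^sub>R x"
  have xw: "x \<bullet> w' = 0" using xx by (simp add: w'_def inner_diff_right)
  have ww: "w' \<bullet> w' = w \<bullet> w - (x \<bullet> w)\<^sup>2"
    using xx inner_commute[of w x] by (simp add: w'_def inner_diff_left inner_diff_right power2_eq_square)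
  have r: "M x x u = 0" "M x u x = 0" for u using M_radial[OF xO] M_sym[OF xO, of u x] by auto
  have Mw: "M x w w = M x w' w'"
    using bil r by (simp add: w'_def bilinear_lsub bilinear_rsub bilinear_lmul bilinear_rmul)
  have ge: "(barrier A \<epsilon> z x - (barrier A \<epsilon> z y - M y v v)) * (w' \<bullet> w') \<le> M x w' w'"
  proof (cases "w' = 0")
    case True
    thus ?thesis using bil by (simp add: bilinear_lzero)
  next
    case False
    define u where "u = w' /\<^sub>R norm w'"
    have u: "norm u = 1" "x \<bullet> u = 0" using False xw by (auto simp: u_def)
    have "M y v v - barrier A \<epsilon> z y \<le> M x u u - barrier A \<epsilon> z x"
      using t x u unfolding touches_def by blast
    hence "barrier A \<epsilon> z x - (barrier A \<epsilon> z y - M y v v) \<le> M x u u" by simp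
    hence "(barrier A \<epsilon> z x - (barrier A \<epsilon> z y - M y v v)) * (w' \<bullet> w') \<le> M x u u * (w' \<bullet> w')"
      by (rule mult_right_mono) simp
    also have "M x u u * (w' \<bullet> w') = M x w' w'"
    proof -
      have w'u: "w' = norm w' *\<^sub>R u" using False by (simp add: u_def)
      have "M x w' w' = norm w' * (norm w' * M x u u)"
        by (subst w'u, subst (2) w'u) (simp only: bilinear_lmul[OF bil] bilinear_rmul[OF bil] real_scaleR_def)
      thus ?thesis by (simp add: power2_norm_eq_inner[symmetric] power2_eq_square)
    qed
    finally show ?thesis .
  qed
  have "norm y' * M y' w w = n * M (n *\<^sub>R x) w w" by (simp only: n_def[symmetric] y'x[symmetric])
  also have "\<dots> = M x w w" using M_scale[OF n xO, of w w] n by simp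
  finally have "norm y' * M y' w w = M x w w" .
  moreover have "barrier A \<epsilon> z y' = barrier A \<epsilon> z x" unfolding y'x by (rule barrier_scale[OF n])
  moreover have "w \<bullet> w - (y' \<bullet> w)\<^sup>2 / (y' \<bullet> y') = w' \<bullet> w'"
    unfolding y'x ww using n xx by (simp add: power2_eq_square)
  ultimately show ?thesis using ge Mw by simp
qed

text \<open>For fixed base point, \<open>v\<close> minimises the form on the tangent space and is an
  eigenvector there; the radial direction is in the kernel, so \<open>v\<close> is an eigenvector on
  the whole space.\<close>

lemma touches_frame:
  assumes t: "touches A \<epsilon> z y v"
  obtains e where "frame y e" "e 1 = v"
proof -
  have y: "y \<in> cap" and v: "norm v = 1" "y \<bullet> v = 0" using t by (auto simp: touches_def)
  have yO: "y \<in> \<Omega>" by (rule cap_dom[OF y])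
  define S where "S = {x. y \<bullet> x = 0}"
  have S: "subspace S" unfolding S_def by (rule subspace_hyperplane)
  have R: "M y v x = M y v v * (v \<bullet> x)" if "x \<in> S" for x
  proof (rule rayleigh_min_eigen[OF M_bilinear[OF yO] M_sym[OF yO] S _ v(1) _ that])
    show "v \<in> S" using v by (simp add: S_def)
    fix u assume "u \<in> S" "norm u = 1"
    hence "M y v v - barrier A \<epsilon> z y \<le> M y u u - barrier A \<epsilon> z y"
      using t y unfolding touches_def S_def by blast
    thus "M y v v \<le> M y u u" by simp
  qed
  have eig: "M y v x = M y v v * (v \<bullet> x)" for x
  proof -
    let ?x = "x - (y \<bullet> x) *\<^sub>R y"
    have l: "linear (M y v)" by (rule M_linear[OF yO])
    have "?x \<in> S" using capD(4)[OF y] by (simp add: S_def inner_diff_right)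
    from R[OF this] have "M y v x - (y \<bullet> x) * M y v y = M y v v * (v \<bullet> x - (y \<bullet> x) * (v \<bullet> y))"
      by (simp only: linear_diff[OF l] linear_scale[OF l] inner_diff_right inner_scaleR_right real_scaleR_def)
    moreover have "M y v y = 0" using M_radial[OF yO, of v] M_sym[OF yO, of v y] by simp
    moreover have "v \<bullet> y = 0" using v(2) by (simp add: inner_commute)
    ultimately show ?thesis by simp
  qed
  show ?thesis by (rule frame_extend[OF y v eig]) (rule that)
qed

text \<open>The test curve is \<open>(y + t *R e a, v + t *R w)\<close>. The freedom in
  \<open>w\<close> is what yields the sum of squares on the left: \<open>w\<close> enters the second
  derivative through \<open>4 * T y v w (e a) + 2 * M y w w\<close>, and a nearly optimal
  \<open>w\<close> is inserted.\<close>

lemma touches_second_order: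
  assumes t: "touches A \<epsilon> z y v" and int: "c < y \<bullet> b" and e: "frame y e" "e 1 = v"
    and a: "1 \<le> a" "a < DIM('a)" and \<eta>: "\<eta> > 0"
  shows "T y v v (e a) = barrier A \<epsilon> z y * (A * (z \<bullet> e a))"
    and "2 * (\<Sum>i\<in>{2..<DIM('a)}. (T y (e i) (e a) v)\<^sup>2 / (M y (e i) (e i) + \<eta>))
      \<le> Q y v v (e a) (e a) + M y v v * (1 + 2 * (if a = 1 then 1 else 0))
        - barrier A \<epsilon> z y * ((A * (z \<bullet> e a))\<^sup>2 - A * (z \<bullet> y))"
proof -
  have y: "y \<in> cap" and v: "norm v = 1" "y \<bullet> v = 0" using t by (auto simp: touches_def)
  have yO: "y \<in> \<Omega>" by (rule cap_dom[OF y])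
  have yy: "y \<bullet> y = 1" by (rule capD(4)[OF y])
  have vv: "v \<bullet> v = 1" using v by (simp add: norm_eq_1)
  define l where "l i = M y (e i) (e i)" for i
  define X where "X i = T y (e i) (e a) v" for i
  \<comment> \<open>The minimiser of \<open>4 * W i * X i + 2 * (W i)^2 * l i\<close> would be
    \<open>- X i / l i\<close>; the shift keeps it meaningful when \<open>l i = 0\<close>.\<close>
  define W where "W i = - X i / (l i + \<eta>)" for i
  \<comment> \<open>Leaving out the indices 0 and 1 makes \<open>w\<close> orthogonal to
    \<open>y\<close> and to \<open>v\<close>, so that \<open>M y v w\<close> and
    \<open>v \<bullet> w\<close> vanish.\<close>
  define I where "I = {2..<DIM('a)}"
  have I: "finite I" "\<And>i. i \<in> I \<Longrightarrow> i < DIM('a) \<and> i \<noteq> 0 \<and> i \<noteq> 1" by (auto simp: I_def)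
  have d1: "1 < DIM('a)" using a by linarith
  define w where "w = (\<Sum>i\<in>I. W i *\<^sub>R e i)"
  have l0: "l i \<ge> 0" if "i < DIM('a)" for i unfolding l_def by (rule frame_eig_nonneg[OF y e(1) that])
  have wi: "e j \<bullet> w = (if j \<in> I then W j else 0)" if "j < DIM('a)" for j
  proof -
    have "e j \<bullet> w = (\<Sum>i\<in>I. if j = i then W i else 0)"
      unfolding w_def inner_sum_right using that I
      by (intro sum.cong refl) (simp add: frameD(4)[OF e(1)])
    thus ?thesis using I(1) by simp
  qed
  have yw: "y \<bullet> w = 0" using wi[of 0] frameD(2)[OF e(1)] d1 I(2)[of 0] by auto
  have vw: "v \<bullet> w = 0" using wi[of 1] e(2) d1 I(2)[of 1] by auto
  have linM: "linear (M y u)" for u by (rule M_linear[OF yO])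
  have Mvw: "M y v w = 0" using frameD(3)[OF e(1) d1, of w] e(2) vw by simp
  have ww: "w \<bullet> w = (\<Sum>i\<in>I. (W i)\<^sup>2)"
  proof -
    have "w \<bullet> w = (\<Sum>i\<in>I. W i * (e i \<bullet> w))" by (subst w_def) (simp add: inner_sum_left)
    also have "\<dots> = (\<Sum>i\<in>I. (W i)\<^sup>2)" using wi I(2) by (intro sum.cong refl) (simp add: power2_eq_square)
    finally show ?thesis .
  qed
  have Mww: "M y w w = (\<Sum>i\<in>I. (W i)\<^sup>2 * l i)"
  proof -
    have "M y w w = (\<Sum>i\<in>I. W i * M y w (e i))"
      by (subst (2) w_def) (simp add: linear_sum[OF linM] linear_scale[OF linM])
    also have "\<dots> = (\<Sum>i\<in>I. (W i)\<^sup>2 * l i)"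
    proof (rule sum.cong[OF refl])
      fix i assume i: "i \<in> I"
      have "M y w (e i) = M y (e i) w" by (rule M_sym[OF yO])
      also have "\<dots> = l i * W i" using frameD(3)[OF e(1), of i w] wi[of i] I(2)[OF i] i by (simp add: l_def)
      finally show "W i * M y w (e i) = (W i)\<^sup>2 * l i" by (simp add: power2_eq_square)
    qed
    finally show ?thesis .
  qed
  have Tvw: "T y v w (e a) = (\<Sum>i\<in>I. W i * X i)"
  proof -
    have "T y v w (e a) = T y v (e a) w" by (rule T_perm23[OF yO])
    also have "\<dots> = (\<Sum>i\<in>I. W i * T y v (e a) (e i))"
      by (subst w_def) (simp add: linear_sum[OF T_linear[OF yO]] linear_scale[OF T_linear[OF yO]])
    also have "\<dots> = (\<Sum>i\<in>I. W i * X i)" unfolding X_def using T_perm13[OF yO] by simp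
    finally show ?thesis .
  qed
  have ea: "norm (e a) = 1" "y \<bullet> e a = 0" "e a \<bullet> e a = 1"
    using frameD(5)[OF e(1) a(2)] frameD(6)[OF e(1), of a] a by (auto simp: norm_eq_1)
  define \<delta> where "\<delta> = (if a = 1 then 1 else (0::real))"
  have av: "e a \<bullet> v = \<delta>" using frameD(4)[OF e(1) a(2) d1] e(2) by (simp add: \<delta>_def)
  define wa where "wa = e a \<bullet> w"
  define \<phi> where "\<phi> = barrier A \<epsilon> z y"
  define \<mu> where "\<mu> = \<phi> - M y v v"
  define \<zeta> where "\<zeta> = z \<bullet> e a"
  define \<psi> where "\<psi> = z \<bullet> y"
  have \<phi>: "\<phi> = \<epsilon> * exp (A * \<psi>)" using capD(1)[OF y] by (simp add: \<phi>_def barrier_def \<psi>_def)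
  \<comment> \<open>Along the test curve, \<open>S\<close> is the value of the form,
    \<open>N\<close> the norm of the base point, \<open>F\<close> the barrier, and \<open>P\<close>
    the squared length of the part of the moving vector orthogonal to the base point.\<close>
  define S where "S t = M (y + t *\<^sub>R e a) v v + (2 * (t * M (y + t *\<^sub>R e a) v w) + t * (t * M (y + t *\<^sub>R e a) w w))" for t
  define N where "N t = sqrt (1 + t\<^sup>2)" for t :: real
  define F where "F t = \<epsilon> * exp (A * ((\<psi> + t * \<zeta>) * inverse (N t)))" for t
  define P where "P t = 1 + (t * (t * (w \<bullet> w)) - t * (t * ((\<delta> + t * wa) * (\<delta> + t * wa) * inverse (1 + t * (t * 1)))))" for t :: real
  have jS: "jet2 S (M y v v) (T y v v (e a)) (Q y v v (e a) (e a) + (4 * T y v w (e a) + 2 * M y w w))"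
    unfolding S_def[abs_def]
    using jet2_add[OF jet_M[OF yO, of "e a" v v]
      jet2_add[OF jet2_cmult[OF jet2_t[OF jet_M[OF yO, of "e a" v w]], of 2] jet2_tt[OF jet_M[OF yO, of "e a" w w]]]]
    by (simp add: Mvw)
  have jN: "jet2 N 1 0 1" unfolding N_def[abs_def] by (rule jet2_sqrt1)
  have jNi: "jet2 (\<lambda>t. inverse (N t)) 1 0 (- 1)" using jet2_inverse[OF jN] by simp
  have jl: "jet2 (\<lambda>t. \<psi> + t * \<zeta>) \<psi> \<zeta> 0" using jet2_add[OF jet2_const[of \<psi>] jet2_t[OF jet2_const[of \<zeta>]]] by simp
  have jq: "jet2 (\<lambda>t. (\<psi> + t * \<zeta>) * inverse (N t)) \<psi> \<zeta> (- \<psi>)" using jet2_mult[OF jl jNi] by simp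
  have jF: "jet2 F \<phi> (\<phi> * (A * \<zeta>)) (\<phi> * ((A * \<zeta>)\<^sup>2 - A * \<psi>))"
    unfolding F_def[abs_def] using jet2_cmult[OF jet2_exp[OF jet2_cmult[OF jq, of A]], of \<epsilon>]
    by (simp add: \<phi> mult.assoc)
  have jP: "jet2 P 1 0 (2 * (w \<bullet> w) - 2 * (\<delta> * \<delta>))"
  proof -
    have j1: "jet2 (\<lambda>t. \<delta> + t * wa) \<delta> wa 0" using jet2_add[OF jet2_const[of \<delta>] jet2_t[OF jet2_const[of wa]]] by simp
    have j2: "jet2 (\<lambda>t. 1 + t * (t * 1)) 1 0 2" using jet2_add[OF jet2_const[of 1] jet2_tt[OF jet2_const[of 1]]] by simp
    show ?thesis unfolding P_def[abs_def]
      using jet2_add[OF jet2_const[of 1] jet2_diff[OF jet2_tt[OF jet2_const[of "w \<bullet> w"]]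
        jet2_tt[OF jet2_mult[OF jet2_mult[OF j1 j1] jet2_inverse[OF j2]]]]] by simp
  qed
  have J: "jet2 (\<lambda>t. N t * S t - (F t - \<mu>) * P t) 0 (T y v v (e a) - \<phi> * (A * \<zeta>))
     ((M y v v + (Q y v v (e a) (e a) + (4 * T y v w (e a) + 2 * M y w w)))
      - (\<phi> * ((A * \<zeta>)\<^sup>2 - A * \<psi>) + M y v v * (2 * (w \<bullet> w) - 2 * (\<delta> * \<delta>))))"
    using jet2_diff[OF jet2_mult[OF jN jS] jet2_mult[OF jet2_diff[OF jF jet2_const[of \<mu>]] jP]] by (simp add: \<mu>_def)
  have ev: "\<forall>\<^sub>F t in nhds 0. 0 \<le> N t * S t - (F t - \<mu>) * P t"
    using interior_eventually[OF y int, of "e a"]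
  proof eventually_elim
    case (elim t)
    let ?y = "y + t *\<^sub>R e a" and ?v = "v + t *\<^sub>R w"
    have yt: "?y \<bullet> ?y = 1 + t * (t * 1)"
      using yy ea inner_commute[of "e a" y] by (simp add: inner_add_left inner_add_right)
    have ny: "norm ?y = N t" using yt by (simp add: norm_eq_sqrt_inner N_def power2_eq_square)
    have O: "?y \<in> \<Omega>" using cone_sub elim by blast
    have bil: "bilinear (M ?y)" by (rule M_bilinear[OF O])
    have MS: "M ?y ?v ?v = S t"
      using bil M_sym[OF O, of w v]
      by (simp add: bilinear_ladd bilinear_radd bilinear_lmul bilinear_rmul S_def algebra_simps)
    have vt: "?v \<bullet> ?v = 1 + t * (t * (w \<bullet> w))"
      using vv vw inner_commute[of w v] by (simp add: inner_add_left inner_add_right)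
    have yv: "?y \<bullet> ?v = t * (\<delta> + t * wa)"
      using v yw av by (simp add: inner_add_left inner_add_right wa_def distrib_left)
    have "?v \<bullet> ?v - (?y \<bullet> ?v)\<^sup>2 / (?y \<bullet> ?y) = P t"
      unfolding vt yv yt P_def by (simp add: power2_eq_square divide_inverse mult.assoc mult.left_commute)
    moreover have "barrier A \<epsilon> z ?y = F t"
      by (simp add: barrier_def ny F_def \<psi>_def \<zeta>_def inner_add_right divide_inverse)
    moreover have "0 \<le> norm ?y * M ?y ?v ?v - (barrier A \<epsilon> z ?y - (barrier A \<epsilon> z y - M y v v)) * (?v \<bullet> ?v - (?y \<bullet> ?v)\<^sup>2 / (?y \<bullet> ?y))"
      using touches_extend[OF t, of ?y ?v] elim by blast
    ultimately show ?case by (simp only: ny MS \<mu>_def \<phi>_def)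
  qed
  have first: "T y v v (e a) - \<phi> * (A * \<zeta>) = 0" by (rule jet2_min(1)[OF J ev])
  have second: "0 \<le> (M y v v + (Q y v v (e a) (e a) + (4 * T y v w (e a) + 2 * M y w w)))
      - (\<phi> * ((A * \<zeta>)\<^sup>2 - A * \<psi>) + M y v v * (2 * (w \<bullet> w) - 2 * (\<delta> * \<delta>)))" by (rule jet2_min(2)[OF J ev])
  show "T y v v (e a) = barrier A \<epsilon> z y * (A * (z \<bullet> e a))" using first by (simp add: \<phi>_def \<zeta>_def)
  have Mv: "M y v v \<ge> 0" using l0[OF d1] e(2) by (simp add: l_def)
  \<comment> \<open>The square is completed index by index. \<open>M y v v >= 0\<close> discards the
    term from the length of \<open>w\<close>, and \<open>l i <= l i + \<eta>\<close> absorbs the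
    shift.\<close>
  have "4 * T y v w (e a) + 2 * M y w w - M y v v * (2 * (w \<bullet> w)) = (\<Sum>i\<in>I. 4 * (W i * X i) + 2 * ((W i)\<^sup>2 * l i) - M y v v * (2 * (W i)\<^sup>2))"
    unfolding Tvw Mww ww by (simp only: sum_distrib_left sum.distrib sum_subtractf)
  also have "\<dots> \<le> (\<Sum>i\<in>I. - (2 * ((X i)\<^sup>2 / (l i + \<eta>))))"
  proof (rule sum_mono)
    fix i assume i: "i \<in> I"
    have li: "l i + \<eta> > 0" using l0[of i] I(2)[OF i] \<eta> by (auto intro: add_nonneg_pos)
    have 1: "W i * X i = - ((X i)\<^sup>2 / (l i + \<eta>))" by (simp add: W_def power2_eq_square)
    have 2: "(W i)\<^sup>2 * (l i + \<eta>) = (X i)\<^sup>2 / (l i + \<eta>)"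
      using li by (simp add: W_def power_divide power2_eq_square)
    have "(W i)\<^sup>2 * l i \<le> (W i)\<^sup>2 * (l i + \<eta>)" using \<eta> by (intro mult_left_mono) auto
    moreover have "0 \<le> M y v v * (2 * (W i)\<^sup>2)" using Mv by simp
    ultimately show "4 * (W i * X i) + 2 * ((W i)\<^sup>2 * l i) - M y v v * (2 * (W i)\<^sup>2) \<le> - (2 * ((X i)\<^sup>2 / (l i + \<eta>)))"
      unfolding 1 2 by linarith
  qed
  also have "\<dots> = - (2 * (\<Sum>i\<in>I. (X i)\<^sup>2 / (l i + \<eta>)))" by (simp only: sum_negf sum_distrib_left)
  finally have "4 * T y v w (e a) + 2 * M y w w - M y v v * (2 * (w \<bullet> w)) \<le> - (2 * (\<Sum>i\<in>I. (X i)\<^sup>2 / (l i + \<eta>)))" .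
  moreover have "M y v v * (1 + 2 * (if a = 1 then 1 else 0)) = M y v v + M y v v * (2 * (\<delta> * \<delta>))"
    by (simp add: \<delta>_def)
  moreover have "M y v v * (2 * (w \<bullet> w) - 2 * (\<delta> * \<delta>)) = M y v v * (2 * (w \<bullet> w)) - M y v v * (2 * (\<delta> * \<delta>))"
    by (rule right_diff_distrib)
  ultimately show "2 * (\<Sum>i\<in>{2..<DIM('a)}. (T y (e i) (e a) v)\<^sup>2 / (M y (e i) (e i) + \<eta>))
      \<le> Q y v v (e a) (e a) + M y v v * (1 + 2 * (if a = 1 then 1 else 0))
        - barrier A \<epsilon> z y * ((A * (z \<bullet> e a))\<^sup>2 - A * (z \<bullet> y))"
    using second unfolding I_def X_def l_def \<phi>_def \<zeta>_def \<psi>_def by linarith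
qed

end

section \<open>Exclusion of touching\<close>

context capillary_cone
begin

definition uniform_consts :: "real \<Rightarrow> real \<Rightarrow> real \<Rightarrow> real \<Rightarrow> bool" where
  "uniform_consts c0 C0 B h0 \<longleftrightarrow> c0 > 0 \<and> C0 > 0 \<and> B \<ge> 0 \<and> h0 > 0 \<and> (\<forall>y\<in>cap. h0 \<le> H y \<and>
     (\<forall>u v w. \<bar>T y u v w\<bar> \<le> B * norm u * norm v * norm w) \<and>
     (\<forall>e. frame y e \<longrightarrow> (\<forall>i<DIM('a). c0 \<le> qd DIM('a) (int k) (int m) (\<lambda>i. M y (e i) (e i)) i \<and>
        qd DIM('a) (int k) (int m) (\<lambda>i. M y (e i) (e i)) i \<le> C0 \<and>
        (\<forall>j\<in>{k,m}. \<bar>dlog DIM('a) (int j) (\<lambda>i. M y (e i) (e i)) i\<bar> \<le> C0 \<and>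
          (\<forall>i'<DIM('a). \<bar>ddlog DIM('a) (int j) (\<lambda>i. M y (e i) (e i)) i i'\<bar> \<le> C0)))))"

text \<open>The summands come, in order, from \<open>M y v v / H y\<close> on the right side of the
  equation, from deleting rows in the two second derivatives, from deleting rows in the squared
  gradient term, and from the lower-order terms of the touching test.\<close>

definition interior_const :: "real \<Rightarrow> real \<Rightarrow> real \<Rightarrow> real" where
  "interior_const C0 B h0 = (p - 1) / h0 + 4 * (real DIM('a))\<^sup>2 * B * C0 * (1 + C0)
     + (real DIM('a) * C0) * (real DIM('a) * (2 * B * C0)) / real (k - m) + 4 * real DIM('a) * C0"

lemma inner_unit_le: "norm x = 1 \<Longrightarrow> norm y = 1 \<Longrightarrow> \<bar>x \<bullet> y\<bar> \<le> 1"
  using Cauchy_Schwarz_ineq2[of x y] by simp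

text \<open>The touching test supplies the correction terms that inverse concavity requires. Its
  fourth derivatives agree, after an exchange of slots, with those in the twice differentiated
  equation and cancel. The squared tangential gradient of the barrier, weighted by
  \<open>c0\<close>, is left against errors of order \<open>1 + A\<close>.\<close>

lemma interior_bound:
  assumes cs: "uniform_consts c0 C0 B h0" and t: "touches A \<epsilon> z y v" and z: "norm z = 1" and A: "A > 0"
    and \<epsilon>: "\<epsilon> > 0" and int: "c < y \<bullet> b"
  shows "A\<^sup>2 * c0 * (1 - (z \<bullet> y)\<^sup>2) \<le> interior_const C0 B h0 * (1 + A)"
proof -
  define n where "n = DIM('a)"
  have y: "y \<in> cap" and v: "norm v = 1" "y \<bullet> v = 0" using t by (auto simp: touches_def)
  have yO: "y \<in> \<Omega>" by (rule cap_dom[OF y])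
  obtain e where e: "frame y e" "e 1 = v" using touches_frame[OF t] by blast
  have n1: "1 < n" "0 < n" using mk by (auto simp: n_def)
  define l where "l = (\<lambda>i. M y (e i) (e i))"
  define D where "D = qd n (int k) (int m) l"
  define X where "X = (\<lambda>i j. T y (e i) (e j) v)"
  define X' where "X' = cut {0,1} X"
  define \<kappa> where "\<kappa> = M y v v"
  define \<phi> where "\<phi> = barrier A \<epsilon> z y"
  define \<psi> where "\<psi> = z \<bullet> y"
  define Yq where "Yq i = Q y (e i) (e i) v v" for i
  \<comment> \<open>The touching test starts at index 1. The value 0 suffices for the radial index
    because that row is deleted from \<open>X'\<close>.\<close>
  define Y' where "Y' i = (if i = 0 then 0 else Q y v v (e i) (e i) + \<kappa> * (1 + 2 * (if i = 1 then 1 else 0))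
     - \<phi> * ((A * (z \<bullet> e i))\<^sup>2 - A * \<psi>))" for i
  \<comment> \<open>A common bound for \<open>M y v v\<close> and for the third derivatives with a
    radial or touching slot: the former is below \<open>\<phi>\<close>, and the first-order touching
    condition gives at most \<open>\<phi> * A\<close> for the latter.\<close>
  define s where "s = \<phi> * (1 + A)"
  have \<phi>: "\<phi> > 0" using \<epsilon> by (simp add: \<phi>_def barrier_def)
  have l0: "l i \<ge> 0" if "i < n" for i using frame_eig_nonneg[OF y e(1)] that by (simp add: l_def n_def)
  have \<kappa>0: "\<kappa> \<ge> 0" using l0[of 1] n1 e(2) by (simp add: l_def \<kappa>_def)
  have \<kappa>\<phi>: "\<kappa> < \<phi>" using t by (simp add: touches_def \<kappa>_def \<phi>_def)
  have \<phi>s: "\<phi> \<le> s" "\<phi> * A \<le> s" "0 \<le> s" using \<phi> A by (auto simp: s_def distrib_left)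
  have ea: "norm (e i) = 1" if "i < n" for i using frameD(5)[OF e(1)] that by (simp add: n_def)
  have cpos: "c0 > 0" "C0 > 0" "B \<ge> 0" "h0 > 0" using cs by (auto simp: uniform_consts_def)
  have hy: "h0 \<le> H y" and TB: "\<bar>T y u w x\<bar> \<le> B * norm u * norm w * norm x" for u w x
    using cs y unfolding uniform_consts_def by blast+
  have FR: "\<forall>i<n. c0 \<le> D i \<and> D i \<le> C0 \<and> (\<forall>j\<in>{k,m}. \<bar>dlog n (int j) l i\<bar> \<le> C0 \<and> (\<forall>i'<n. \<bar>ddlog n (int j) l i i'\<bar> \<le> C0))"
    using cs y e(1) unfolding uniform_consts_def D_def n_def l_def by blast
  have Db: "c0 \<le> D i" "D i \<le> C0" if "i < n" for i using FR that by blast+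
  have dl: "\<bar>dlog n (int j) l i\<bar> \<le> C0" if "i < n" "j \<in> {k,m}" for i j using FR that by blast
  have ddl: "\<bar>ddlog n (int j) l i i'\<bar> \<le> C0" if "i < n" "i' < n" "j \<in> {k,m}" for i i' j using FR that by blast
  have Xsym: "X i j = X j i" for i j unfolding X_def by (rule T_perm12[OF yO])
  have XB: "\<bar>X i j\<bar> \<le> B" if "i < n" "j < n" for i j
    using TB[of "e i" "e j" v] ea that v by (simp add: X_def)
  note so = touches_second_order[OF t int e]
  have X0: "\<bar>X 0 j\<bar> \<le> s" if j: "j < n" for j
  proof -
    have "X 0 j = - M y v (e j)" unfolding X_def frameD(2)[OF e(1)] by (rule T_radial[OF yO])
    also have "M y v (e j) = \<kappa> * (v \<bullet> e j)" using frameD(3)[OF e(1), of 1 "e j"] n1 e(2) by (simp add: n_def \<kappa>_def)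
    finally have "\<bar>X 0 j\<bar> = \<kappa> * \<bar>v \<bullet> e j\<bar>" using \<kappa>0 by (simp add: abs_mult)
    also have "\<dots> \<le> \<kappa> * 1" using inner_unit_le[OF v(1) ea[OF j]] \<kappa>0 by (rule mult_left_mono)
    finally show ?thesis using \<kappa>\<phi> \<phi>s by linarith
  qed
  have X1: "\<bar>X 1 j\<bar> \<le> s" if j: "j < n" for j
  proof (cases "j = 0")
    case True
    thus ?thesis using X0[OF n1(1)] Xsym[of 1 0] by simp
  next
    case False
    hence j1: "1 \<le> j" by simp
    have "X 1 j = T y v v (e j)" unfolding X_def e(2) by (rule T_perm23[OF yO])
    also have "\<dots> = \<phi> * (A * (z \<bullet> e j))" using so(1)[OF j1 _ zero_less_one_class.zero_less_one] j by (simp add: n_def \<phi>_def)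
    finally have "\<bar>X 1 j\<bar> = (\<phi> * A) * \<bar>z \<bullet> e j\<bar>" using \<phi> A by (simp add: abs_mult)
    also have "\<dots> \<le> (\<phi> * A) * 1" using inner_unit_le[OF z ea[OF j]] \<phi> A by (intro mult_left_mono) auto
    finally show ?thesis using \<phi>s by linarith
  qed
  have Xs: "\<bar>X i j\<bar> \<le> s" if "i < n" "j < n" "i \<in> {0,1} \<or> j \<in> {0,1}" for i j
    using that X0 X1 Xsym[of i 0] Xsym[of i 1] by auto
  have es: "es {..<n} (int k) l > 0" "es {..<n} (int m) l > 0"
    using frame_es[OF y e(1)] by (simp_all add: n_def l_def)
  have mk': "m < k" "k \<le> n" using mk by (auto simp: n_def)
  have Y'ge: "Y' a \<ge> 2 * (\<Sum>i<n. (X' a i)\<^sup>2 / (l i + \<eta>))" if a: "a < n" and \<eta>: "\<eta> > 0" for a \<eta>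
  proof (cases "a = 0")
    case True
    thus ?thesis by (simp add: X'_def cut_def Y'_def)
  next
    case False
    have li: "l i + \<eta> > 0" if "i < n" for i using l0[OF that] \<eta> by simp
    have "(\<Sum>i<n. (X' a i)\<^sup>2 / (l i + \<eta>)) = (\<Sum>i\<in>{2..<n}. (X' a i)\<^sup>2 / (l i + \<eta>))"
    proof (rule sum.mono_neutral_right)
      show "\<forall>i\<in>{..<n} - {2..<n}. (X' a i)\<^sup>2 / (l i + \<eta>) = 0"
      proof
        fix i assume "i \<in> {..<n} - {2..<n}"
        hence "i \<in> {0,1}" by auto
        thus "(X' a i)\<^sup>2 / (l i + \<eta>) = 0" by (simp add: X'_def cut_def)
      qed
    qed auto
    also have "\<dots> \<le> (\<Sum>i\<in>{2..<n}. (T y (e i) (e a) v)\<^sup>2 / (l i + \<eta>))"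
    proof (rule sum_mono)
      fix i assume i: "i \<in> {2..<n}"
      have "(X' a i)\<^sup>2 \<le> (T y (e i) (e a) v)\<^sup>2"
        using Xsym[of a i] by (auto simp: X'_def cut_def X_def)
      thus "(X' a i)\<^sup>2 / (l i + \<eta>) \<le> (T y (e i) (e a) v)\<^sup>2 / (l i + \<eta>)"
        using li[of i] i by (intro divide_right_mono) auto
    qed
    finally have "2 * (\<Sum>i<n. (X' a i)\<^sup>2 / (l i + \<eta>)) \<le> 2 * (\<Sum>i\<in>{2..<n}. (T y (e i) (e a) v)\<^sup>2 / (l i + \<eta>))" by simp
    also have "\<dots> \<le> Q y v v (e a) (e a) + M y v v * (1 + 2 * (if a = 1 then 1 else 0))
        - barrier A \<epsilon> z y * ((A * (z \<bullet> e a))\<^sup>2 - A * (z \<bullet> y))"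
      unfolding l_def n_def by (rule so(2)[OF _ _ \<eta>]) (use a False in \<open>auto simp: n_def\<close>)
    also have "\<dots> = Y' a" using False by (simp add: Y'_def \<kappa>_def \<phi>_def \<psi>_def)
    finally show ?thesis .
  qed
  have main: "(\<Sum>a<n. X' a a * D a)\<^sup>2 / real (k - m) \<le> qh n (int k) (int m) l X' + (\<Sum>a<n. D a * Y' a)"
    unfolding D_def
  proof (rule qh_limit_ineq[OF mk' _ es])
    show "X' i j = X' j i" for i j using Xsym[of i j] by (auto simp: X'_def cut_def)
  qed (use l0 Y'ge in auto)
  define \<omega> where "\<omega> = (\<Sum>a<n. X a a * D a)"
  define r where "r = dr v H y / H y"
  define g where "g = dr v G y / G y"
  note ie = interior_equation[OF y int e(1), of v, folded n_def, folded l_def, folded D_def]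
  have \<omega>: "\<omega> = (p - 1) * r - \<gamma> * g" using ie(1) by (simp add: \<omega>_def X_def r_def g_def)
  have Hy: "H y > 0" "G y > 0" using Hpos Gpos capD(1,2)[OF y] by auto
  have eq2: "(\<Sum>a<n. Yq a * D a) + qh n (int k) (int m) l X \<le> (p - 1) / h0 * \<kappa> + \<omega>\<^sup>2 / real (k - m)"
  proof -
    have "(\<Sum>a<n. Yq a * D a) + qh n (int k) (int m) l X
      = (p - 1) * (\<kappa> / H y - r\<^sup>2) - \<gamma> * (dr v (dr v G) y / G y - g\<^sup>2)"
      using ie(2) by (simp add: Yq_def X_def \<kappa>_def r_def g_def)
    moreover have "(p - 1) * (\<kappa> / H y) \<le> (p - 1) / h0 * \<kappa>"
    proof -
      have "\<kappa> / H y \<le> \<kappa> / h0" using hy cpos \<kappa>0 by (intro divide_left_mono) auto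
      hence "(p - 1) * (\<kappa> / H y) \<le> (p - 1) * (\<kappa> / h0)" using p by (intro mult_left_mono) auto
      thus ?thesis by simp
    qed
    moreover have "0 \<le> \<gamma> * (dr v (dr v G) y / G y)"
    proof -
      have "0 \<le> \<gamma>" using \<gamma> p by simp
      moreover have "0 \<le> dr v (dr v G) y" by (rule Gconv[OF capD(1)[OF y] capD(2)[OF y] v(2)])
      ultimately show ?thesis using Hy(2) by simp
    qed
    moreover have "- (p - 1) * r\<^sup>2 + \<gamma> * g\<^sup>2 \<le> \<omega>\<^sup>2 / real (k - m)" using structure_sign[OF \<omega>] by simp
    ultimately show ?thesis by (simp add: right_diff_distrib left_diff_distrib)
  qed
  have hc: "\<bar>qh n (int k) (int m) l X - qh n (int k) (int m) l X'\<bar> \<le> 2 * (s * (2 * (real n)\<^sup>2 * B * C0 * (1 + C0)))"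
  proof -
    have "\<bar>hess n (int j) l X - hess n (int j) l X'\<bar> \<le> s * (2 * (real n)\<^sup>2 * B * C0 * (1 + C0))" if "j \<in> {k,m}" for j
      unfolding X'_def
      by (rule hess_cut[OF XB Xs \<phi>s(3) cpos(3) dl[OF _ that] _ ddl[OF _ _ that]]) (use cpos in auto)
    from this[of k] this[of m] show ?thesis unfolding qh_def by simp
  qed
  have lc: "\<omega>\<^sup>2 / real (k - m) - (\<Sum>a<n. X' a a * D a)\<^sup>2 / real (k - m)
      \<le> s * ((real n * C0) * (real n * (2 * B * C0)) / real (k - m))"
  proof -
    have "\<bar>D i\<bar> \<le> C0" if "i < n" for i using Db[OF that] cpos by simp
    hence "\<bar>\<omega>\<^sup>2 - (\<Sum>a<n. X' a a * D a)\<^sup>2\<bar> \<le> (real n * (s * C0)) * (real n * (2 * B * C0))"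
      unfolding \<omega>_def X'_def using cpos by (intro linear_cut XB Xs \<phi>s(3)) auto
    hence "\<omega>\<^sup>2 - (\<Sum>a<n. X' a a * D a)\<^sup>2 \<le> s * ((real n * C0) * (real n * (2 * B * C0)))" by (simp add: ac_simps)
    hence "(\<omega>\<^sup>2 - (\<Sum>a<n. X' a a * D a)\<^sup>2) / real (k - m) \<le> s * ((real n * C0) * (real n * (2 * B * C0))) / real (k - m)"
      by (rule divide_right_mono) simp
    thus ?thesis by (simp add: diff_divide_distrib)
  qed
  define \<zeta> where "\<zeta> i = (if i = 0 then 0 else z \<bullet> e i)" for i :: nat
  \<comment> \<open>For \<open>i >= 1\<close> the fourth derivatives coincide by
    \<open>Q_pairs\<close>. For \<open>i = 0\<close> the equation contributes
    \<open>Yq 0 = 2 * \<kappa> >= 0\<close>, so replacing it by \<open>Y' 0 = 0\<close> goes in the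
    right direction.\<close>
  have trm: "D i * Y' i \<le> Yq i * D i + (3 * C0 * \<kappa> + \<phi> * A * C0) - \<phi> * (A\<^sup>2 * c0) * (\<zeta> i)\<^sup>2" if i: "i < n" for i
  proof (cases "i = 0")
    case True
    have "Yq 0 = - 2 * T y v y v" unfolding Yq_def frameD(2)[OF e(1)] by (rule Q_radial[OF yO])
    also have "T y v y v = T y y v v" by (rule T_perm12[OF yO])
    also have "\<dots> = - \<kappa>" unfolding \<kappa>_def by (rule T_radial[OF yO])
    finally have "Yq 0 * D 0 \<ge> 0" using \<kappa>0 Db(1)[OF n1(2)] cpos by simp
    moreover have "0 \<le> 3 * C0 * \<kappa> + \<phi> * A * C0" using cpos \<kappa>0 \<phi> A by simp
    ultimately show ?thesis using True by (simp add: Y'_def \<zeta>_def)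
  next
    case False
    have q: "Q y v v (e i) (e i) = Yq i" unfolding Yq_def by (rule Q_pairs[OF yO])
    have \<zeta>: "\<zeta> i = z \<bullet> e i" using False by (simp add: \<zeta>_def)
    have D0: "0 \<le> D i" using Db[OF i] cpos by linarith
    have "D i * Y' i = Yq i * D i + D i * (\<kappa> * (1 + 2 * (if i = 1 then 1 else 0))) + \<phi> * A * (D i * \<psi>) - \<phi> * (A\<^sup>2 * D i) * (\<zeta> i)\<^sup>2"
      using False by (simp add: Y'_def q \<zeta> algebra_simps power2_eq_square)
    moreover have "D i * (\<kappa> * (1 + 2 * (if i = 1 then 1 else 0))) \<le> C0 * (\<kappa> * 3)"
      using Db[OF i] D0 \<kappa>0 by (intro mult_mono mult_left_mono) auto
    moreover have "\<phi> * A * (D i * \<psi>) \<le> \<phi> * A * C0"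
    proof -
      have "\<psi> \<le> 1" using inner_unit_le[OF z capD(1)[OF y]] by (simp add: \<psi>_def)
      hence "D i * \<psi> \<le> D i * 1" using D0 by (rule mult_left_mono)
      hence "D i * \<psi> \<le> C0" using Db[OF i] by simp
      thus ?thesis using \<phi> A by (intro mult_left_mono) auto
    qed
    moreover have "\<phi> * (A\<^sup>2 * c0) * (\<zeta> i)\<^sup>2 \<le> \<phi> * (A\<^sup>2 * D i) * (\<zeta> i)\<^sup>2"
      using Db[OF i] \<phi> by (intro mult_right_mono mult_left_mono) auto
    ultimately show ?thesis by simp
  qed
  \<comment> \<open>The sum is the squared length of the tangential part of \<open>z\<close>, that
    is, of the gradient of \<open>z \<bullet> y\<close> on the sphere.\<close>
  have zsum: "(\<Sum>i<n. (\<zeta> i)\<^sup>2) = 1 - \<psi>\<^sup>2"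
  proof -
    have "1 = z \<bullet> z" using z by (simp add: norm_eq_1)
    also have "\<dots> = (\<Sum>i<n. (z \<bullet> e i) * (z \<bullet> e i))" unfolding n_def by (rule onb_parseval[OF frameD(1)[OF e(1)]])
    also have "\<dots> = (\<Sum>i<n. (\<zeta> i)\<^sup>2 + (if i = 0 then \<psi>\<^sup>2 else 0))"
      by (intro sum.cong refl) (auto simp: \<zeta>_def \<psi>_def frameD(2)[OF e(1)] power2_eq_square)
    also have "\<dots> = (\<Sum>i<n. (\<zeta> i)\<^sup>2) + \<psi>\<^sup>2" using n1 by (simp add: sum.distrib)
    finally show ?thesis by simp
  qed
  have "(\<Sum>a<n. D a * Y' a) \<le> (\<Sum>a<n. Yq a * D a + (3 * C0 * \<kappa> + \<phi> * A * C0) - \<phi> * (A\<^sup>2 * c0) * (\<zeta> a)\<^sup>2)"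
    by (rule sum_mono) (use trm in auto)
  also have "\<dots> = (\<Sum>a<n. Yq a * D a) + real n * (3 * C0 * \<kappa> + \<phi> * A * C0) - \<phi> * (A\<^sup>2 * c0) * (1 - \<psi>\<^sup>2)"
    by (simp add: sum.distrib sum_subtractf sum_distrib_left[symmetric] zsum)
  finally have DY: "(\<Sum>a<n. D a * Y' a) \<le> (\<Sum>a<n. Yq a * D a) + real n * (3 * C0 * \<kappa> + \<phi> * A * C0) - \<phi> * (A\<^sup>2 * c0) * (1 - \<psi>\<^sup>2)" .
  have nb: "real n * (3 * C0 * \<kappa> + \<phi> * A * C0) \<le> s * (4 * real n * C0)"
  proof -
    have "3 * C0 * \<kappa> \<le> 3 * C0 * s" using \<kappa>\<phi> \<phi>s cpos by (intro mult_left_mono) auto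
    moreover have "\<phi> * A * C0 \<le> s * C0" using \<phi>s cpos by (intro mult_right_mono) auto
    ultimately have "3 * C0 * \<kappa> + \<phi> * A * C0 \<le> 4 * C0 * s" by (simp add: algebra_simps)
    hence "real n * (3 * C0 * \<kappa> + \<phi> * A * C0) \<le> real n * (4 * C0 * s)" by (rule mult_left_mono) simp
    thus ?thesis by (simp add: ac_simps)
  qed
  have pb: "(p - 1) / h0 * \<kappa> \<le> s * ((p - 1) / h0)"
    using \<kappa>\<phi> \<phi>s p cpos by (subst mult.commute) (intro mult_right_mono, auto)
  have "\<phi> * (A\<^sup>2 * c0) * (1 - \<psi>\<^sup>2) \<le> s * ((p - 1) / h0) + 2 * (s * (2 * (real n)\<^sup>2 * B * C0 * (1 + C0)))
    + s * ((real n * C0) * (real n * (2 * B * C0)) / real (k - m)) + s * (4 * real n * C0)"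
  proof -
    \<comment> \<open>Pure bookkeeping: the fourth-derivative sum \<open>SYq\<close> and the
      gradient square \<open>W1\<close> are eliminated, while the uncut and cut second derivatives
      differ by \<open>E1\<close>.\<close>
    have gen: "P \<le> L2 + E1 + E2 + E3"
      if "W2 \<le> Q2 + SY" "SY \<le> SYq + n1 - P" "SYq + Q1 \<le> L1 + W1" "\<bar>Q1 - Q2\<bar> \<le> E1" "W1 - W2 \<le> E2" "n1 \<le> E3" "L1 \<le> L2"
      for P L1 L2 E1 E2 E3 W1 W2 Q1 Q2 SY SYq n1 :: real
      using that by linarith
    show ?thesis by (rule gen[OF main DY eq2 hc lc nb pb])
  qed
  also have "\<dots> = s * interior_const C0 B h0" by (simp add: interior_const_def n_def algebra_simps)
  finally have "\<phi> * (A\<^sup>2 * c0 * (1 - \<psi>\<^sup>2)) \<le> \<phi> * (interior_const C0 B h0 * (1 + A))" by (simp add: s_def ac_simps)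
  thus ?thesis unfolding \<psi>_def by (rule mult_left_le_imp_le[OF _ \<phi>])
qed

section \<open>Touching at the boundary\<close>

lemma inward:
  assumes y: "y \<in> cap" "y \<bullet> b = c" and t: "t \<ge> 0"
  shows "y + t *\<^sub>R b \<noteq> 0" "c * norm (y + t *\<^sub>R b) \<le> (y + t *\<^sub>R b) \<bullet> b"
proof -
  have bb: "b \<bullet> b = 1" using b by (simp add: norm_eq_1)
  have i: "(y + t *\<^sub>R b) \<bullet> b = c + t" using y(2) bb by (simp add: inner_add_left)
  show "y + t *\<^sub>R b \<noteq> 0"
  proof
    assume "y + t *\<^sub>R b = 0"
    hence "c + t = 0" using i by simp
    thus False using c t by simp
  qed
  have "norm (y + t *\<^sub>R b) \<le> 1 + t" using norm_triangle_ineq[of y "t *\<^sub>R b"] capD(1)[OF y(1)] b t by simp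
  hence "c * norm (y + t *\<^sub>R b) \<le> c * (1 + t)" using c by (intro mult_left_mono) auto
  also have "\<dots> \<le> c + t" using c t mult_right_mono[of c 1 t] by (simp add: distrib_left)
  finally show "c * norm (y + t *\<^sub>R b) \<le> (y + t *\<^sub>R b) \<bullet> b" using i by simp
qed

lemma norm_inward_DERIV:
  assumes "y \<in> cap" "y \<bullet> b = c"
  shows "((\<lambda>t. norm (y + t *\<^sub>R b)) has_real_derivative c) (at 0)"
proof -
  have "norm (y + t *\<^sub>R b) = sqrt (1 + 2 * c * t + t\<^sup>2)" for t
    using capD(4)[OF assms(1)] assms(2) b inner_commute[of b y]
    by (simp add: norm_eq_sqrt_inner inner_add_left inner_add_right power2_eq_square algebra_simps)
  moreover have "((\<lambda>t. sqrt (1 + 2 * c * t + t\<^sup>2)) has_real_derivative c) (at 0)"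
    by (auto intro!: derivative_eq_intros)
  ultimately show ?thesis by simp
qed

text \<open>The vector \<open>e 1\<close> is the inward conormal, the normalised tangential part of
  \<open>b\<close>; the other tangent vectors of the frame are tangent to the boundary, so
  \<open>boundary_third\<close> applies to them.\<close>

lemma boundary_frame:
  assumes y: "y \<in> cap" "y \<bullet> b = c"
  obtains e where "frame y e" "\<And>i. 2 \<le> i \<Longrightarrow> i < DIM('a) \<Longrightarrow> T y (e i) (e i) b = - c * M y (e 1) (e 1)"
proof -
  have yO: "y \<in> \<Omega>" by (rule cap_dom[OF y(1)])
  have bb: "b \<bullet> b = 1" using b by (simp add: norm_eq_1)
  have yy: "y \<bullet> y = 1" by (rule capD(4)[OF y(1)])
  have c2: "c\<^sup>2 < 1" using c by (simp add: power_less_one_iff abs_square_less_1)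
  define s where "s = sqrt (1 - c\<^sup>2)"
  have s: "s > 0" "s * s = 1 - c\<^sup>2" using c2 by (auto simp: s_def)
  define \<beta> where "\<beta> = (b - c *\<^sub>R y) /\<^sub>R s"
  have bs: "b = c *\<^sub>R y + s *\<^sub>R \<beta>" using s by (simp add: \<beta>_def)
  have y\<beta>: "y \<bullet> \<beta> = 0" using y(2) yy by (simp add: \<beta>_def inner_diff_right)
  have "(b - c *\<^sub>R y) \<bullet> (b - c *\<^sub>R y) = s * s"
    using y(2) bb yy s(2) inner_commute[of b y] by (simp add: inner_diff_left inner_diff_right power2_eq_square)
  hence "norm (b - c *\<^sub>R y) = s" using s(1) by (simp add: norm_eq_sqrt_inner)
  hence n\<beta>: "norm \<beta> = 1" using s(1) by (simp add: \<beta>_def)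
  have l: "linear (M y u)" for u by (rule M_linear[OF yO])
  have bil: "bilinear (M y)" by (rule M_bilinear[OF yO])
  have r: "M y y u = 0" "M y u y = 0" for u using M_radial[OF yO] M_sym[OF yO, of u y] by auto
  have Mb: "M y b u = s * M y \<beta> u" for u
    by (subst bs) (simp add: bilinear_ladd[OF bil] bilinear_lmul[OF bil] r)
  have eig: "M y \<beta> x = M y \<beta> \<beta> * (\<beta> \<bullet> x)" for x
  proof -
    define \<tau> where "\<tau> = x - (y \<bullet> x) *\<^sub>R y - (\<beta> \<bullet> x) *\<^sub>R \<beta>"
    have b\<beta>: "\<beta> \<bullet> \<beta> = 1" using n\<beta> by (simp add: norm_eq_1)
    have "y \<bullet> \<tau> = 0" "\<beta> \<bullet> \<tau> = 0" using yy y\<beta> b\<beta> inner_commute[of \<beta> y] by (simp_all add: \<tau>_def inner_diff_right)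
    moreover from this have "b \<bullet> \<tau> = 0" by (subst bs) (simp add: inner_add_left)
    ultimately have "M y b \<tau> = 0" using boundary_mixed[OF y] by blast
    hence "M y \<beta> \<tau> = 0" using Mb s(1) by simp
    moreover have "M y \<beta> \<tau> = M y \<beta> x - (y \<bullet> x) * M y \<beta> y - (\<beta> \<bullet> x) * M y \<beta> \<beta>"
      unfolding \<tau>_def by (simp only: linear_diff[OF l] linear_scale[OF l] real_scaleR_def)
    ultimately show ?thesis using r by (simp add: mult.commute)
  qed
  obtain e where e: "frame y e" "e 1 = \<beta>" using frame_extend[OF y(1) n\<beta> y\<beta> eig] by blast
  have Mbb: "M y b b = s * s * M y \<beta> \<beta>"
    using Mb[of b] Mb[of \<beta>] M_sym[OF yO, of \<beta> b] by simp
  show ?thesis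
  proof (rule that[OF e(1)])
    fix i assume i: "2 \<le> i" "i < DIM('a)"
    have "y \<bullet> e i = 0" using frameD(6)[OF e(1), of i] i by simp
    moreover have "\<beta> \<bullet> e i = 0" using frameD(4)[OF e(1), of 1 i] e(2) i by simp
    ultimately have "y \<bullet> e i = 0" "b \<bullet> e i = 0" "norm (e i) = 1"
      using frameD(5)[OF e(1) i(2)] by (simp_all add: bs inner_add_left)
    from boundary_third[OF y this] have "s * s * T y (e i) (e i) b = s * s * (- c * M y \<beta> \<beta>)"
      by (simp add: Mbb s(2))
    hence "T y (e i) (e i) b = - c * M y \<beta> \<beta>"
      by (rule mult_left_cancel[THEN iffD1, rotated]) (use s(1) in simp)
    thus "T y (e i) (e i) b = - c * M y (e 1) (e 1)" by (simp only: e(2))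
  qed
qed

text \<open>Moving inward, the difference to the barrier cannot decrease, while the barrier grows at
  rate at least \<open>\<phi> * A * (z \<bullet> b - c)\<close>. So the third derivative in a
  smallest eigendirection must be large. Tangentially to the boundary the Neumann identities forbid
  this, and in the conormal direction the equation differentiated along \<open>b\<close> bounds
  it.\<close>

lemma boundary_bound:
  assumes cs: "uniform_consts c0 C0 B h0" and t: "touches A \<epsilon> z y v" and z: "norm z = 1" "c < z \<bullet> b" and A: "A > 0"
    and \<epsilon>: "\<epsilon> > 0" and bd: "y \<bullet> b = c"
  shows "A * (z \<bullet> b - c) \<le> 1 + real DIM('a) * C0 / c0"
proof -
  define n where "n = DIM('a)"
  have y: "y \<in> cap" and v: "norm v = 1" "y \<bullet> v = 0" using t by (auto simp: touches_def)
  have yO: "y \<in> \<Omega>" by (rule cap_dom[OF y])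
  have n1: "1 < n" "0 < n" using mk by (auto simp: n_def)
  obtain e where e: "frame y e" and Te: "\<And>i. 2 \<le> i \<Longrightarrow> i < n \<Longrightarrow> T y (e i) (e i) b = - c * M y (e 1) (e 1)"
    using boundary_frame[OF y bd] unfolding n_def by blast
  define l where "l = (\<lambda>i. M y (e i) (e i))"
  define D where "D = qd n (int k) (int m) l"
  define \<kappa> where "\<kappa> = M y v v"
  define \<phi> where "\<phi> = barrier A \<epsilon> z y"
  define \<psi> where "\<psi> = z \<bullet> y"
  have \<phi>: "\<phi> > 0" using \<epsilon> by (simp add: \<phi>_def barrier_def)
  have \<kappa>\<phi>: "\<kappa> < \<phi>" using t by (simp add: touches_def \<kappa>_def \<phi>_def)
  have \<kappa>0: "\<kappa> \<ge> 0" unfolding \<kappa>_def by (rule psd[OF capD(1)[OF y] capD(2)[OF y] v(2)])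
  have cpos: "c0 > 0" "C0 > 0" using cs by (auto simp: uniform_consts_def)
  have Db: "c0 \<le> D i" "D i \<le> C0" if "i < n" for i
    using cs y e that unfolding uniform_consts_def D_def n_def l_def by blast+
  have ge: "\<kappa> \<le> l i" if "0 < i" "i < n" for i
  proof -
    have "norm (e i) = 1" "y \<bullet> e i = 0" using frameD(5)[OF e] frameD(6)[OF e] that by (auto simp: n_def)
    hence "M y v v - barrier A \<epsilon> z y \<le> M y (e i) (e i) - barrier A \<epsilon> z y"
      using t y unfolding touches_def by blast
    thus ?thesis by (simp add: l_def \<kappa>_def)
  qed
  have sumv: "(\<Sum>i<n. (v \<bullet> e i)\<^sup>2) = 1"
    using onb_parseval[OF frameD(1)[OF e], of v v] v(1) by (simp add: n_def norm_eq_1 power2_eq_square)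
  have v0: "v \<bullet> e 0 = 0" using v(2) frameD(2)[OF e] by (simp add: inner_commute)
  have Mvv: "\<kappa> = (\<Sum>i<n. (v \<bullet> e i)\<^sup>2 * l i)"
  proof -
    have "\<kappa> = M y v (\<Sum>i<n. (v \<bullet> e i) *\<^sub>R e i)" using onb_expand[OF frameD(1)[OF e], of v] by (simp add: \<kappa>_def n_def)
    also have "\<dots> = (\<Sum>i<n. (v \<bullet> e i) * M y v (e i))"
      by (simp add: linear_sum[OF M_linear[OF yO]] linear_scale[OF M_linear[OF yO]])
    also have "\<dots> = (\<Sum>i<n. (v \<bullet> e i)\<^sup>2 * l i)"
    proof (rule sum.cong[OF refl])
      fix i assume "i \<in> {..<n}"
      hence "M y (e i) v = l i * (e i \<bullet> v)" using frameD(3)[OF e, of i v] by (simp add: n_def l_def)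
      thus "(v \<bullet> e i) * M y v (e i) = (v \<bullet> e i)\<^sup>2 * l i"
        using M_sym[OF yO, of v "e i"] by (simp add: inner_commute power2_eq_square)
    qed
    finally show ?thesis .
  qed
  \<comment> \<open>\<open>v\<close> need not belong to this frame. Its value
    \<open>\<kappa>\<close> is a weighted mean of tangential eigenvalues that are all at least
    \<open>\<kappa>\<close>, so one of them equals \<open>\<kappa>\<close>.\<close>
  have "\<exists>a. 0 < a \<and> a < n \<and> l a = \<kappa>"
  proof (rule ccontr)
    assume "\<not> ?thesis"
    hence gt: "\<kappa> < l i" if "0 < i" "i < n" for i using ge[OF that] that by (metis order_le_less)
    have "(\<Sum>i<n. (v \<bullet> e i)\<^sup>2 * (l i - \<kappa>)) = 0"
      using Mvv sumv by (simp add: right_diff_distrib sum_subtractf sum_distrib_right[symmetric])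
    moreover have nn: "0 \<le> (v \<bullet> e i)\<^sup>2 * (l i - \<kappa>)" if "i \<in> {..<n}" for i
      using ge[of i] that v0 by (cases "i = 0") auto
    ultimately have z0: "\<forall>i\<in>{..<n}. (v \<bullet> e i)\<^sup>2 * (l i - \<kappa>) = 0"
      using sum_nonneg_eq_0_iff[of "{..<n}" "\<lambda>i. (v \<bullet> e i)\<^sup>2 * (l i - \<kappa>)"] by blast
    have "(v \<bullet> e i)\<^sup>2 = 0" if "i < n" for i
    proof (cases "i = 0")
      case True thus ?thesis using v0 by simp
    next
      case False
      hence "l i - \<kappa> \<noteq> 0" using gt[of i] that by simp
      thus ?thesis using z0 that by auto
    qed
    hence "(\<Sum>i<n. (v \<bullet> e i)\<^sup>2) = 0" by simp
    thus False using sumv by simp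
  qed
  then obtain a where a: "0 < a" "a < n" "l a = \<kappa>" by blast
  define x where "x = e a"
  have x: "x \<bullet> x = 1" "y \<bullet> x = 0" using frameD(4)[OF e, of a a] frameD(6)[OF e, of a] a by (auto simp: x_def n_def)
  define F where "F t = norm (y + t *\<^sub>R b) * M (y + t *\<^sub>R b) x x
    - (barrier A \<epsilon> z (y + t *\<^sub>R b) - (\<phi> - \<kappa>)) * (x \<bullet> x - ((y + t *\<^sub>R b) \<bullet> x)\<^sup>2 / ((y + t *\<^sub>R b) \<bullet> (y + t *\<^sub>R b)))" for t
  have F0: "F 0 = 0" using x capD(1)[OF y] a(3) by (simp add: F_def \<phi>_def l_def x_def)
  have Fge: "F t \<ge> 0" if "t \<ge> 0" for t
    unfolding F_def \<phi>_def \<kappa>_def by (rule touches_extend[OF t inward[OF y bd that]])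
  have N: "((\<lambda>t. norm (y + t *\<^sub>R b)) has_real_derivative c) (at 0)" by (rule norm_inward_DERIV[OF y bd])
  have D1: "((\<lambda>t. norm (y + t *\<^sub>R b) * M (y + t *\<^sub>R b) x x) has_real_derivative c * \<kappa> + T y x x b) (at 0)"
    using DERIV_mult[OF N jet2_DERIV[OF jet_M[OF yO, of b x x]]] capD(1)[OF y] a(3) by (simp add: l_def x_def)
  have D2: "((\<lambda>t. barrier A \<epsilon> z (y + t *\<^sub>R b)) has_real_derivative \<phi> * (A * (z \<bullet> b - c * \<psi>))) (at 0)"
  proof -
    have "((\<lambda>t. \<psi> + t * (z \<bullet> b)) has_real_derivative z \<bullet> b) (at 0)" by (auto intro!: derivative_eq_intros)
    from DERIV_divide[OF this N] have "((\<lambda>t. (\<psi> + t * (z \<bullet> b)) / norm (y + t *\<^sub>R b)) has_real_derivative z \<bullet> b - c * \<psi>) (at 0)"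
      using capD(1)[OF y] capD(3)[OF y] by (simp add: mult.commute)
    from DERIV_cmult[OF DERIV_fun_exp[OF DERIV_cmult[OF this, of A]], of \<epsilon>]
    have "((\<lambda>t. \<epsilon> * exp (A * ((\<psi> + t * (z \<bullet> b)) / norm (y + t *\<^sub>R b)))) has_real_derivative
        \<epsilon> * (exp (A * \<psi>) * (A * (z \<bullet> b - c * \<psi>)))) (at 0)"
      using capD(1)[OF y] by simp
    moreover have "\<epsilon> * (exp (A * \<psi>) * (A * (z \<bullet> b - c * \<psi>))) = \<phi> * (A * (z \<bullet> b - c * \<psi>))"
      using capD(1)[OF y] by (simp add: \<phi>_def barrier_def \<psi>_def)
    ultimately have "((\<lambda>t. \<epsilon> * exp (A * ((\<psi> + t * (z \<bullet> b)) / norm (y + t *\<^sub>R b)))) has_real_derivative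
        \<phi> * (A * (z \<bullet> b - c * \<psi>))) (at 0)" by (simp only:)
    thus ?thesis by (simp only: barrier_def \<psi>_def inner_add_right inner_scaleR_right real_scaleR_def)
  qed
  have D3: "((\<lambda>t. x \<bullet> x - ((y + t *\<^sub>R b) \<bullet> x)\<^sup>2 / ((y + t *\<^sub>R b) \<bullet> (y + t *\<^sub>R b))) has_real_derivative 0) (at 0)"
  proof -
    have s: "(y + t *\<^sub>R b) \<bullet> x = t * (b \<bullet> x)" for t using x(2) by (simp add: inner_add_left)
    have q: "(y + t *\<^sub>R b) \<bullet> (y + t *\<^sub>R b) = 1 + 2 * c * t + t * t" for t
      using capD(4)[OF y] bd b inner_commute[of b y] by (simp add: norm_eq_1 inner_add_left inner_add_right algebra_simps)
    show ?thesis unfolding s q by (auto intro!: derivative_eq_intros)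
  qed
  have "(F has_real_derivative (c * \<kappa> + T y x x b) - \<phi> * (A * (z \<bullet> b - c * \<psi>))) (at 0)"
  proof -
    have "((\<lambda>t. barrier A \<epsilon> z (y + t *\<^sub>R b) - (\<phi> - \<kappa>)) has_real_derivative \<phi> * (A * (z \<bullet> b - c * \<psi>)) - 0) (at 0)"
      by (intro DERIV_diff D2 DERIV_const)
    from DERIV_diff[OF D1 DERIV_mult[OF this D3]] show ?thesis
      unfolding F_def[abs_def] using x by simp
  qed
  from right_min_DERIV[OF this zero_less_one_class.zero_less_one] F0 Fge
  have ineq: "\<phi> * (A * (z \<bullet> b - c * \<psi>)) \<le> c * \<kappa> + T y x x b" by auto
  have "\<psi> \<le> 1" using inner_unit_le[OF z(1) capD(1)[OF y]] by (simp add: \<psi>_def)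
  hence "c * \<psi> \<le> c" using c mult_left_mono[of \<psi> 1 c] by simp
  hence lower: "\<phi> * (A * (z \<bullet> b - c)) \<le> \<phi> * (A * (z \<bullet> b - c * \<psi>))"
    using \<phi> A by (intro mult_left_mono) auto
  have lpos: "0 < \<phi> * (A * (z \<bullet> b - c))" using \<phi> A z(2) by simp
  \<comment> \<open>For an eigenvector tangent to the boundary,
    \<open>c * \<kappa> + T y x x b = c * (\<kappa> - l 1) <= 0\<close>, which contradicts the
    growth of the barrier.\<close>
  have a1: "a = 1"
  proof (rule ccontr)
    assume "a \<noteq> 1"
    hence "T y x x b = - c * l 1" using Te[of a] a by (simp add: x_def l_def)
    moreover have "c * \<kappa> \<le> c * l 1" using ge[of 1] n1 c by (intro mult_left_mono) auto
    ultimately show False using ineq lower lpos by simp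
  qed
  have l1: "l 1 = \<kappa>" using a(3) a1 by simp
  \<comment> \<open>The inward derivative of the equation. The Neumann condition removes the term
    with \<open>H\<close>, and \<open>dr b G y >= 0\<close> then makes the sum nonpositive.\<close>
  have "(\<Sum>i<n. T y (e i) (e i) b * D i) = (p - 1) * (dr b H y / H y) - \<gamma> * (dr b G y / G y)"
    unfolding D_def l_def n_def
  proof (rule right_eq_DERIV[OF jet2_DERIV[OF jet_eqn[OF y e, of b]] jet2_DERIV[OF jet_rhs[OF y, of b]] zero_less_one_class.zero_less_one])
    fix t :: real assume "0 \<le> t"
    from eqn[OF inward[OF y bd this] frameD(1)[OF e]]
    show "ln (esm DIM('a) (int k) (\<lambda>i j. M (y + t *\<^sub>R b) (e i) (e j))) - ln (esm DIM('a) (int m) (\<lambda>i j. M (y + t *\<^sub>R b) (e i) (e j)))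
      = (p - 1) * ln (H (y + t *\<^sub>R b)) - \<gamma> * ln (G (y + t *\<^sub>R b))" .
  qed
  moreover have "dr b H y = 0" by (rule Hbd[OF capD(1)[OF y] bd])
  moreover have "0 \<le> \<gamma> * (dr b G y / G y)"
    using Gbd[OF capD(1)[OF y] bd] Gpos[OF capD(1)[OF y] capD(2)[OF y]] \<gamma> p by simp
  ultimately have sum0: "(\<Sum>i<n. T y (e i) (e i) b * D i) \<le> 0" by simp
  have trm: "(if i = 1 then T y x x b * D 1 else 0) - c * \<kappa> * C0 \<le> T y (e i) (e i) b * D i" if i: "i < n" for i
  proof -
    have cl: "0 \<le> c * \<kappa> * C0" using c \<kappa>0 cpos by simp
    consider "i = 0" | "i = 1" | "2 \<le> i" by linarith
    thus ?thesis
    proof cases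
      case 1
      have "T y (e 0) (e 0) b = - M y b y" unfolding frameD(2)[OF e] by (rule T_radial[OF yO])
      also have "M y b y = 0" using M_radial[OF yO, of b] M_sym[OF yO, of b y] by simp
      finally show ?thesis using 1 cl by simp
    next
      case 2
      thus ?thesis using cl a1 by (simp add: x_def)
    next
      case 3
      have "c * \<kappa> * D i \<le> c * \<kappa> * C0" using Db[OF i] c \<kappa>0 by (intro mult_left_mono) auto
      thus ?thesis using 3 Te[OF 3 i] l1 by (simp add: l_def)
    qed
  qed
  have "(\<Sum>i<n. (if i = 1 then T y x x b * D 1 else 0) - c * \<kappa> * C0) \<le> (\<Sum>i<n. T y (e i) (e i) b * D i)"
    by (rule sum_mono) (use trm in auto)
  hence TD: "T y x x b * D 1 \<le> real n * (c * \<kappa> * C0)" using sum0 n1 by (simp add: sum_subtractf)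
  have TT: "T y x x b \<le> real n * (c * \<kappa> * C0) / c0"
  proof (cases "T y x x b \<le> 0")
    case True
    also have "0 \<le> real n * (c * \<kappa> * C0) / c0" using c \<kappa>0 cpos by simp
    finally show ?thesis .
  next
    case False
    hence "T y x x b * c0 \<le> T y x x b * D 1" using Db(1)[OF n1(1)] by (intro mult_left_mono) auto
    thus ?thesis using TD cpos by (simp add: pos_le_divide_eq)
  qed
  have "c * \<kappa> \<le> \<phi>"
  proof -
    have "c * \<kappa> \<le> 1 * \<kappa>" using c \<kappa>0 by (intro mult_right_mono) auto
    thus ?thesis using \<kappa>\<phi> by simp
  qed
  moreover have "real n * (c * \<kappa> * C0) / c0 \<le> \<phi> * (real n * C0 / c0)"
  proof -
    have "(c * \<kappa>) * (real n * C0 / c0) \<le> \<phi> * (real n * C0 / c0)"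
      using \<open>c * \<kappa> \<le> \<phi>\<close> cpos by (intro mult_right_mono) auto
    thus ?thesis by (simp add: ac_simps)
  qed
  ultimately have "\<phi> * (A * (z \<bullet> b - c)) \<le> \<phi> * (1 + real n * C0 / c0)"
    using ineq lower TT by (simp add: distrib_left)
  thus ?thesis unfolding n_def by (rule mult_left_le_imp_le[OF _ \<phi>])
qed

end

section \<open>Strict convexity\<close>

context capillary_cone
begin

definition unit_tangents :: "('a \<times> 'a) set" where
  "unit_tangents = {x. fst x \<in> cap \<and> norm (snd x) = 1 \<and> fst x \<bullet> snd x = 0}"

lemma compact_unit_tangents: "compact unit_tangents"
proof -
  have eq: "unit_tangents = (cap \<times> sphere 0 1) \<inter> {x. fst x \<bullet> snd x = 0}" by (auto simp: unit_tangents_def)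
  have cl: "closed {x :: 'a \<times> 'a. fst x \<bullet> snd x = 0}" by (intro closed_Collect_eq continuous_intros)
  show ?thesis unfolding eq by (rule compact_Int_closed[OF compact_Times[OF compact_cap compact_sphere] cl])
qed

lemma M_cont_tangents: "continuous_on unit_tangents (\<lambda>x. M (fst x) (snd x) (snd x))"
  by (rule continuous_on_subset[OF M_cont_pair]) (use cap_dom in \<open>auto simp: unit_tangents_def\<close>)

lemma closed_in_tangents:
  assumes "continuous_on unit_tangents f"
  shows "compact {x \<in> unit_tangents. f x \<le> (r :: real)}"
proof -
  have "closed unit_tangents" using compact_unit_tangents compact_imp_closed by blast
  hence "closed (unit_tangents \<inter> f -` {..r})"
    using continuous_on_closed_vimage[of unit_tangents f] assms by (metis Int_commute closed_atMost)
  moreover have "{x \<in> unit_tangents. f x \<le> r} = unit_tangents \<inter> (unit_tangents \<inter> f -` {..r})" by auto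
  ultimately show ?thesis using compact_unit_tangents compact_Int_closed by metis
qed

text \<open>At a minimum \<open>z\<close> on the cap, \<open>H - H z * norm\<close> is nonnegative
  on the cone and zero at \<open>z\<close>. The norm has tangential Hessian 1, so the form is at
  least \<open>H z > 0\<close> there. A boundary minimum is impossible, because the Neumann
  condition gives this function the inward derivative \<open>- H z * c < 0\<close>.\<close>

lemma H_min_point:
  obtains z where "z \<in> cap" "c < z \<bullet> b" "\<And>u. norm u = 1 \<Longrightarrow> z \<bullet> u = 0 \<Longrightarrow> M z u u > 0"
proof -
  have ne: "cap \<noteq> {}" using b_cap by blast
  have "continuous_on cap H" using Ck_continuous[OF CkH] cap_sub continuous_on_subset by blast
  then obtain z where z: "z \<in> cap" "\<And>y. y \<in> cap \<Longrightarrow> H z \<le> H y"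
    using continuous_attains_inf[OF compact_cap ne] by blast
  have Hz: "H z > 0" using Hpos[OF capD(1)[OF z(1)] capD(2)[OF z(1)]] .
  have ge: "H y - H z * norm y \<ge> 0" if y: "y \<noteq> 0" "c * norm y \<le> y \<bullet> b" for y
  proof -
    define x where "x = y /\<^sub>R norm y"
    have n: "norm y > 0" using y by simp
    have "c \<le> x \<bullet> b" using y n by (simp add: x_def field_simps)
    hence x: "x \<in> cap" using n by (simp add: cap_def x_def)
    have "H y = norm y * H x" using hom[OF n cap_dom[OF x]] n by (simp add: x_def)
    moreover have "norm y * H z \<le> norm y * H x" using z(2)[OF x] n by (intro mult_left_mono) auto
    ultimately show ?thesis by (simp add: mult.commute)
  qed
  have zO: "z \<in> \<Omega>" by (rule cap_dom[OF z(1)])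
  have int: "c < z \<bullet> b"
  proof (rule ccontr)
    assume "\<not> c < z \<bullet> b"
    hence bd: "z \<bullet> b = c" using capD(2)[OF z(1)] by simp
    have D: "((\<lambda>t. H (z + t *\<^sub>R b) - H z * norm (z + t *\<^sub>R b)) has_real_derivative dr b H z - H z * c) (at 0)"
      by (intro DERIV_diff DERIV_cmult jet2_DERIV[OF jet_H[OF zO]] norm_inward_DERIV[OF z(1) bd])
    have "0 \<le> dr b H z - H z * c"
    proof (rule right_min_DERIV[OF D zero_less_one_class.zero_less_one])
      fix t :: real assume "0 < t"
      hence "0 \<le> H (z + t *\<^sub>R b) - H z * norm (z + t *\<^sub>R b)" using ge[OF inward[OF z(1) bd]] by simp
      thus "H (z + 0 *\<^sub>R b) - H z * norm (z + 0 *\<^sub>R b) \<le> H (z + t *\<^sub>R b) - H z * norm (z + t *\<^sub>R b)"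
        using capD(1)[OF z(1)] by simp
    qed
    moreover have "dr b H z = 0" by (rule Hbd[OF capD(1)[OF z(1)] bd])
    moreover have "H z * c > 0" using Hz c by simp
    ultimately show False by simp
  qed
  have "M z u u > 0" if u: "norm u = 1" "z \<bullet> u = 0" for u
  proof -
    have uu: "u \<bullet> u = 1" using u by (simp add: norm_eq_1)
    have nz: "norm (z + t *\<^sub>R u) = sqrt (1 + t\<^sup>2)" for t
      using capD(4)[OF z(1)] u(2) uu inner_commute[of u z]
      by (simp add: norm_eq_sqrt_inner inner_add_left inner_add_right power2_eq_square)
    have J: "jet2 (\<lambda>t. H (z + t *\<^sub>R u) - H z * sqrt (1 + t\<^sup>2)) (H z - H z * 1) (dr u H z - H z * 0) (M z u u - H z * 1)"
      by (intro jet2_diff jet2_cmult jet2_sqrt1 jet_H zO)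
    have "\<forall>\<^sub>F t in nhds 0. H z - H z * 1 \<le> H (z + t *\<^sub>R u) - H z * sqrt (1 + t\<^sup>2)"
      using interior_eventually[OF z(1) int, of u]
    proof eventually_elim
      case (elim t)
      hence "0 \<le> H (z + t *\<^sub>R u) - H z * norm (z + t *\<^sub>R u)" by (intro ge) auto
      thus ?case by (simp add: nz)
    qed
    from jet2_min(2)[OF J this] show ?thesis using Hz by simp
  qed
  thus ?thesis using that z(1) int by blast
qed

lemma strict_convexity:
  assumes y0: "y0 \<in> cap" and v0: "v0 \<noteq> 0" "y0 \<bullet> v0 = 0"
  shows "M y0 v0 v0 > 0"
proof (rule ccontr)
  assume neg: "\<not> M y0 v0 v0 > 0"
  define u0 where "u0 = v0 /\<^sub>R norm v0"
  have bil0: "bilinear (M y0)" by (rule M_bilinear[OF cap_dom[OF y0]])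
  have "M y0 u0 u0 = M y0 v0 v0 / (norm v0)\<^sup>2"
    unfolding u0_def by (simp add: bilinear_lmul[OF bil0] bilinear_rmul[OF bil0] power2_eq_square divide_inverse)
  hence neg0: "M y0 u0 u0 \<le> 0" using neg by (simp add: divide_le_0_iff)
  have u0: "norm u0 = 1" "y0 \<bullet> u0 = 0" using v0 by (auto simp: u0_def)
  have p0: "(y0, u0) \<in> unit_tangents" using y0 u0 by (simp add: unit_tangents_def)
  obtain z where z: "z \<in> cap" "c < z \<bullet> b" "\<And>u. norm u = 1 \<Longrightarrow> z \<bullet> u = 0 \<Longrightarrow> M z u u > 0"
    using H_min_point by blast
  have nz: "norm z = 1" by (rule capD(1)[OF z(1)])
  let ?M = "\<lambda>x. M (fst x) (snd x) (snd x)"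
  define K0 where "K0 = {x \<in> unit_tangents. ?M x \<le> 0}"
  have K0: "compact K0" "K0 \<noteq> {}"
    unfolding K0_def by (rule closed_in_tangents[OF M_cont_tangents]) (use p0 neg0 in auto)
  have "continuous_on K0 (\<lambda>x. z \<bullet> fst x)" by (intro continuous_intros)
  \<comment> \<open>Among the degenerate pairs, one whose base point is closest to
    \<open>z\<close>.\<close>
  from continuous_attains_sup[OF K0 this] obtain x1 where x1: "x1 \<in> K0" "\<And>x. x \<in> K0 \<Longrightarrow> z \<bullet> fst x \<le> z \<bullet> fst x1" by blast
  have x1t: "fst x1 \<in> cap" "norm (snd x1) = 1" "fst x1 \<bullet> snd x1 = 0" "?M x1 \<le> 0" using x1 by (auto simp: K0_def unit_tangents_def)
  have "fst x1 \<noteq> z" using x1t z(3)[of "snd x1"] by auto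
  hence "0 < (z - fst x1) \<bullet> (z - fst x1)" by simp
  also have "\<dots> = 2 - 2 * (z \<bullet> fst x1)"
    using capD(4)[OF z(1)] capD(4)[OF x1t(1)] inner_commute[of z "fst x1"] by (simp add: inner_diff_left inner_diff_right)
  finally have lt1: "z \<bullet> fst x1 < 1" by simp
  \<comment> \<open>Halfway between 1 and the largest value of \<open>z \<bullet> y\<close> on the
    degenerate set, so that the closed region \<open>z \<bullet> y >= \<rho>\<close> is uniformly
    definite.\<close>
  define \<rho> where "\<rho> = (1 + z \<bullet> fst x1) / 2"
  have \<rho>: "\<rho> < 1" "z \<bullet> fst x1 < \<rho>" using lt1 by (auto simp: \<rho>_def)
  define K1 where "K1 = {x \<in> unit_tangents. - (z \<bullet> fst x) \<le> - \<rho>}"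
  have K1: "compact K1" unfolding K1_def by (rule closed_in_tangents) (intro continuous_intros)
  have K1pos: "?M x > 0" if "x \<in> K1" for x
  proof (rule ccontr)
    assume "\<not> ?M x > 0"
    hence "x \<in> K0" using that by (simp add: K0_def K1_def)
    from x1(2)[OF this] show False using that \<rho> by (simp add: K1_def)
  qed
  have "\<exists>\<delta>>0. \<forall>x\<in>K1. \<delta> \<le> ?M x"
  proof (cases "K1 = {}")
    case True thus ?thesis by (intro exI[of _ 1]) auto
  next
    case False
    have "continuous_on K1 ?M" by (rule continuous_on_subset[OF M_cont_tangents]) (auto simp: K1_def)
    from continuous_attains_inf[OF K1 False this] show ?thesis using K1pos by blast
  qed
  then obtain \<delta> where \<delta>: "\<delta> > 0" "\<And>x. x \<in> K1 \<Longrightarrow> \<delta> \<le> ?M x" by blast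
  obtain c0 C0 B h0 where cs: "uniform_consts c0 C0 B h0"
    using constants unfolding uniform_consts_def[symmetric] by blast
  have c0: "c0 > 0" using cs by (simp add: uniform_consts_def)
  define K where "K = interior_const C0 B h0"
  \<comment> \<open>A lower bound for \<open>(1 - z \<bullet> y) * (1 + z \<bullet> y)\<close> at
    touching points: the first factor is at least \<open>1 - \<rho>\<close>, the second at least
    \<open>2 * c^2\<close>.\<close>
  define q where "q = (1 - \<rho>) * (2 * c\<^sup>2)"
  have q: "q > 0" using \<rho> c by (simp add: q_def)
  define w where "w = z \<bullet> b - c"
  have w: "w > 0" using z(2) by (simp add: w_def)
  \<comment> \<open>The second summand violates \<open>interior_bound\<close>, the third violates
    \<open>boundary_bound\<close>, and the leading 1 gives \<open>1 + A <= 2 * A\<close>.\<close>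
  define A where "A = 1 + 2 * \<bar>K\<bar> / (c0 * q) + \<bar>1 + real DIM('a) * C0 / c0\<bar> / w"
  have t1: "0 \<le> 2 * \<bar>K\<bar> / (c0 * q)" and t2: "0 \<le> \<bar>1 + real DIM('a) * C0 / c0\<bar> / w"
    using c0 q w by auto
  have A1: "A \<ge> 1" and A2: "2 * \<bar>K\<bar> / (c0 * q) < A" and A3: "\<bar>1 + real DIM('a) * C0 / c0\<bar> / w < A"
    using t1 t2 by (auto simp: A_def)
  have A: "A > 0" using A1 by simp
  \<comment> \<open>Since \<open>z \<bullet> y <= 1\<close>, this keeps the barrier at most
    \<open>\<delta>\<close> on the cap, so touching cannot occur in the definite region around
    \<open>z\<close>.\<close>
  define \<epsilon> where "\<epsilon> = \<delta> * exp (- A)"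
  have \<epsilon>: "\<epsilon> > 0" using \<delta> by (simp add: \<epsilon>_def)
  let ?f = "\<lambda>x. ?M x - barrier A \<epsilon> z (fst x)"
  have "continuous_on unit_tangents (\<lambda>x. barrier A \<epsilon> z (fst x))"
    unfolding barrier_def by (intro continuous_intros) (use capD(3) in \<open>auto simp: unit_tangents_def\<close>)
  hence "continuous_on unit_tangents ?f" by (intro continuous_on_diff M_cont_tangents)
  moreover have "unit_tangents \<noteq> {}" using p0 by blast
  ultimately obtain x where x: "x \<in> unit_tangents" "\<And>x'. x' \<in> unit_tangents \<Longrightarrow> ?f x \<le> ?f x'"
    using continuous_attains_inf[OF compact_unit_tangents] by blast
  define y where "y = fst x"
  define v where "v = snd x"
  have xyv: "y \<in> cap" "norm v = 1" "y \<bullet> v = 0" using x(1) by (auto simp: y_def v_def unit_tangents_def)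
  have bpos: "barrier A \<epsilon> z y' > 0" for y' using \<epsilon> by (simp add: barrier_def)
  have fneg: "?f x < 0" using x(2)[OF p0] neg0 bpos[of y0] by simp
  have touch: "touches A \<epsilon> z y v"
    unfolding touches_def
  proof (intro conjI ballI allI impI)
    show "M y v v < barrier A \<epsilon> z y" using fneg by (simp add: y_def v_def)
    fix y' v' assume "y' \<in> cap" "norm v' = 1" "y' \<bullet> v' = 0"
    hence "(y', v') \<in> unit_tangents" by (simp add: unit_tangents_def)
    from x(2)[OF this] show "M y v v - barrier A \<epsilon> z y \<le> M y' v' v' - barrier A \<epsilon> z y'" by (simp add: y_def v_def)
  qed (fact xyv)+
  have \<psi>1: "z \<bullet> y \<le> 1" using inner_unit_le[OF nz capD(1)[OF xyv(1)]] by simp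
  have \<psi>\<rho>: "z \<bullet> y < \<rho>"
  proof (rule ccontr)
    assume "\<not> z \<bullet> y < \<rho>"
    hence "x \<in> K1" using x(1) by (simp add: K1_def y_def)
    hence "\<delta> \<le> M y v v" using \<delta>(2) by (simp add: y_def v_def)
    moreover have "barrier A \<epsilon> z y \<le> \<delta>"
    proof -
      have "exp (A * (z \<bullet> y)) \<le> exp A" using \<psi>1 A by (simp add: mult_le_cancel_left2)
      hence "\<epsilon> * exp (A * (z \<bullet> y)) \<le> \<epsilon> * exp A" using \<epsilon> by (intro mult_left_mono) auto
      also have "\<epsilon> * exp A = \<delta>" by (simp add: \<epsilon>_def exp_minus)
      finally show ?thesis using capD(1)[OF xyv(1)] by (simp add: barrier_def)
    qed
    ultimately show False using fneg by (simp add: y_def v_def)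
  qed
  show False
  proof (cases "c < y \<bullet> b")
    case True
    have lower: "q \<le> 1 - (z \<bullet> y)\<^sup>2"
    proof -
      \<comment> \<open>Two points of the cap both have inner product at least \<open>c\<close> with
        \<open>b\<close>, so they are quantitatively far from antipodal.\<close>
      have "2 * c \<le> (z + y) \<bullet> b" using z(2) True by (simp add: inner_add_left)
      also have "\<dots> \<le> norm (z + y) * norm b" by (rule norm_cauchy_schwarz)
      finally have "2 * c \<le> norm (z + y)" using b by simp
      hence "(2 * c)\<^sup>2 \<le> (norm (z + y))\<^sup>2" using c by (intro power_mono) auto
      also have "\<dots> = 2 + 2 * (z \<bullet> y)"
        using capD(4)[OF z(1)] capD(4)[OF xyv(1)] inner_commute[of z y]
        by (simp add: power2_norm_eq_inner inner_add_left inner_add_right)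
      finally have "2 * c\<^sup>2 \<le> 1 + z \<bullet> y" by (simp add: power2_eq_square)
      hence "(1 - \<rho>) * (2 * c\<^sup>2) \<le> (1 - z \<bullet> y) * (1 + z \<bullet> y)"
        using \<psi>\<rho> \<rho> \<psi>1 by (intro mult_mono) auto
      thus ?thesis by (simp add: q_def power2_eq_square algebra_simps)
    qed
    have "A\<^sup>2 * c0 * q \<le> A\<^sup>2 * c0 * (1 - (z \<bullet> y)\<^sup>2)" using lower c0 by (intro mult_left_mono) auto
    also have "\<dots> \<le> K * (1 + A)" unfolding K_def by (rule interior_bound[OF cs touch nz A \<epsilon> True])
    also have "\<dots> \<le> \<bar>K\<bar> * (2 * A)" using A1 by (intro mult_mono) auto
    finally have "A * (A * (c0 * q)) \<le> A * (2 * \<bar>K\<bar>)" by (simp add: power2_eq_square ac_simps)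
    hence "A * (c0 * q) \<le> 2 * \<bar>K\<bar>" by (rule mult_left_le_imp_le[OF _ A])
    moreover have "2 * \<bar>K\<bar> < A * (c0 * q)" using A2 c0 q by (simp add: pos_divide_less_eq)
    ultimately show False by simp
  next
    case False
    hence bd: "y \<bullet> b = c" using capD(2)[OF xyv(1)] by simp
    have "A * w \<le> 1 + real DIM('a) * C0 / c0"
      unfolding w_def by (rule boundary_bound[OF cs touch nz z(2) A \<epsilon> bd])
    moreover have "\<bar>1 + real DIM('a) * C0 / c0\<bar> < A * w" using A3 w by (simp add: pos_divide_less_eq)
    ultimately show False by simp
  qed
qed

end

section \<open>Transfer between the cap and the cone\<close>

lemma es_reindex:
  assumes "finite I" "inj_on g I"
  shows "es (g ` I) j x = es I j (\<lambda>i. x (g i))"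
  using assms
proof (induction I arbitrary: j)
  case empty
  thus ?case by (simp add: es_empty)
next
  case (insert a I)
  have "g a \<notin> g ` I" using insert by auto
  hence "es (g ` insert a I) j x = es (g ` I) j x + x (g a) * es (g ` I) (j - 1) x"
    using insert by (simp add: es_insert)
  also have "\<dots> = es (insert a I) j (\<lambda>i. x (g i))"
    using insert by (simp add: es_insert)
  finally show ?case .
qed

text \<open>Index 0 stands for the radial eigenvalue 0; removing it leaves the \<open>n\<close>
  eigenvalues of \<open>W\<close>.\<close>

lemma esym_shift:
  assumes "x 0 = 0"
  shows "es {..<Suc n} (int j) x = esym n j (\<lambda>i. x (Suc i))"
proof -
  have "es {..<Suc n} (int j) x = es ({..<Suc n} - {0}) (int j) x"
    using es_remove[of "{..<Suc n}" 0 "int j" x] assms by simp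
  also have "{..<Suc n} - {0} = Suc ` {..<n}" by (auto simp: image_iff lessThan_Suc_eq_insert_0)
  also have "es (Suc ` {..<n}) (int j) x = es {..<n} (int j) (\<lambda>i. x (Suc i))" by (rule es_reindex) auto
  also have "\<dots> = esym n j (\<lambda>i. x (Suc i))" by (simp add: es_def esym_def)
  finally show ?thesis .
qed

lemma Wform_eq_hext:
  assumes U: "open U" "Ck 2 U f" and y: "norm y = 1" "y - cos \<theta> *\<^sub>R b \<in> U" and uv: "y \<bullet> u = 0" "y \<bullet> v = 0"
  shows "Wform b \<theta> f (y - cos \<theta> *\<^sub>R b) u v = dr v (dr u (hext (cos \<theta>) b f)) y"
  using D2_hext[OF assms] by (simp add: Wform_def sphHess_def D2_def Dd_def capN_def)

text \<open>With the outward conormal \<open>\<mu>\<close> one has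
  \<open>b = cos \<theta> *R y - sin \<theta> *R \<mu>\<close> on the boundary, and the radial
  derivative of the extension is \<open>f\<close> by homogeneity. The Robin condition for
  \<open>h\<close> therefore becomes a homogeneous Neumann condition.\<close>

lemma dr_hext_boundary:
  assumes U: "open U" "Ck (Suc j) U f" and y: "norm y = 1" "y \<bullet> b = cos \<theta>" "y - cos \<theta> *\<^sub>R b \<in> U"
    and b: "norm b = 1" and th: "0 < \<theta>" "\<theta> < pi / 2"
  shows "dr b (hext (cos \<theta>) b f) y = cos \<theta> * f (y - cos \<theta> *\<^sub>R b)
    - sin \<theta> * Dd f (y - cos \<theta> *\<^sub>R b) (conormal b \<theta> (y - cos \<theta> *\<^sub>R b))"
proof -
  let ?\<xi> = "y - cos \<theta> *\<^sub>R b"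
  have sin: "sin \<theta> > 0" using th by (intro sin_gt_zero) auto
  have bb: "b \<bullet> b = 1" and yy: "y \<bullet> y = 1" using b y by (auto simp: norm_eq_1)
  have N: "capN b \<theta> ?\<xi> = y" by (simp add: capN_def)
  let ?t = "- b + cos \<theta> *\<^sub>R y"
  have "?t \<bullet> ?t = 1 - (cos \<theta>)\<^sup>2"
    using bb yy y(2) inner_commute[of b y] by (simp add: inner_add_left inner_add_right inner_diff_left inner_diff_right power2_eq_square)
  also have "\<dots> = (sin \<theta>)\<^sup>2" by (simp add: sin_squared_eq)
  finally have nt: "norm ?t = sin \<theta>" using sin by (simp add: norm_eq_sqrt_inner)
  have con: "conormal b \<theta> ?\<xi> = ?t /\<^sub>R sin \<theta>"
    unfolding conormal_def Let_def N using nt y(2) inner_commute[of b y] by simp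
  have l: "linear (\<lambda>u. dr u f ?\<xi>)" by (rule dr_linear[OF U y(3)])
  have "Dd f ?\<xi> (conormal b \<theta> ?\<xi>) = inverse (sin \<theta>) * dr ?t f ?\<xi>"
    unfolding con Dd_def using linear_scale[OF l, of "inverse (sin \<theta>)" ?t] by simp
  hence "sin \<theta> * Dd f ?\<xi> (conormal b \<theta> ?\<xi>) = dr ?t f ?\<xi>" using sin by simp
  also have "\<dots> = - dr b f ?\<xi> + cos \<theta> * dr y f ?\<xi>"
    using linear_add[OF l, of "- b" "cos \<theta> *\<^sub>R y"] linear_neg[OF l, of b] linear_scale[OF l, of "cos \<theta>" y] by simp
  finally have 1: "sin \<theta> * Dd f ?\<xi> (conormal b \<theta> ?\<xi>) = - dr b f ?\<xi> + cos \<theta> * dr y f ?\<xi>" .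
  have "y \<in> cdom (cos \<theta>) b U" using y by (auto simp: cdom_def proj_unit)
  from dr_hext[OF U this, of b] show ?thesis unfolding 1 using y by (simp add: proj_unit)
qed

lemma Ck_powr_pos:
  assumes "open V" "Ck 2 V f"
  shows "open {x \<in> V. f x > 0}" "Ck 2 {x \<in> V. f x > 0} (\<lambda>x. f x powr s)"
    "\<And>x u. x \<in> V \<Longrightarrow> f x > 0 \<Longrightarrow> Dd (\<lambda>x. f x powr s) x u = s * f x powr (s - 1) * Dd f x u"
proof -
  have "{x \<in> V. f x > 0} = V \<inter> f -` {0<..}" by auto
  thus o: "open {x \<in> V. f x > 0}"
    using continuous_open_preimage[OF Ck_continuous[OF assms(2)] assms(1), of "{0<..}"] by simp
  have C: "Ck 2 {x \<in> V. f x > 0} f" by (rule Ck_subset[OF assms(2)]) auto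
  show "Ck 2 {x \<in> V. f x > 0} (\<lambda>x. f x powr s)" by (rule Ck_powr[OF o C]) simp
  fix x u assume x: "x \<in> V" "f x > 0"
  have f1: "Ck (Suc 0) V f" by (rule Ck_mono[OF assms(2)]) simp
  have "((\<lambda>z. z powr s) has_real_derivative s * f x powr (s - 1)) (at (f x))"
    using x(2) by (rule has_real_derivative_powr)
  from has_derivative_compose[OF Ck_has_derivative[OF f1 assms(1) x(1)] this[unfolded has_field_derivative_def]]
  have "((\<lambda>x. f x powr s) has_derivative (\<lambda>u. s * f x powr (s - 1) * dr u f x)) (at x)" .
  from fun_cong[OF frechet_derivative_at[OF this], of u]
  show "Dd (\<lambda>x. f x powr s) x u = s * f x powr (s - 1) * Dd f x u" by (simp add: Dd_def)
qed

theorem theorem4p1: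
  fixes b :: "'a::euclidean_space" and \<theta> p :: real and k l :: nat
    and f h :: "'a \<Rightarrow> real" and U V :: "'a set"
  defines "n \<equiv> DIM('a) - 1"
  assumes b: "b \<in> Basis"
    and n2: "n \<ge> 2"
    and lk: "l < k" and kn: "k \<le> n - 1"
    and th: "0 < \<theta>" "\<theta> < pi / 2"
    and p: "p \<ge> 1"
    and V: "open V" "capC b \<theta> \<subseteq> V" "smooth_on_set V f"
    and fpos: "\<forall>\<xi>\<in>capC b \<theta>. f \<xi> > 0"
    and fconv: "\<forall>\<xi>\<in>capC b \<theta>. \<forall>u. tangent b \<theta> \<xi> u \<longrightarrow>
        Wform b \<theta> (\<lambda>x. f x powr (- 1 / (p + real k - real l - 1))) \<xi> u u \<ge> 0"
    and fbd: "\<forall>\<xi>\<in>capBd b \<theta>.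
        Dd f \<xi> (conormal b \<theta> \<xi>) + cot \<theta> * (p + real k - real l - 1) * f \<xi> \<ge> 0"
    and U: "open U" "capC b \<theta> \<subseteq> U" "Ck 4 U h"
    and hpos: "\<forall>\<xi>\<in>capC b \<theta>. h \<xi> > 0"
    and adm: "\<forall>\<xi>\<in>capC b \<theta>. \<forall>lam. eigvals b \<theta> (Wform b \<theta> h \<xi>) \<xi> lam \<longrightarrow> inGamma n k lam"
    and eq: "\<forall>\<xi>\<in>capC b \<theta>. \<forall>lam. eigvals b \<theta> (Wform b \<theta> h \<xi>) \<xi> lam \<longrightarrow>
        esym n k lam / esym n l lam = f \<xi> * h \<xi> powr (p - 1)"
    and hbd: "\<forall>\<xi>\<in>capBd b \<theta>. Dd h \<xi> (conormal b \<theta> \<xi>) = cot \<theta> * h \<xi>"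
    and psd: "\<forall>\<xi>\<in>capC b \<theta>. \<forall>u. tangent b \<theta> \<xi> u \<longrightarrow> Wform b \<theta> h \<xi> u u \<ge> 0"
  shows "\<forall>\<xi>\<in>capC b \<theta>. \<forall>u. tangent b \<theta> \<xi> u \<and> u \<noteq> 0 \<longrightarrow> Wform b \<theta> h \<xi> u u > 0"
proof -
  define c where "c = cos \<theta>"
  define \<gamma> where "\<gamma> = p - 1 + real (k - l)"
  have \<gamma>p: "\<gamma> > 0" using p lk by (simp add: \<gamma>_def)
  have \<gamma>eq: "p + real k - real l - 1 = \<gamma>" using lk by (simp add: \<gamma>_def of_nat_diff)
  \<comment> \<open>The function in the convexity hypothesis; \<open>f\<close> is the power
    \<open>- \<gamma>\<close> of it, which produces \<open>- \<gamma> * ln (Gh y)\<close> in the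
    logarithmic equation.\<close>
  define g where "g = (\<lambda>x. f x powr (- 1 / \<gamma>))"
  \<comment> \<open>The power of \<open>f\<close> is smooth where \<open>f\<close> is positive, and
    positivity is given on the cap only; the domain is shrunk accordingly.\<close>
  define V' where "V' = {x \<in> V. f x > 0}"
  have sin: "sin \<theta> > 0" using th by (intro sin_gt_zero) auto
  have c01: "0 < c" "c < 1"
  proof -
    show "0 < c" unfolding c_def using th by (intro cos_gt_zero) auto
    have "cos \<theta> < cos 0" using th by (intro cos_monotone_0_pi) auto
    thus "c < 1" by (simp add: c_def)
  qed
  have bn: "norm b = 1" using b by simp
  have d: "DIM('a) = Suc n" "1 < DIM('a)" using n2 by (auto simp: n_def)
  have Ckf: "Ck j V f" for j using V(3) by (simp add: smooth_on_set_def)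
  have oV': "open V'" unfolding V'_def by (rule Ck_powr_pos(1)[OF V(1) Ckf])
  have Ckg: "Ck 2 V' g" unfolding V'_def g_def by (rule Ck_powr_pos(2)[OF V(1) Ckf])
  have Dg: "Dd g x u = (- 1 / \<gamma>) * f x powr (- 1 / \<gamma> - 1) * Dd f x u" if "x \<in> V" "f x > 0" for x u
    unfolding g_def by (rule Ck_powr_pos(3)[OF V(1) Ckf that])
  have capV': "capC b \<theta> \<subseteq> V'" using V(2) fpos by (auto simp: V'_def)
  define H where "H = hext c b h"
  define Gh where "Gh = hext c b g"
  define \<Omega> where "\<Omega> = cdom c b U \<inter> cdom c b V'"
  have op: "open \<Omega>" unfolding \<Omega>_def by (intro open_Int open_cdom U(1) oV')
  interpret H4: homog4 \<Omega> H
  proof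
    show "open \<Omega>" by fact
    show "s *\<^sub>R y \<in> \<Omega>" if "s > 0" "y \<in> \<Omega>" for s y
      using that unfolding \<Omega>_def by (auto intro: cdom_scale)
    show "Ck 4 \<Omega> H" unfolding H_def by (rule Ck_subset[OF Ck_hext[OF U(1,3)]]) (simp add: \<Omega>_def)
    show "H (s *\<^sub>R y) = s * H y" if "s > 0" "y \<in> \<Omega>" for s y unfolding H_def by (rule hext_scale[OF that(1)])
  qed
  have CkG: "Ck 2 \<Omega> Gh" unfolding Gh_def by (rule Ck_subset[OF Ck_hext[OF oV' Ckg]]) (simp add: \<Omega>_def)
  have h2: "Ck 2 U h" and h1: "Ck (Suc 0) U h" by (rule Ck_mono[OF U(3)], simp)+
  have g1: "Ck (Suc 0) V' g" by (rule Ck_mono[OF Ckg]) simp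
  have capi: "y - c *\<^sub>R b \<in> capC b \<theta>" "capN b \<theta> (y - c *\<^sub>R b) = y" if "norm y = 1" "c \<le> y \<bullet> b" for y
    using that bn by (auto simp: capC_def capN_def c_def inner_diff_left norm_eq_1)
  have capU: "y - c *\<^sub>R b \<in> U" "y - c *\<^sub>R b \<in> V'" "y - c *\<^sub>R b \<in> V" if "norm y = 1" "c \<le> y \<bullet> b" for y
    using capi(1)[OF that] U(2) capV' V(2) by auto
  have WH: "H4.M y u v = Wform b \<theta> h (y - c *\<^sub>R b) u v"
    if "norm y = 1" "c \<le> y \<bullet> b" "y \<bullet> u = 0" "y \<bullet> v = 0" for y u v
    unfolding H4.M_def unfolding H_def c_def using Wform_eq_hext[OF U(1) h2, of y \<theta> b u v] capU(1)[OF that(1,2)] that by (simp add: c_def)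
  have Hv: "H y = h (y - c *\<^sub>R b)" "Gh y = g (y - c *\<^sub>R b)" if "norm y = 1" for y
    using that by (simp_all add: H_def Gh_def hext_def proj_unit)
  have normalize: "(y /\<^sub>R norm y) \<bullet> b \<ge> c" "norm (y /\<^sub>R norm y) = 1" if "y \<noteq> 0" "c * norm y \<le> y \<bullet> b" for y
    using that by (auto simp: field_simps)
  have dom: "y \<in> \<Omega>" if y: "y \<noteq> 0" "c * norm y \<le> y \<bullet> b" for y
    using capU[OF normalize(2)[OF y] normalize(1)[OF y]] y(1) by (simp add: \<Omega>_def cdom_def proj_def)
  have bdry: "y - c *\<^sub>R b \<in> capBd b \<theta>" if "norm y = 1" "y \<bullet> b = c" for y
    using capi(1)[of y] that bn by (simp add: capBd_def inner_diff_left norm_eq_1)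
  have key: "0 < esm DIM('a) (int k) (\<lambda>i j. H4.M y (e i) (e j)) \<and> 0 < esm DIM('a) (int l) (\<lambda>i j. H4.M y (e i) (e j)) \<and>
     ln (esm DIM('a) (int k) (\<lambda>i j. H4.M y (e i) (e j))) - ln (esm DIM('a) (int l) (\<lambda>i j. H4.M y (e i) (e j)))
        = (p - 1) * ln (H y) - \<gamma> * ln (Gh y)"
    if y: "y \<noteq> 0" "c * norm y \<le> y \<bullet> b" and e: "onb DIM('a) e" for y and e :: "nat \<Rightarrow> 'a"
  proof -
    define r where "r = norm y"
    define x where "x = y /\<^sub>R r"
    define \<xi> where "\<xi> = x - c *\<^sub>R b"
    have r: "r > 0" using y by (simp add: r_def)
    have yx: "y = r *\<^sub>R x" using r by (simp add: x_def)
    have x: "norm x = 1" "c \<le> x \<bullet> b" using normalize[OF y] by (auto simp: x_def r_def)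
    have \<xi>: "\<xi> \<in> capC b \<theta>" "capN b \<theta> \<xi> = x" using capi[OF x] by (auto simp: \<xi>_def)
    have xO: "x \<in> \<Omega>" by (rule dom) (use x in auto)
    have "\<exists>v. (\<forall>i<1. v i = (\<lambda>_::nat. x) i) \<and> onb DIM('a) v \<and>
      (\<forall>i<DIM('a). \<forall>w. H4.M x (v i) w = H4.M x (v i) (v i) * (v i \<bullet> w))"
    proof (rule eigenbasis_extend[OF H4.M_bilinear[OF xO] H4.M_sym[OF xO]])
      show "onb 1 (\<lambda>_. x)" using x by (simp add: onb_def norm_eq_1)
      show "H4.M x x w = H4.M x x x * (x \<bullet> w)" for w using H4.M_radial[OF xO] by simp
      show "1 \<le> DIM('a)" using d by simp
    qed
    then obtain v where v: "v 0 = x" "onb DIM('a) v" "\<And>i w. i < DIM('a) \<Longrightarrow> H4.M x (v i) w = H4.M x (v i) (v i) * (v i \<bullet> w)"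
      by auto
    define \<mu> where "\<mu> = (\<lambda>i. H4.M x (v i) (v i))"
    define lam where "lam = (\<lambda>i. \<mu> (Suc i))"
    have \<mu>0: "\<mu> 0 = 0" using H4.M_radial[OF xO] v(1) by (simp add: \<mu>_def)
    have vv: "v i \<bullet> v j = (if i = j then 1 else 0)" if "i < Suc n" "j < Suc n" for i j
      using v(2) that unfolding onb_def d(1) by blast
    have xv: "x \<bullet> v (Suc i) = 0" if "i < n" for i using vv[of 0 "Suc i"] that v(1) by simp
    have "eigvals b \<theta> (Wform b \<theta> h \<xi>) \<xi> lam"
      unfolding eigvals_def n_def[symmetric]
    proof (intro exI[of _ "\<lambda>i. v (Suc i)"] conjI allI impI)
      fix i assume i: "i < n"
      show "tangent b \<theta> \<xi> (v (Suc i))" using xv[OF i] by (simp add: tangent_def \<xi>(2) inner_commute)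
      fix j assume j: "j < n"
      show "v (Suc i) \<bullet> v (Suc j) = (if i = j then 1 else 0)" using vv[of "Suc i" "Suc j"] i j by simp
      have "Wform b \<theta> h \<xi> (v (Suc i)) (v (Suc j)) = H4.M x (v (Suc i)) (v (Suc j))"
        unfolding \<xi>_def by (rule WH[OF x xv[OF i] xv[OF j], symmetric])
      also have "\<dots> = \<mu> (Suc i) * (v (Suc i) \<bullet> v (Suc j))"
        using v(3)[of "Suc i" "v (Suc j)"] i by (simp add: \<mu>_def d(1))
      also have "\<dots> = (if i = j then lam i else 0)" using vv[of "Suc i" "Suc j"] i j by (simp add: lam_def)
      finally show "Wform b \<theta> h \<xi> (v (Suc i)) (v (Suc j)) = (if i = j then lam i else 0)" .
    qed
    \<comment> \<open>Admissibility and the equation are stated for every list of eigenvalues, so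
      the list of this eigenbasis can be inserted.\<close>
    hence Gam: "inGamma n k lam" and E: "esym n k lam / esym n l lam = f \<xi> * h \<xi> powr (p - 1)"
      using adm eq \<xi>(1) by blast+
    have sk: "esym n k lam > 0" using Gam lk unfolding inGamma_def by simp
    \<comment> \<open>Membership in the cone speaks about degrees from 1 on; degree 0 has the value
      1.\<close>
    have sl: "esym n l lam > 0"
    proof (cases "l = 0")
      case True
      have "esym n 0 lam = es {..<n} 0 lam" by (simp add: es_def esym_def)
      thus ?thesis using True by simp
    next
      case False thus ?thesis using Gam lk unfolding inGamma_def by simp
    qed
    \<comment> \<open>The Hessian of a function of degree one has degree -1, hence the factor
      \<open>inverse r ^ j\<close> for minors of order \<open>j\<close>.\<close>
    have esm: "esm DIM('a) (int j) (\<lambda>i i'. H4.M y (e i) (e i')) = inverse r ^ j * esym n j lam" if j: "j \<le> DIM('a)" for j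
    proof -
      have yO: "y \<in> \<Omega>" by (rule dom[OF y])
      have "H4.M y (v i) w = (inverse r * \<mu> i) * (v i \<bullet> w)" if "i < DIM('a)" for i w
      proof -
        have "H4.M y (v i) w = H4.M x (v i) w / r" unfolding yx by (rule H4.M_scale[OF r xO])
        also have "H4.M x (v i) w = \<mu> i * (v i \<bullet> w)" using v(3)[OF that, of w] by (simp only: \<mu>_def)
        finally show ?thesis by (simp add: divide_inverse)
      qed
      hence "esm DIM('a) (int j) (\<lambda>i i'. H4.M y (e i) (e i')) = es {..<DIM('a)} (int j) (\<lambda>i. inverse r * \<mu> i)"
        by (rule esm_eigenbasis[OF H4.M_bilinear[OF yO] v(2) _ e j])
      also have "\<dots> = inverse r ^ j * es {..<Suc n} (int j) \<mu>" unfolding d(1) by (rule es_scale) simp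
      also have "es {..<Suc n} (int j) \<mu> = esym n j lam" unfolding lam_def by (rule esym_shift[where x = \<mu>, OF \<mu>0])
      finally show ?thesis .
    qed
    have kd: "k \<le> DIM('a)" "l \<le> DIM('a)" using kn lk d by auto
    have pos: "0 < esm DIM('a) (int k) (\<lambda>i j. H4.M y (e i) (e j))" "0 < esm DIM('a) (int l) (\<lambda>i j. H4.M y (e i) (e j))"
      unfolding esm[OF kd(1)] esm[OF kd(2)] using r sk sl by simp_all
    have fh: "f \<xi> > 0" "h \<xi> > 0" using fpos hpos \<xi>(1) by auto
    have lnr: "ln (inverse r ^ j * s) = ln s - real j * ln r" if "s > 0" for s j
      using r that by (simp add: ln_mult ln_realpow ln_inverse)
    have "ln (esm DIM('a) (int k) (\<lambda>i j. H4.M y (e i) (e j))) - ln (esm DIM('a) (int l) (\<lambda>i j. H4.M y (e i) (e j)))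
      = ln (esym n k lam) - ln (esym n l lam) - real (k - l) * ln r"
      unfolding esm[OF kd(1)] esm[OF kd(2)] lnr[OF sk] lnr[OF sl] using lk by (simp add: of_nat_diff left_diff_distrib)
    also have "ln (esym n k lam) - ln (esym n l lam) = ln (f \<xi> * h \<xi> powr (p - 1))"
      unfolding E[symmetric] by (rule ln_divide_pos[OF sk sl, symmetric])
    also have "\<dots> = ln (f \<xi>) + (p - 1) * ln (h \<xi>)"
      using fh by (simp add: ln_mult ln_powr)
    finally have L: "ln (esm DIM('a) (int k) (\<lambda>i j. H4.M y (e i) (e j))) - ln (esm DIM('a) (int l) (\<lambda>i j. H4.M y (e i) (e j)))
      = ln (f \<xi>) + (p - 1) * ln (h \<xi>) - real (k - l) * ln r" .
    have "H y = r * h \<xi>" unfolding yx H_def using hext_scale[OF r, of c b h x] Hv(1)[OF x(1)] by (simp add: H_def \<xi>_def)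
    hence lH: "ln (H y) = ln r + ln (h \<xi>)" using r fh by (simp add: ln_mult)
    have "Gh y = r * g \<xi>" unfolding yx Gh_def using hext_scale[OF r, of c b g x] Hv(2)[OF x(1)] by (simp add: Gh_def \<xi>_def)
    hence lG: "ln (Gh y) = ln r - ln (f \<xi>) / \<gamma>" using r fh by (simp add: ln_mult g_def ln_powr)
    have "\<gamma> * ln (Gh y) = \<gamma> * ln r - ln (f \<xi>)" unfolding lG using \<gamma>p by (simp add: right_diff_distrib)
    \<comment> \<open>The powers of \<open>r\<close> on the two sides agree because
      \<open>\<gamma> - (p - 1) = k - l\<close>.\<close>
    hence "(p - 1) * ln (H y) - \<gamma> * ln (Gh y) = ln (f \<xi>) + (p - 1) * ln (h \<xi>) - real (k - l) * ln r"
      unfolding lH \<gamma>_def by (simp add: algebra_simps)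
    thus ?thesis using pos L by simp
  qed
  interpret C: capillary_cone \<Omega> H Gh b c p \<gamma> k l
  proof unfold_locales
    show "norm b = 1" by (fact bn)
    show "0 < c" "c < 1" by (fact c01)+
    show "l < k" by (fact lk)
    show "k < DIM('a)" using kn n2 d by linarith
    show "1 \<le> p" by (fact p)
    show "\<gamma> = p - 1 + real (k - l)" by (fact \<gamma>_def)
    show "y \<in> \<Omega>" if "y \<noteq> 0" "c * norm y \<le> y \<bullet> b" for y by (rule dom[OF that])
    show "Ck 2 \<Omega> Gh" by (fact CkG)
    fix y :: 'a assume y: "norm y = 1"
    {
      assume yb: "c \<le> y \<bullet> b"
      have \<xi>: "y - c *\<^sub>R b \<in> capC b \<theta>" by (rule capi(1)[OF y yb])
      show "0 < H y" using hpos \<xi> by (simp add: Hv[OF y])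
      have "f (y - c *\<^sub>R b) > 0" using fpos \<xi> by blast
      thus "0 < Gh y" by (simp add: Hv[OF y] g_def)
      fix v assume v: "y \<bullet> v = 0"
      have tan: "tangent b \<theta> (y - c *\<^sub>R b) v" using v by (simp add: tangent_def capi(2)[OF y yb] inner_commute)
      show "0 \<le> H4.M y v v" unfolding WH[OF y yb v v] using psd \<xi> tan by blast
      have "dr v (dr v Gh) y = Wform b \<theta> g (y - c *\<^sub>R b) v v"
        unfolding Gh_def c_def using Wform_eq_hext[OF oV' Ckg, of y \<theta> b v v] capU(2)[OF y yb] y v by (simp add: c_def)
      moreover have "0 \<le> Wform b \<theta> g (y - c *\<^sub>R b) v v"
        using fconv \<xi> tan unfolding \<gamma>eq g_def by blast
      ultimately show "0 \<le> dr v (dr v Gh) y" by simp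
    }
    {
      assume yb: "y \<bullet> b = c"
      hence yb': "c \<le> y \<bullet> b" by simp
      let ?\<xi> = "y - c *\<^sub>R b"
      have bd: "?\<xi> \<in> capBd b \<theta>" by (rule bdry[OF y yb])
      have fx: "f ?\<xi> > 0" using fpos capi(1)[OF y yb'] by blast
      have sc: "sin \<theta> * cot \<theta> = c" using sin by (simp add: cot_def c_def)
      have "dr b H y = c * h ?\<xi> - sin \<theta> * Dd h ?\<xi> (conormal b \<theta> ?\<xi>)"
        unfolding H_def c_def
        by (rule dr_hext_boundary[OF U(1) h1 y _ _ bn th]) (use yb capU(1)[OF y yb'] in \<open>simp_all add: c_def\<close>)
      also have "sin \<theta> * Dd h ?\<xi> (conormal b \<theta> ?\<xi>) = (sin \<theta> * cot \<theta>) * h ?\<xi>" using hbd bd by simp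
      finally show "dr b H y = 0" by (simp add: sc)
      have gx: "g ?\<xi> > 0" using fx by (simp add: g_def)
      have Dg': "Dd g ?\<xi> w = - (1 / \<gamma>) * (g ?\<xi> / f ?\<xi>) * Dd f ?\<xi> w" for w
        using Dg[OF capU(3)[OF y yb'] fx, of w] fx by (simp add: g_def powr_diff)
      \<comment> \<open>Shows that the inward derivative of \<open>Gh\<close> is a positive multiple
        of the quantity in the boundary hypothesis on \<open>f\<close>.\<close>
      have alg: "(s * ct) * gg - s * (- (1 / \<gamma>) * (gg / ff) * A) = (s / \<gamma>) * (gg / ff) * (A + ct * \<gamma> * ff)"
        if "ff > 0" for s ct gg ff A :: real using that \<gamma>p by (simp add: field_simps)
      have "dr b Gh y = c * g ?\<xi> - sin \<theta> * Dd g ?\<xi> (conormal b \<theta> ?\<xi>)"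
        unfolding Gh_def c_def
        by (rule dr_hext_boundary[OF oV' g1 y _ _ bn th]) (use yb capU(2)[OF y yb'] in \<open>simp_all add: c_def\<close>)
      also have "\<dots> = (sin \<theta> / \<gamma>) * (g ?\<xi> / f ?\<xi>) * (Dd f ?\<xi> (conormal b \<theta> ?\<xi>) + cot \<theta> * \<gamma> * f ?\<xi>)"
        using alg[OF fx, of "sin \<theta>" "cot \<theta>" "g ?\<xi>" "Dd f ?\<xi> (conormal b \<theta> ?\<xi>)"] by (simp only: Dg' sc)
      also have "\<dots> \<ge> 0"
        using fbd bd sin \<gamma>p gx fx unfolding \<gamma>eq by (intro mult_nonneg_nonneg) auto
      finally show "0 \<le> dr b Gh y" .
    }
  next
    fix y :: 'a and e :: "nat \<Rightarrow> 'a"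
    assume "y \<noteq> 0" "c * norm y \<le> y \<bullet> b" "onb DIM('a) e"
    from key[OF this]
    show "0 < esm DIM('a) (int k) (\<lambda>i j. H4.M y (e i) (e j)) \<and> 0 < esm DIM('a) (int l) (\<lambda>i j. H4.M y (e i) (e j))"
      "ln (esm DIM('a) (int k) (\<lambda>i j. H4.M y (e i) (e j))) - ln (esm DIM('a) (int l) (\<lambda>i j. H4.M y (e i) (e j)))
        = (p - 1) * ln (H y) - \<gamma> * ln (Gh y)" by blast+
  qed
  show ?thesis
  proof (intro ballI allI impI)
    fix \<xi> u assume \<xi>: "\<xi> \<in> capC b \<theta>" and u: "tangent b \<theta> \<xi> u \<and> u \<noteq> 0"
    define y where "y = \<xi> + c *\<^sub>R b"
    have \<xi>y: "\<xi> = y - c *\<^sub>R b" by (simp add: y_def)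
    have y: "norm y = 1" "c \<le> y \<bullet> b"
      using \<xi> bn by (auto simp: capC_def y_def c_def inner_add_left norm_eq_1)
    have uy: "y \<bullet> u = 0" using u capi(2)[OF y] by (simp add: tangent_def \<xi>y inner_commute)
    have "H4.M y u u > 0" by (rule C.strict_convexity) (use y u uy in \<open>auto simp: C.cap_def\<close>)
    thus "Wform b \<theta> h \<xi> u u > 0" unfolding \<xi>y WH[OF y uy uy] .
  qed
qed

end
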